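(* Let $1<p<\infty$ and $p'=p/(p-1)$. Let $(X,d,\mu)$ be a complete metric measure space such that $\mu$ is doubling and the space supports a $(p,p)$-Poincaré inequality, and let $\Omega\subset X$ be a nonempty bounded open connected set with $\mu(X\setminus\Omega)>0$. Let $f\in L^{p'}(\Omega)$ and $g\in N^{1,p}(\Omega)$, and define $J:N^{1,p}(\Omega)\to\mathbb{R}$ by $$J(u):=\int_\Omega g_u^p\,d\mu-p\int_\Omega fu\,d\mu,$$ where $g_u$ is the minimal $p$-weak upper gradient of $u$ in $\Omega$. Then there exists a solution $u_0$ to the Dirichlet problem for the $p$-Poisson equation with source term $f$ and boundary data $g$, that is, there exists $u_0\in N^{1,p}(\Omega)$ such that $u_0-g\in N_0^{1,p}(\Omega)$ and $$J(u_0)=\inf\{J(u): u\in N^{1,p}(\Omega),\ u-g\in N_0^{1,p}(\Omega)\}.$$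
   Context: A metric measure space $(X,d,\mu)$ is a metric space with a Borel regular measure $\mu$; $B(x,r)$ is the open ball, and $u_E=\frac{1}{\mu(E)}\int_E u\,d\mu$ denotes the integral average when $0<\mu(E)<\infty$. The measure is doubling if there is $C_\mu\ge 1$ with $0<\mu(B(x,2r))\le C_\mu\mu(B(x,r))<\infty$ for all $x\in X$, $r>0$. Upper gradients: a Borel function $h:X\to[0,\infty]$ is an upper gradient of $u:X\to\mathbb{R}$ if $|u(\gamma(a))-u(\gamma(b))|\le\int_\gamma h\,ds$ for all nonconstant compact rectifiable curves $\gamma:[a,b]\to X$. It is a $p$-weak upper gradient if this holds for all such curves except a family of $p$-modulus zero, where the $p$-modulus of a curve family $\Gamma$ is $\inf\int_X\rho^p\,d\mu$ over Borel $\rho\ge0$ with $\int_\gamma\rho\,ds\ge1$ for all $\gamma\in\Gamma$. If $u$ has a $p$-weak upper gradient in $L^p(X)$, then there is a unique (up to a.e. equality) one with smallest $L^p$ norm, the minimal $p$-weak upper gradient $g_u$. Newtonian spaces: $u\in N^{1,p}(X)$ if $u\in L^p(X)$ and $u$ has a $p$-weak upper gradient in $L^p(X)$; $\|u\|_{N^{1,p}(X)}=\left(\int_X|u|^p+g_u^p\,d\mu\right)^{1/p}$. The space $N^{1,p}(\Omega)$ is defined in the same way with $\Omega$ (with restricted metric and measure) in place of $X$. $N_0^{1,p}(\Omega)$ consists of the restrictions to $\Omega$ of functions $u\in N^{1,p}(X)$ with $u=0$ in $X\setminus\Omega$ (such functions are identified with their zero extensions). Poincaré inequality: $X$ supports a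 $(p,p)$-Poincaré inequality if there are $C_P>0$ and $\lambda\ge1$ such that for every $u\in L^1(X)$, $x\in X$, $r>0$ and every upper gradient $h$ of $u$, $$\left(\frac{1}{\mu(B(x,r))}\int_{B(x,r)}|u-u_{B(x,r)}|^p\,d\mu\right)^{1/p}\le C_P\,r\left(\frac{1}{\mu(B(x,\lambda r))}\int_{B(x,\lambda r)}h^p\,d\mu\right)^{1/p}.$$ Here $g$ without subscript denotes the boundary data, while $g_u$ denotes the minimal $p$-weak upper gradient of $u$. *)

theory Defs
  imports "HOL-Analysis.Analysis"
begin

subsection \<open>Extended powers, Lebesgue classes, averages\<close>

definition epowr :: "ennreal \<Rightarrow> real \<Rightarrow> ennreal" where
  \<comment> \<open>only meaningful for positive exponents\<close>
  "epowr x q = (if x = \<infinity> then \<infinity> else ennreal (enn2real x powr q))"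

definition eLp_norm :: "real \<Rightarrow> 'a measure \<Rightarrow> ('a \<Rightarrow> ennreal) \<Rightarrow> ennreal" where
  "eLp_norm p M h = epowr (\<integral>\<^sup>+ x. epowr (h x) p \<partial>M) (1 / p)"

text \<open>Elements of \<open>Lp\<close> are functions, not classes of functions modulo null sets; this matters
  for Newtonian functions, which are defined pointwise.\<close>

definition Lp :: "real \<Rightarrow> 'a measure \<Rightarrow> ('a \<Rightarrow> real) set" where
  "Lp p M = {u \<in> borel_measurable M. eLp_norm p M (\<lambda>x. ennreal \<bar>u x\<bar>) < \<infinity>}"

definition average :: "'a measure \<Rightarrow> 'a set \<Rightarrow> ('a \<Rightarrow> real) \<Rightarrow> real" where
  "average M E u = (LINT x:E|M. u x) / measure M E"

subsection \<open>Metric measure spaces\<close>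

text \<open>A Borel regular outer measure is represented by its restriction to the Caratheodory
  measurable sets. That restriction is a complete measure, all Borel sets are measurable, and
  every measurable set has a Borel superset of the same measure.\<close>

definition borel_regular :: "'a::metric_space measure \<Rightarrow> bool" where
  "borel_regular M \<longleftrightarrow>
     complete_measure M \<and> space M = UNIV \<and> sets borel \<subseteq> sets M \<and>
     (\<forall>A\<in>sets M. \<exists>B\<in>sets borel. A \<subseteq> B \<and> emeasure M B = emeasure M A)"

definition doubling :: "'a::metric_space measure \<Rightarrow> bool" where
  "doubling M \<longleftrightarrow>
     (\<exists>C::real. C \<ge> 1 \<and> (\<forall>x. \<forall>r>0.
        0 < emeasure M (ball x (2 * r)) \<and>
        emeasure M (ball x (2 * r)) \<le> ennreal C * emeasure M (ball x r) \<and>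
        ennreal C * emeasure M (ball x r) < \<infinity>))"

subsection \<open>Rectifiable curves and line integrals\<close>

text \<open>A compact curve is a triple \<open>(a, b, \<gamma>)\<close>; only the values of \<open>\<gamma>\<close> on \<open>{a..b}\<close> matter.\<close>

type_synonym 'a curve = "real \<times> real \<times> (real \<Rightarrow> 'a)"

definition curve_length :: "real \<Rightarrow> real \<Rightarrow> (real \<Rightarrow> 'a::metric_space) \<Rightarrow> ennreal" where
  "curve_length a b \<gamma> =
     (SUP ts \<in> {ts. sorted ts \<and> set ts \<subseteq> {a..b}}.
        \<Sum>i<length ts - 1. ennreal (dist (\<gamma> (ts ! i)) (\<gamma> (ts ! Suc i))))"

definition rect_curves :: "'a::metric_space set \<Rightarrow> 'a curve set" where
  "rect_curves S = {(a, b, \<gamma>). a \<le> b \<and> continuous_on {a..b} \<gamma> \<and> \<gamma> ` {a..b} \<subseteq> S \<and>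
     \<not> \<gamma> constant_on {a..b} \<and> curve_length a b \<gamma> < \<infinity>}"

text \<open>The arc length parametrization of \<open>\<gamma>\<close>, defined on \<open>[0, curve_length a b \<gamma>]\<close>: its value at
  \<open>s\<close> is the point \<open>\<gamma> t\<close> for any \<open>t\<close> such that \<open>\<gamma>\<close> restricted to \<open>[a, t]\<close> has length \<open>s\<close>.\<close>

definition arc_param :: "real \<Rightarrow> real \<Rightarrow> (real \<Rightarrow> 'a::metric_space) \<Rightarrow> real \<Rightarrow> 'a" where
  "arc_param a b \<gamma> s = (THE y. \<exists>t\<in>{a..b}. curve_length a t \<gamma> = ennreal s \<and> y = \<gamma> t)"

definition curve_integral ::
  "'a::metric_space curve \<Rightarrow> ('a \<Rightarrow> ennreal) \<Rightarrow> ennreal" where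
  "curve_integral = (\<lambda>(a, b, \<gamma>) h.
     \<integral>\<^sup>+ s. h (arc_param a b \<gamma> s) * indicator {0..enn2real (curve_length a b \<gamma>)} s \<partial>lborel)"

subsection \<open>Upper gradients and Newtonian spaces\<close>

text \<open>Everything below is relative to a set \<open>S\<close>, regarded as a metric measure space of its own
  with the restricted metric and the restricted measure \<open>restrict_space M S\<close>: curves run in \<open>S\<close>,
  functions are Borel or measurable on \<open>S\<close>, and values outside \<open>S\<close> are irrelevant. The whole
  space is \<open>S = UNIV\<close>.\<close>

definition borel_fun_on :: "'a::metric_space set \<Rightarrow> ('a \<Rightarrow> ennreal) \<Rightarrow> bool" where
  "borel_fun_on S h \<longleftrightarrow> h \<in> borel_measurable (restrict_space borel S)"

definition ug_ineq ::
  "('a::metric_space \<Rightarrow> real) \<Rightarrow> ('a \<Rightarrow> ennreal) \<Rightarrow> 'a curve \<Rightarrow> bool" where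
  "ug_ineq u h = (\<lambda>(a, b, \<gamma>). ennreal \<bar>u (\<gamma> a) - u (\<gamma> b)\<bar> \<le> curve_integral (a, b, \<gamma>) h)"

definition upper_gradient ::
  "'a::metric_space set \<Rightarrow> ('a \<Rightarrow> real) \<Rightarrow> ('a \<Rightarrow> ennreal) \<Rightarrow> bool" where
  "upper_gradient S u h \<longleftrightarrow> borel_fun_on S h \<and> (\<forall>c\<in>rect_curves S. ug_ineq u h c)"

definition modulus ::
  "real \<Rightarrow> 'a::metric_space measure \<Rightarrow> 'a set \<Rightarrow> 'a curve set \<Rightarrow> ennreal" where
  "modulus p M S \<Gamma> =
     (INF \<rho> \<in> {\<rho>. borel_fun_on S \<rho> \<and> (\<forall>c\<in>\<Gamma>. 1 \<le> curve_integral c \<rho>)}.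
        \<integral>\<^sup>+ x. epowr (\<rho> x) p \<partial>(restrict_space M S))"

definition weak_upper_gradient ::
  "real \<Rightarrow> 'a::metric_space measure \<Rightarrow> 'a set \<Rightarrow> ('a \<Rightarrow> real) \<Rightarrow> ('a \<Rightarrow> ennreal) \<Rightarrow> bool" where
  "weak_upper_gradient p M S u h \<longleftrightarrow> borel_fun_on S h \<and>
     (\<exists>\<Gamma>\<subseteq>rect_curves S. modulus p M S \<Gamma> = 0 \<and> (\<forall>c\<in>rect_curves S - \<Gamma>. ug_ineq u h c))"

definition Lp_weak_upper_gradients ::
  "real \<Rightarrow> 'a::metric_space measure \<Rightarrow> 'a set \<Rightarrow> ('a \<Rightarrow> real) \<Rightarrow> ('a \<Rightarrow> ennreal) set" where
  "Lp_weak_upper_gradients p M S u =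
     {h. weak_upper_gradient p M S u h \<and> eLp_norm p (restrict_space M S) h < \<infinity>}"

text \<open>The minimal weak upper gradient is unique only up to null sets; an arbitrary
  representative is chosen.\<close>

definition minimal_wug ::
  "real \<Rightarrow> 'a::metric_space measure \<Rightarrow> 'a set \<Rightarrow> ('a \<Rightarrow> real) \<Rightarrow> 'a \<Rightarrow> ennreal" where
  "minimal_wug p M S u =
     (SOME h. h \<in> Lp_weak_upper_gradients p M S u \<and>
        (\<forall>k\<in>Lp_weak_upper_gradients p M S u.
           eLp_norm p (restrict_space M S) h \<le> eLp_norm p (restrict_space M S) k))"

definition newtonian ::
  "real \<Rightarrow> 'a::metric_space measure \<Rightarrow> 'a set \<Rightarrow> ('a \<Rightarrow> real) set" where
  "newtonian p M S = {u \<in> Lp p (restrict_space M S). Lp_weak_upper_gradients p M S u \<noteq> {}}"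

definition newtonian0 ::
  "real \<Rightarrow> 'a::metric_space measure \<Rightarrow> 'a set \<Rightarrow> ('a \<Rightarrow> real) set" where
  "newtonian0 p M \<Omega> =
     {v. \<exists>w\<in>newtonian p M UNIV. (\<forall>x. x \<notin> \<Omega> \<longrightarrow> w x = 0) \<and> (\<forall>x\<in>\<Omega>. v x = w x)}"

definition poincare :: "real \<Rightarrow> 'a::metric_space measure \<Rightarrow> bool" where
  "poincare p M \<longleftrightarrow>
     (\<exists>C l::real. C > 0 \<and> l \<ge> 1 \<and>
       (\<forall>u x r h. integrable M u \<and> r > 0 \<and> upper_gradient UNIV u h \<longrightarrow>
          epowr ((\<integral>\<^sup>+ y\<in>ball x r. epowr (ennreal \<bar>u y - average M (ball x r) u\<bar>) p \<partial>M)
                 / emeasure M (ball x r)) (1 / p)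
          \<le> ennreal (C * r) *
            epowr ((\<integral>\<^sup>+ y\<in>ball x (l * r). epowr (h y) p \<partial>M)
                   / emeasure M (ball x (l * r))) (1 / p)))"

subsection \<open>The Dirichlet problem\<close>

definition energy ::
  "real \<Rightarrow> 'a::metric_space measure \<Rightarrow> 'a set \<Rightarrow> ('a \<Rightarrow> real) \<Rightarrow> ('a \<Rightarrow> real) \<Rightarrow> real" where
  "energy p M \<Omega> f u =
     enn2real (\<integral>\<^sup>+ x. epowr (minimal_wug p M \<Omega> u x) p \<partial>(restrict_space M \<Omega>))
     - p * (LINT x|restrict_space M \<Omega>. f x * u x)"

definition admissible ::
  "real \<Rightarrow> 'a::metric_space measure \<Rightarrow> 'a set \<Rightarrow> ('a \<Rightarrow> real) \<Rightarrow> ('a \<Rightarrow> real) set" where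
  "admissible p M \<Omega> g = {u \<in> newtonian p M \<Omega>. (\<lambda>x. u x - g x) \<in> newtonian0 p M \<Omega>}"

text \<open>The infimum is taken in the extended reals, because \<open>Inf\<close> on the reals is unspecified
  for sets that are not bounded below.\<close>

definition dirichlet_solution ::
  "real \<Rightarrow> 'a::metric_space measure \<Rightarrow> 'a set \<Rightarrow> ('a \<Rightarrow> real) \<Rightarrow> ('a \<Rightarrow> real) \<Rightarrow> ('a \<Rightarrow> real) \<Rightarrow> bool"
  where
  "dirichlet_solution p M \<Omega> f g u0 \<longleftrightarrow>
     u0 \<in> admissible p M \<Omega> g \<and>
     ereal (energy p M \<Omega> f u0) = (INF u \<in> admissible p M \<Omega> g. ereal (energy p M \<Omega> f u))"

end

theory Submission
  imports Defs
begin

text \<open>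
  The solution is found by the direct method of the calculus of variations. The functional \<open>J\<close> is
  convex, because the average of two weak upper gradients is a weak upper gradient of the average,
  and it is coercive on the admissible functions: \<open>w = u - g\<close>, extended by zero, satisfies a Friedrichs
  inequality \<open>\<integral>\<bar>w\<bar>\<^sup>p \<le> C \<integral>h\<^sup>p\<close> (\<open>Friedrichs_inequality\<close>), which follows from the Poincare inequality on one
  ball that contains \<open>\<Omega>\<close> and a set of positive measure on which \<open>w\<close> vanishes. For this, the
  gradient of \<open>w\<close> must be controlled by gradients in \<open>\<Omega>\<close> alone: a weak upper gradient in \<open>\<Omega>\<close>, extended
  by zero, is one in the whole space (\<open>weak_upper_gradient_zero_extension\<close>).

  Instead of extracting weakly convergent subsequences and passing to convex combinations, strong
  convergence is obtained directly from uniform convexity of \<open>L\<^sup>p\<close>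
  (\<open>nn_abs_powr_midpoint_Cauchy\<close>): a sequence whose norms converge, and whose midpoints do not have
  asymptotically smaller norms, is a Cauchy sequence. This is used three times. The sets
  \<open>{u. J u \<le> inf J + 1/n}\<close> of near-minimizers are stable under midpoints; functions in them with almost
  smallest norm converge in \<open>L\<^sup>p\<close> (\<open>minimizing_sequence\<close>). Then the source terms converge, so the
  gradient terms converge as well, and their midpoints cannot be smaller because \<open>J\<close> is bounded below by its
  infimum; hence the minimal weak upper gradients of the sequence converge in \<open>L\<^sup>p\<close> too. Finally,
  the same argument for a fixed function shows that minimal weak upper gradients exist
  (\<open>minimal_wug\<close>).

  That the limit of the gradients is a weak upper gradient of the limit function is a form of the lemma of
  Fuglede (\<open>weak_upper_gradient_limit\<close>). The limit function has to be chosen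
  pointwise, as an upper limit of the sequence. The curves to be avoided are all those with infinite
  integral of a single function in \<open>L\<^sup>p\<close>, which dominates geometrically weighted errors. On all
  other curves the errors have integrals tending to zero, and the sequence is bounded at every point of the
  curve since it is bounded at one of them.
\<close>

section \<open>Length and arc length parametrization of rectifiable curves\<close>

fun poly_length :: "(real \<Rightarrow> 'a::metric_space) \<Rightarrow> real list \<Rightarrow> real" where
  "poly_length \<gamma> (s # t # ts) = dist (\<gamma> s) (\<gamma> t) + poly_length \<gamma> (t # ts)"
| "poly_length \<gamma> _ = 0"

lemma poly_length_nonneg: "0 \<le> poly_length \<gamma> ts"
  by (induction \<gamma> ts rule: poly_length.induct) auto

lemma poly_length_eq_sum:
  "ennreal (poly_length \<gamma> ts) = (\<Sum>i<length ts - 1. ennreal (dist (\<gamma> (ts ! i)) (\<gamma> (ts ! Suc i))))"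
proof (induction \<gamma> ts rule: poly_length.induct)
  case (1 \<gamma> s t ts)
  have "(\<Sum>i<length (s # t # ts) - 1. ennreal (dist (\<gamma> ((s # t # ts) ! i)) (\<gamma> ((s # t # ts) ! Suc i))))
     = (\<Sum>i<Suc (length ts). ennreal (dist (\<gamma> ((s # t # ts) ! i)) (\<gamma> ((s # t # ts) ! Suc i))))"
    by simp
  also have "\<dots> = ennreal (dist (\<gamma> s) (\<gamma> t)) +
      (\<Sum>i<length (t # ts) - 1. ennreal (dist (\<gamma> ((t # ts) ! i)) (\<gamma> ((t # ts) ! Suc i))))"
    by (subst sum.lessThan_Suc_shift) simp
  finally show ?case
    using 1 by (simp add: poly_length_nonneg ennreal_plus)
qed auto

lemma curve_length_eq_SUP:
  "curve_length a b \<gamma> = (SUP ts \<in> {ts. sorted ts \<and> set ts \<subseteq> {a..b}}. ennreal (poly_length \<gamma> ts))"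
  unfolding curve_length_def poly_length_eq_sum ..

lemma poly_length_append_shared:
  "poly_length \<gamma> (xs @ c # ys) = poly_length \<gamma> (xs @ [c]) + poly_length \<gamma> (c # ys)"
proof (induction xs)
  case (Cons x xs)
  then show ?case by (cases xs) auto
qed simp

lemma poly_length_insert: "poly_length \<gamma> (xs @ ys) \<le> poly_length \<gamma> (xs @ c # ys)"
proof (induction xs)
  case Nil
  then show ?case by (cases ys) auto
next
  case (Cons x xs)
  show ?case
  proof (cases xs)
    case Nil
    then show ?thesis
      using dist_triangle[of "\<gamma> x" _ "\<gamma> c"] by (cases ys) auto
  next
    case (Cons y zs)
    then show ?thesis using Cons.IH by auto
  qed
qed

text \<open>By the triangle inequality an additional vertex \<open>c\<close> can only lengthen an inscribed polygon, which
  then falls apart into two polygons.\<close>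

lemma poly_length_split:
  assumes "sorted ts"
  shows "poly_length \<gamma> ts \<le>
    poly_length \<gamma> (filter (\<lambda>t. t \<le> c) ts @ [c]) + poly_length \<gamma> (c # filter (\<lambda>t. c < t) ts)"
proof -
  have "ts = filter (\<lambda>t. t \<le> c) ts @ filter (\<lambda>t. c < t) ts"
    using assms
  proof (induction ts)
    case (Cons t ts)
    show ?case
    proof (cases "t \<le> c")
      case False
      then have "filter (\<lambda>t. t \<le> c) ts = []" "filter (\<lambda>t. c < t) ts = ts"
        using Cons.prems by (fastforce simp: filter_empty_conv filter_id_conv)+
      then show ?thesis using False by simp
    qed (use Cons in auto)
  qed simp
  then have "poly_length \<gamma> ts \<le> poly_length \<gamma> (filter (\<lambda>t. t \<le> c) ts @ c # filter (\<lambda>t. c < t) ts)"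
    using poly_length_insert by metis
  then show ?thesis
    unfolding poly_length_append_shared[of \<gamma> "filter (\<lambda>t. t \<le> c) ts" c "filter (\<lambda>t. c < t) ts"] .
qed

lemma poly_length_le_curve_length:
  "sorted ts \<Longrightarrow> set ts \<subseteq> {a..b} \<Longrightarrow> ennreal (poly_length \<gamma> ts) \<le> curve_length a b \<gamma>"
  unfolding curve_length_eq_SUP by (rule SUP_upper) auto

lemma curve_length_refl [simp]: "curve_length a a \<gamma> = 0"
proof -
  have "poly_length \<gamma> ts = 0" if "set ts \<subseteq> {a..a}" for ts
    using that by (induction \<gamma> ts rule: poly_length.induct) auto
  then show ?thesis
    unfolding curve_length_eq_SUP by (auto intro!: antisym SUP_least)
qed

lemma dist_le_curve_length:
  "a \<le> b \<Longrightarrow> ennreal (dist (\<gamma> a) (\<gamma> b)) \<le> curve_length a b \<gamma>"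
  using poly_length_le_curve_length[of "[a, b]" a b \<gamma>] by simp

text \<open>Polygons inscribed in the two parts join at \<open>c\<close>; conversely, every polygon inscribed in the whole
  curve can be cut at \<open>c\<close>.\<close>

lemma curve_length_add:
  assumes "a \<le> c" "c \<le> b"
  shows "curve_length a b \<gamma> = curve_length a c \<gamma> + curve_length c b \<gamma>"
proof (rule antisym)
  show "curve_length a b \<gamma> \<le> curve_length a c \<gamma> + curve_length c b \<gamma>"
    unfolding curve_length_eq_SUP[of a b]
  proof (rule SUP_least, clarify)
    fix ts :: "real list" assume ts: "sorted ts" "set ts \<subseteq> {a..b}"
    have "ennreal (poly_length \<gamma> ts) \<le> ennreal (poly_length \<gamma> (filter (\<lambda>t. t \<le> c) ts @ [c]))
       + ennreal (poly_length \<gamma> (c # filter (\<lambda>t. c < t) ts))"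
      using poly_length_split[OF ts(1)] by (simp add: poly_length_nonneg flip: ennreal_plus)
    also have "\<dots> \<le> curve_length a c \<gamma> + curve_length c b \<gamma>"
      using ts assms
      by (intro add_mono poly_length_le_curve_length) (auto simp: sorted_append sorted_wrt_filter)
    finally show "ennreal (poly_length \<gamma> ts) \<le> curve_length a c \<gamma> + curve_length c b \<gamma>" .
  qed
  have concat: "ennreal (poly_length \<gamma> xs) + ennreal (poly_length \<gamma> ys) \<le> curve_length a b \<gamma>"
    if xs: "sorted xs" "set xs \<subseteq> {a..c}" and ys: "sorted ys" "set ys \<subseteq> {c..b}" for xs ys
  proof -
    have "poly_length \<gamma> xs + poly_length \<gamma> ys \<le> poly_length \<gamma> (xs @ [c]) + poly_length \<gamma> (c # ys)"
      using poly_length_insert[of \<gamma> xs "[]" c] poly_length_insert[of \<gamma> "[]" ys c] by simp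
    then have "ennreal (poly_length \<gamma> xs) + ennreal (poly_length \<gamma> ys) \<le> ennreal (poly_length \<gamma> (xs @ c # ys))"
      using poly_length_append_shared[of \<gamma> xs c ys] by (simp add: poly_length_nonneg flip: ennreal_plus)
    also have "\<dots> \<le> curve_length a b \<gamma>"
      using xs ys assms by (intro poly_length_le_curve_length) (force simp: sorted_append)+
    finally show ?thesis .
  qed
  have "curve_length a c \<gamma> + ennreal (poly_length \<gamma> ys) \<le> curve_length a b \<gamma>"
    if "sorted ys" "set ys \<subseteq> {c..b}" for ys
    unfolding curve_length_eq_SUP[of a c]
    using that by (subst ennreal_SUP_add_left[symmetric]) (auto intro!: SUP_least concat exI[of _ "[]"])
  then have "(SUP ys \<in> {ts. sorted ts \<and> set ts \<subseteq> {c..b}}.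
      curve_length a c \<gamma> + ennreal (poly_length \<gamma> ys)) \<le> curve_length a b \<gamma>"
    by (auto intro!: SUP_least)
  moreover have "{ts. sorted ts \<and> set ts \<subseteq> {c..b}} \<noteq> {}"
    by (auto intro!: exI[of _ "[]"])
  ultimately show "curve_length a c \<gamma> + curve_length c b \<gamma> \<le> curve_length a b \<gamma>"
    unfolding curve_length_eq_SUP[of c b] by (simp add: ennreal_SUP_add_right)
qed


lemma poly_length_le:
  "(\<And>s t. s \<in> set ts \<Longrightarrow> t \<in> set ts \<Longrightarrow> dist (\<gamma> s) (\<gamma> t) \<le> e) \<Longrightarrow> 0 \<le> e \<Longrightarrow>
    poly_length \<gamma> ts \<le> real (length ts) * e"
proof (induction \<gamma> ts rule: poly_length.induct)
  case (1 \<gamma> s t ts)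
  have "dist (\<gamma> s) (\<gamma> t) \<le> e" "poly_length \<gamma> (t # ts) \<le> length (t # ts) * e"
    using 1 by auto
  then show ?case by (simp add: algebra_simps)
qed auto

text \<open>Constant curves are allowed here, so that all subcurves of a rectifiable curve are again
  rectifiable.\<close>

locale rectifiable =
  fixes a b :: real and \<gamma> :: "real \<Rightarrow> 'a::metric_space"
  assumes le: "a \<le> b" and cont: "continuous_on {a..b} \<gamma>" and finite_length: "curve_length a b \<gamma> < \<infinity>"
begin

definition len :: "real \<Rightarrow> real" where "len t = enn2real (curve_length a t \<gamma>)"

lemma curve_length_eq:
  assumes "a \<le> s" "s \<le> t" "t \<le> b"
  shows "curve_length s t \<gamma> = ennreal (len t - len s)" "len s \<le> len t"
proof -
  have b: "curve_length a b \<gamma> = curve_length a t \<gamma> + curve_length t b \<gamma>"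
    and t: "curve_length a t \<gamma> = curve_length a s \<gamma> + curve_length s t \<gamma>"
    using assms by (auto intro!: curve_length_add)
  have f: "curve_length a s \<gamma> < \<infinity>" "curve_length s t \<gamma> < \<infinity>"
    using finite_length unfolding b t by (auto simp: less_top)
  have e: "len t = len s + enn2real (curve_length s t \<gamma>)"
    using f unfolding len_def t by (simp add: enn2real_plus)
  then show "len s \<le> len t" by simp
  show "curve_length s t \<gamma> = ennreal (len t - len s)"
    using f e by (simp add: less_top)
qed

lemma len_a [simp]: "len a = 0"
  by (simp add: len_def)

lemma len_nonneg: "0 \<le> len t"
  by (simp add: len_def)

lemma dist_le_len:
  assumes "s \<in> {a..b}" "t \<in> {a..b}"
  shows "dist (\<gamma> s) (\<gamma> t) \<le> \<bar>len s - len t\<bar>"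
proof -
  have *: "dist (\<gamma> s) (\<gamma> t) \<le> len t - len s" if "s \<in> {a..b}" "t \<in> {a..b}" "s \<le> t" for s t
    using dist_le_curve_length[of s t \<gamma>] curve_length_eq[of s t] that by simp
  show ?thesis
    using *[of s t] *[of t s] assms by (cases "s \<le> t") (auto simp: dist_commute)
qed

text \<open>A polygon inscribed in the curve whose length almost equals that of the curve almost
  exhausts the length of the two parts outside a short interval \<open>[s, t]\<close>; what
  the polygon picks up inside consists of a bounded number of short edges.\<close>

lemma continuous_on_len: "continuous_on {a..b} len"
  unfolding continuous_on_iff
proof (intro ballI allI impI)
  fix s0 e :: real assume "s0 \<in> {a..b}" "0 < e"
  define e' where "e' = e / 2"
  have "0 < e'" using \<open>0 < e\<close> by (simp add: e'_def)
  have "\<exists>ts. sorted ts \<and> set ts \<subseteq> {a..b} \<and> len b - e' < poly_length \<gamma> ts"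
  proof (rule ccontr)
    assume "\<not> ?thesis"
    then have *: "poly_length \<gamma> ts \<le> len b - e'" if "sorted ts" "set ts \<subseteq> {a..b}" for ts
      using that by (auto simp: not_less)
    then have "curve_length a b \<gamma> \<le> ennreal (len b - e')"
      unfolding curve_length_eq_SUP by (auto intro!: SUP_least ennreal_leI)
    moreover have "curve_length a b \<gamma> = ennreal (len b)"
      using curve_length_eq[of a b] le by simp
    ultimately show False
      using *[of "[]"] \<open>0 < e'\<close> by simp
  qed
  then obtain ts where ts: "sorted ts" "set ts \<subseteq> {a..b}" "len b - e' < poly_length \<gamma> ts"
    by blast
  define h where "h = e' / (length ts + 3)"
  have "0 < h" using \<open>0 < e'\<close> by (simp add: h_def)
  obtain d where d: "0 < d" "\<And>s t. s \<in> {a..b} \<Longrightarrow> t \<in> {a..b} \<Longrightarrow> dist s t < d \<Longrightarrow> dist (\<gamma> s) (\<gamma> t) < h"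
    using compact_uniformly_continuous[OF cont compact_Icc] \<open>0 < h\<close>
    unfolding uniformly_continuous_on_def by (metis dist_commute)
  have short: "len t - len s < e" if st: "a \<le> s" "s \<le> t" "t \<le> b" "t - s < d" for s t
  proof -
    let ?lo = "filter (\<lambda>x. x \<le> s) ts" and ?up = "filter (\<lambda>x. s < x) ts"
    let ?mid = "s # filter (\<lambda>x. x \<le> t) ?up"
    have "poly_length \<gamma> ts \<le> poly_length \<gamma> (?lo @ [s]) + poly_length \<gamma> (s # ?up)"
      by (rule poly_length_split[OF ts(1)])
    also have "poly_length \<gamma> (s # ?up) \<le> poly_length \<gamma> (?mid @ [t]) + poly_length \<gamma> (t # filter (\<lambda>x. t < x) ?up)"
      using poly_length_split[of "s # ?up" \<gamma> t] ts(1) st by (auto simp: sorted_wrt_filter)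
    also have "poly_length \<gamma> (?lo @ [s]) \<le> len s"
    proof -
      have "ennreal (poly_length \<gamma> (?lo @ [s])) \<le> curve_length a s \<gamma>"
        using ts st by (intro poly_length_le_curve_length) (auto simp: sorted_append sorted_wrt_filter)
      then show ?thesis using st curve_length_eq[of a s] len_nonneg by simp
    qed
    also have "poly_length \<gamma> (t # filter (\<lambda>x. t < x) ?up) \<le> len b - len t"
    proof -
      have "ennreal (poly_length \<gamma> (t # filter (\<lambda>x. t < x) ?up)) \<le> curve_length t b \<gamma>"
        using ts st by (intro poly_length_le_curve_length) (auto simp: sorted_wrt_filter)
      then show ?thesis using st curve_length_eq[of t b] by simp
    qed
    also have "poly_length \<gamma> (?mid @ [t]) \<le> real (length (?mid @ [t])) * h"
    proof (rule poly_length_le)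
      fix x y assume "x \<in> set (?mid @ [t])" "y \<in> set (?mid @ [t])"
      then have "x \<in> {s..t}" "y \<in> {s..t}" using st by auto
      then have "x \<in> {a..b}" "y \<in> {a..b}" "dist x y < d" using st by (auto simp: dist_real_def)
      then show "dist (\<gamma> x) (\<gamma> y) \<le> h" using d(2) by (simp add: less_imp_le)
    qed (use \<open>0 < h\<close> in simp)
    also have "\<dots> \<le> (length ts + 2) * h"
      using \<open>0 < h\<close> length_filter_le[of "\<lambda>x. x \<le> t" ?up] length_filter_le[of "\<lambda>x. s < x" ts]
      by (intro mult_right_mono) auto
    also have "\<dots> < e'"
      using \<open>0 < e'\<close> by (simp add: h_def field_simps)
    finally have "poly_length \<gamma> ts < len s + (e' + (len b - len t))" by linarith
    then show ?thesis using ts(3) by (simp add: e'_def)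
  qed
  show "\<exists>d>0. \<forall>t\<in>{a..b}. dist t s0 < d \<longrightarrow> dist (len t) (len s0) < e"
  proof (intro exI conjI ballI impI)
    fix t assume t: "t \<in> {a..b}" "dist t s0 < d"
    then show "dist (len t) (len s0) < e"
      using short[of s0 t] short[of t s0] curve_length_eq(2)[of s0 t] curve_length_eq(2)[of t s0] \<open>s0 \<in> {a..b}\<close>
      by (cases "s0 \<le> t") (auto simp: dist_real_def)
  qed (rule d)
qed

text \<open>The definite description is justified because parameters with the same value of \<open>len\<close> belong
  to the same point: the length in between bounds the distance.\<close>

lemma arc_param_len:
  assumes "t \<in> {a..b}"
  shows "arc_param a b \<gamma> (len t) = \<gamma> t"
  unfolding arc_param_def
proof (rule the_equality)
  show "\<exists>t'\<in>{a..b}. curve_length a t' \<gamma> = ennreal (len t) \<and> \<gamma> t = \<gamma> t'"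
    using assms curve_length_eq[of a t] by (intro bexI[of _ t]) auto
next
  fix y assume "\<exists>t'\<in>{a..b}. curve_length a t' \<gamma> = ennreal (len t) \<and> y = \<gamma> t'"
  then obtain t' where t': "t' \<in> {a..b}" "curve_length a t' \<gamma> = ennreal (len t)" "y = \<gamma> t'" by auto
  then have "len t' = len t" by (simp add: len_def)
  then show "y = \<gamma> t" using dist_le_len[OF assms t'(1)] t' by simp
qed

lemma len_onto:
  assumes "s \<in> {0..len b}"
  obtains t where "t \<in> {a..b}" "len t = s"
  using IVT'[of len a s b] continuous_on_len assms le by auto

lemma arc_param_in: "s \<in> {0..len b} \<Longrightarrow> arc_param a b \<gamma> s \<in> \<gamma> ` {a..b}"
  by (metis len_onto arc_param_len imageI)

lemma continuous_on_arc_param: "continuous_on {0..len b} (arc_param a b \<gamma>)"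
proof -
  have "dist (arc_param a b \<gamma> s) (arc_param a b \<gamma> s') \<le> dist s s'"
    if "s \<in> {0..len b}" "s' \<in> {0..len b}" for s s'
    using that dist_le_len by (metis len_onto arc_param_len dist_real_def)
  then show ?thesis
    unfolding continuous_on_iff by (metis le_less_trans)
qed

lemma subcurve: "a \<le> c \<Longrightarrow> c \<le> d \<Longrightarrow> d \<le> b \<Longrightarrow> rectifiable c d \<gamma>"
  using cont curve_length_eq[of c d] by unfold_locales (auto elim: continuous_on_subset)

lemma arc_param_subcurve:
  assumes "a \<le> c" "c \<le> d" "d \<le> b" "s \<in> {0..len d - len c}"
  shows "arc_param c d \<gamma> s = arc_param a b \<gamma> (len c + s)"
proof -
  interpret sub: rectifiable c d \<gamma> using subcurve assms by blast
  have sub_len: "sub.len t = len t - len c" if "t \<in> {c..d}" for t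
    using curve_length_eq[of c t] that assms by (simp add: sub.len_def)
  then obtain t where t: "t \<in> {c..d}" "sub.len t = s"
    using sub.len_onto[of s] assms by auto
  then have "arc_param c d \<gamma> s = \<gamma> t" using sub.arc_param_len by auto
  moreover have "len c + s = len t" using sub_len t by simp
  ultimately show ?thesis using arc_param_len[of t] t assms by auto
qed

lemma measurable_arc_param [measurable]:
  assumes "\<gamma> ` {a..b} \<subseteq> S" "borel_fun_on S h" "0 \<le> r" "t \<le> len b"
  shows "(\<lambda>s. h (arc_param a b \<gamma> s) * indicator {r..t} s) \<in> borel_measurable borel"
proof -
  have "arc_param a b \<gamma> \<in> measurable (restrict_space borel {0..len b}) (restrict_space borel S)"
    using arc_param_in assms(1) continuous_on_arc_param
    by (intro measurable_restrict_space2 borel_measurable_continuous_on_restrict)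
       (auto simp: space_restrict_space)
  then have "(\<lambda>s. h (arc_param a b \<gamma> s)) \<in> borel_measurable (restrict_space borel {0..len b})"
    using assms(2) unfolding borel_fun_on_def by (rule measurable_compose)
  then have [measurable]: "(\<lambda>s. h (arc_param a b \<gamma> s) * indicator {0..len b} s) \<in> borel_measurable borel"
    by (subst (asm) borel_measurable_restrict_space_iff_ennreal) auto
  have "(\<lambda>s. h (arc_param a b \<gamma> s) * indicator {r..t} s) =
      (\<lambda>s. h (arc_param a b \<gamma> s) * indicator {0..len b} s * indicator {r..t} s)"
    using assms by (auto simp: indicator_def fun_eq_iff)
  then show ?thesis by simp
qed

text \<open>All integrals over subcurves are integrals of one function on the line, the pullback
  under the arc length parametrization of the whole curve.\<close>

lemma curve_integral_subcurve:
  assumes "a \<le> c" "c \<le> d" "d \<le> b" "\<gamma> ` {a..b} \<subseteq> S" "borel_fun_on S h"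
  shows "curve_integral (c, d, \<gamma>) h =
    (\<integral>\<^sup>+ s. h (arc_param a b \<gamma> s) * indicator {len c..len d} s \<partial>lborel)"
proof -
  have L: "enn2real (curve_length c d \<gamma>) = len d - len c"
    using curve_length_eq[of c d] assms by simp
  have [measurable]: "(\<lambda>s. h (arc_param a b \<gamma> s) * indicator {len c..len d} s) \<in> borel_measurable borel"
    using assms curve_length_eq(2)[of d b] by (intro measurable_arc_param) (auto intro: len_nonneg)
  have "(\<integral>\<^sup>+ s. h (arc_param a b \<gamma> s) * indicator {len c..len d} s \<partial>lborel) =
     (\<integral>\<^sup>+ s. h (arc_param a b \<gamma> (len c + 1 * s)) * indicator {len c..len d} (len c + 1 * s) \<partial>lborel)"
    by (subst nn_integral_real_affine[where c=1 and t="len c"]) auto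
  also have "\<dots> = (\<integral>\<^sup>+ s. h (arc_param c d \<gamma> s) * indicator {0..len d - len c} s \<partial>lborel)"
    using arc_param_subcurve[OF assms(1-3)] by (intro nn_integral_cong) (auto simp: indicator_def)
  finally show ?thesis by (simp add: curve_integral_def L)
qed

lemma curve_integral_eq:
  assumes "\<gamma> ` {a..b} \<subseteq> S" "borel_fun_on S h"
  shows "curve_integral (a, b, \<gamma>) h =
    (\<integral>\<^sup>+ s. h (arc_param a b \<gamma> s) * indicator {0..len b} s \<partial>lborel)"
  using curve_integral_subcurve[of a b] assms le by simp

lemma curve_integral_split:
  assumes "a \<le> c" "c \<le> b" "\<gamma> ` {a..b} \<subseteq> S" "borel_fun_on S h"
  shows "curve_integral (a, b, \<gamma>) h = curve_integral (a, c, \<gamma>) h + curve_integral (c, b, \<gamma>) h"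
proof -
  let ?f = "\<lambda>r t s. h (arc_param a b \<gamma> s) * indicator {r..t} s"
  have l: "0 \<le> len c" "len c \<le> len b"
    using curve_length_eq(2)[of c b] assms by (auto intro: len_nonneg)
  have "curve_integral (a, b, \<gamma>) h = (\<integral>\<^sup>+ s. ?f 0 (len c) s + ?f (len c) (len b) s \<partial>lborel)"
    unfolding curve_integral_eq[OF assms(3,4)]
    using AE_lborel_singleton[of "len c"] l
    by (intro nn_integral_cong_AE) (auto elim!: eventually_mono simp: indicator_def)
  also have "\<dots> = (\<integral>\<^sup>+ s. ?f 0 (len c) s \<partial>lborel) + (\<integral>\<^sup>+ s. ?f (len c) (len b) s \<partial>lborel)"
    using l assms by (intro nn_integral_add) (auto intro!: measurable_arc_param)
  finally show ?thesis
    using assms le by (simp add: curve_integral_subcurve)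
qed

lemma curve_integral_subcurve_le:
  assumes "a \<le> c" "c \<le> d" "d \<le> b" "\<gamma> ` {a..b} \<subseteq> S" "borel_fun_on S h"
  shows "curve_integral (c, d, \<gamma>) h \<le> curve_integral (a, b, \<gamma>) h"
  using curve_integral_subcurve[OF assms] curve_integral_eq[OF assms(4,5)]
    curve_length_eq(2)[of d b] len_nonneg[of c] assms
  by (auto intro!: nn_integral_mono simp: indicator_def)

text \<open>Dominated convergence: the intervals of arc length shrink to one point.\<close>

lemma curve_integral_shrinking:
  assumes sub: "\<gamma> ` {a..b} \<subseteq> S" "borel_fun_on S h" and fin: "curve_integral (a, b, \<gamma>) h < \<infinity>"
    and st: "\<And>n::nat. a \<le> s n" "\<And>n. s n \<le> t n" "\<And>n. t n \<le> b"
    and lim: "s \<longlonglongrightarrow> r" "t \<longlonglongrightarrow> r"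
  shows "(\<lambda>n. curve_integral (s n, t n, \<gamma>) h) \<longlonglongrightarrow> 0"
proof -
  let ?f = "\<lambda>n x. h (arc_param a b \<gamma> x) * indicator {len (s n)..len (t n)} x"
  have r: "r \<in> {a..b}"
    using st lim by (auto intro!: LIMSEQ_le_const[OF lim(1)] LIMSEQ_le_const2[OF lim(2)] exI[of _ 0])
  have tb: "len (t n) \<le> len b" for n
    using curve_length_eq(2)[of "t n" b] st(1-3)[of n] by auto
  have "s n \<in> {a..b}" "t n \<in> {a..b}" for n
    using st(1-3)[of n] by auto
  then have len_lim: "(\<lambda>n. len (s n)) \<longlonglongrightarrow> len r" "(\<lambda>n. len (t n)) \<longlonglongrightarrow> len r"
    using continuous_on_len r lim by (auto simp: continuous_on_sequentially comp_def)
  have "(\<lambda>n. \<integral>\<^sup>+ x. ?f n x \<partial>lborel) \<longlonglongrightarrow> (\<integral>\<^sup>+ x. 0 \<partial>(lborel :: real measure))"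
  proof (rule nn_integral_dominated_convergence[where
        w="\<lambda>x. h (arc_param a b \<gamma> x) * indicator {0..len b} x"])
    show "?f n \<in> borel_measurable lborel" for n
      using sub tb len_nonneg by (simp add: measurable_arc_param)
    show "(\<lambda>x. h (arc_param a b \<gamma> x) * indicator {0..len b} x) \<in> borel_measurable lborel"
      using sub by (simp add: measurable_arc_param)
    show "AE x in lborel. ?f n x \<le> h (arc_param a b \<gamma> x) * indicator {0..len b} x" for n
    proof (intro AE_I2)
      fix x show "?f n x \<le> h (arc_param a b \<gamma> x) * indicator {0..len b} x"
        using tb[of n] len_nonneg[of "s n"] by (auto simp: indicator_def)
    qed
    show "AE x in lborel. (\<lambda>n. ?f n x) \<longlonglongrightarrow> 0"
      using AE_lborel_singleton[of "len r"]
    proof eventually_elim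
      case (elim x)
      have "\<forall>\<^sub>F n in sequentially. x \<notin> {len (s n)..len (t n)}"
      proof (cases "x < len r")
        case True
        then show ?thesis
          using order_tendstoD(1)[OF len_lim(1) True] by (auto elim!: eventually_mono)
      next
        case False
        then have "len r < x" using elim by auto
        then show ?thesis
          using order_tendstoD(2)[OF len_lim(2) \<open>len r < x\<close>] by (auto elim!: eventually_mono)
      qed
      then show ?case
        by (rule tendsto_eventually[OF eventually_mono]) simp
    qed
    show "(\<integral>\<^sup>+ x. h (arc_param a b \<gamma> x) * indicator {0..len b} x \<partial>lborel) < \<infinity>"
      using fin curve_integral_eq[OF sub] by simp
  qed simp
  then show ?thesis
    using curve_integral_subcurve[OF st(1-3) sub] by simp
qed

end

section \<open>Curve integrals\<close>

lemma rect_curvesD: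
  assumes "(a, b, \<gamma>) \<in> rect_curves S"
  shows "rectifiable a b \<gamma>" "\<gamma> ` {a..b} \<subseteq> S"
  using assms by (auto simp: rect_curves_def rectifiable_def)

lemma rect_curves_subcurve:
  assumes "(a, b, \<gamma>) \<in> rect_curves S" "a \<le> c" "c \<le> d" "d \<le> b" "\<gamma> c \<noteq> \<gamma> d" "\<gamma> ` {c..d} \<subseteq> S'"
  shows "(c, d, \<gamma>) \<in> rect_curves S'"
proof -
  interpret rectifiable a b \<gamma> using rect_curvesD assms by blast
  interpret sub: rectifiable c d \<gamma> using subcurve assms by blast
  show ?thesis
    using sub.cont sub.finite_length assms unfolding rect_curves_def
    by (auto simp: constant_on_def) (metis atLeastAtMost_iff order_refl)
qed

lemma curve_integral_mono:
  assumes "c \<in> rect_curves S" "\<And>x. x \<in> S \<Longrightarrow> h x \<le> k x"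
  shows "curve_integral c h \<le> curve_integral c k"
proof -
  obtain a b \<gamma> where c: "c = (a, b, \<gamma>)" by (cases c) auto
  interpret rectifiable a b \<gamma> using rect_curvesD assms c by blast
  have "h (arc_param a b \<gamma> s) \<le> k (arc_param a b \<gamma> s)" if "s \<in> {0..len b}" for s
    using arc_param_in[OF that] rect_curvesD(2) assms c by blast
  then show ?thesis
    unfolding c curve_integral_def by (auto intro!: nn_integral_mono simp: indicator_def len_def)
qed

lemma curve_integral_cong:
  "c \<in> rect_curves S \<Longrightarrow> (\<And>x. x \<in> S \<Longrightarrow> h x = k x) \<Longrightarrow> curve_integral c h = curve_integral c k"
  by (intro antisym curve_integral_mono) auto

lemma borel_fun_on_add: "borel_fun_on S h \<Longrightarrow> borel_fun_on S k \<Longrightarrow> borel_fun_on S (\<lambda>x. h x + k x)"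
  and borel_fun_on_cmult: "borel_fun_on S h \<Longrightarrow> borel_fun_on S (\<lambda>x. r * h x)"
  and borel_fun_on_const [simp]: "borel_fun_on S (\<lambda>x. r)"
  unfolding borel_fun_on_def by auto

lemma
  assumes c: "c \<in> rect_curves S" and h: "borel_fun_on S h"
  shows curve_integral_add: "borel_fun_on S k \<Longrightarrow>
      curve_integral c (\<lambda>x. h x + k x) = curve_integral c h + curve_integral c k"
    and curve_integral_cmult: "curve_integral c (\<lambda>x. r * h x) = r * curve_integral c h"
proof -
  obtain a b \<gamma> where c_def: "c = (a, b, \<gamma>)" by (cases c) auto
  interpret rectifiable a b \<gamma> using rect_curvesD c c_def by blast
  have S: "\<gamma> ` {a..b} \<subseteq> S" using rect_curvesD c c_def by blast
  have m: "(\<lambda>s. k (arc_param a b \<gamma> s) * indicator {0..len b} s) \<in> borel_measurable lborel"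
    if "borel_fun_on S k" for k
    using measurable_arc_param[OF S that] by simp
  show "curve_integral c (\<lambda>x. h x + k x) = curve_integral c h + curve_integral c k"
    if "borel_fun_on S k"
    using that h S by (simp add: c_def curve_integral_eq borel_fun_on_add nn_integral_add m distrib_right)
  show "curve_integral c (\<lambda>x. r * h x) = r * curve_integral c h"
    using h S by (simp add: c_def curve_integral_eq borel_fun_on_cmult nn_integral_cmult m mult.assoc)
qed

text \<open>A nonconstant curve cannot run inside a set on which the function \<open>\<infinity>\<close> has finite
  curve integral, because its length is positive.\<close>

lemma curve_leaves_set:
  assumes "(a, b, \<gamma>) \<in> rect_curves S" and "curve_integral (a, b, \<gamma>) (\<lambda>x. top * indicator B x) < top"
  obtains t where "t \<in> {a..b}" "\<gamma> t \<notin> B"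
proof -
  interpret rectifiable a b \<gamma> using rect_curvesD assms by blast
  have "len b \<noteq> 0"
  proof
    assume 0: "len b = 0"
    have "len t = 0" if "t \<in> {a..b}" for t
      using curve_length_eq(2)[of t b] len_nonneg[of t] that 0 by simp
    then have "\<gamma> t = \<gamma> a" if "t \<in> {a..b}" for t
      using dist_le_len[of t a] that by simp
    then have "\<gamma> constant_on {a..b}" unfolding constant_on_def by blast
    then show False
      using assms(1) by (simp add: rect_curves_def)
  qed
  then have pos: "0 < len b" using len_nonneg[of b] by simp
  show ?thesis
  proof (rule ccontr)
    assume "\<not> thesis"
    then have "\<gamma> ` {a..b} \<subseteq> B" using that by blast
    then have "curve_integral (a, b, \<gamma>) (\<lambda>x. top * indicator B x) =
        (\<integral>\<^sup>+ s. top * indicator {0..len b} s \<partial>lborel)"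
      unfolding curve_integral_def prod.case len_def[symmetric]
      using subsetD[OF \<open>\<gamma> ` {a..b} \<subseteq> B\<close> arc_param_in]
      by (intro nn_integral_cong) (auto simp: indicator_def)
    also have "\<dots> = top * ennreal (len b)"
      using pos by (simp add: nn_integral_cmult_indicator)
    also have "\<dots> = top" using pos by (simp add: ennreal_top_mult)
    finally show False using assms(2) by simp
  qed
qed

section \<open>Powers, uniform convexity and convergence in \<open>L\<^sup>p\<close>\<close>

lemma epowr_top [simp]: "epowr \<infinity> q = \<infinity>" "epowr top q = top"
  by (simp_all add: epowr_def)

lemma epowr_ennreal [simp]: "0 \<le> r \<Longrightarrow> epowr (ennreal r) q = ennreal (r powr q)"
  by (simp add: epowr_def)

lemma epowr_0 [simp]: "epowr 0 q = 0"
  by (simp add: epowr_def)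

lemma epowr_mono: "0 \<le> q \<Longrightarrow> x \<le> y \<Longrightarrow> epowr x q \<le> epowr y q"
  by (cases x; cases y) (auto intro!: ennreal_leI powr_mono2 simp: top_unique)

lemma epowr_inverse: "p \<noteq> 0 \<Longrightarrow> epowr (epowr x p) (1 / p) = x" "p \<noteq> 0 \<Longrightarrow> epowr (epowr x (1 / p)) p = x"
  by (cases x; simp add: powr_powr)+

lemma epowr_le_iff: "0 < q \<Longrightarrow> epowr x q \<le> epowr y q \<longleftrightarrow> x \<le> y"
  using epowr_mono[of q x y] epowr_mono[of "1 / q" "epowr x q" "epowr y q"] by (auto simp: epowr_inverse)

lemma epowr_eq_top_iff: "epowr x q = top \<longleftrightarrow> x = top"
  by (cases x) auto

lemma epowr_less_top_iff: "epowr x q < top \<longleftrightarrow> x < top"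
  by (simp add: less_top[symmetric] epowr_eq_top_iff)

lemma epowr_cmult: "0 \<le> c \<Longrightarrow> epowr (ennreal c * x) q = ennreal (c powr q) * epowr x q"
  by (cases x; cases "c = 0")
     (auto simp: powr_mult ennreal_mult_top simp flip: ennreal_mult)

lemma measurable_epowr [measurable]:
  assumes [measurable]: "f \<in> borel_measurable N"
  shows "(\<lambda>x. epowr (f x) q) \<in> borel_measurable N"
proof -
  have [measurable]: "(\<lambda>x. q) \<in> borel_measurable N" by simp
  show ?thesis unfolding epowr_def by measurable
qed

lemma epowr_add_le:
  assumes "0 \<le> p"
  shows "epowr (x + y) p \<le> ennreal (2 powr p) * (epowr x p + epowr y p)"
proof -
  have "x + y \<le> ennreal 2 * max x y"
    using add_mono[of x "max x y" y "max x y"] by (simp add: mult_2)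
  then have "epowr (x + y) p \<le> ennreal (2 powr p) * epowr (max x y) p"
    using epowr_mono[OF assms] by (subst epowr_cmult[symmetric]) auto
  also have "\<dots> \<le> ennreal (2 powr p) * (epowr x p + epowr y p)"
    by (intro mult_left_mono) (auto simp: max_def)
  finally show ?thesis .
qed

lemma eLp_norm_less_top_iff: "eLp_norm p N h < top \<longleftrightarrow> (\<integral>\<^sup>+ x. epowr (h x) p \<partial>N) < top"
  by (simp add: eLp_norm_def epowr_less_top_iff)

lemma eLp_norm_le_iff:
  "0 < p \<Longrightarrow> eLp_norm p N h \<le> eLp_norm p N k \<longleftrightarrow>
     (\<integral>\<^sup>+ x. epowr (h x) p \<partial>N) \<le> (\<integral>\<^sup>+ x. epowr (k x) p \<partial>N)"
  by (simp add: eLp_norm_def epowr_le_iff)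

lemma Lp_iff:
  "u \<in> Lp p N \<longleftrightarrow> u \<in> borel_measurable N \<and> (\<integral>\<^sup>+ x. ennreal (\<bar>u x\<bar> powr p) \<partial>N) < top"
  by (simp add: Lp_def eLp_norm_less_top_iff)

text \<open>The difference of the two sides vanishes at \<open>t = 1\<close> and is strictly monotone in \<open>t\<close>.\<close>

lemma midpoint_powr_less:
  fixes t p :: real
  assumes "1 < p" "0 \<le> t" "t < 1"
  shows "((1 + t) / 2) powr p < (1 + t powr p) / 2"
proof -
  let ?f = "\<lambda>t::real. (1 + t powr p) / 2 - ((1 + t) / 2) powr p"
  have "?f 1 < ?f t"
  proof (rule DERIV_neg_imp_decreasing_open[OF assms(3)])
    fix x assume x: "t < x" "x < 1"
    have "(?f has_real_derivative p / 2 * (x powr (p - 1) - ((1 + x) / 2) powr (p - 1))) (at x)"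
      using x assms by (auto intro!: derivative_eq_intros simp: field_simps)
    moreover have "x powr (p - 1) < ((1 + x) / 2) powr (p - 1)"
      using x assms by (intro powr_less_mono2) auto
    ultimately show "\<exists>y. (?f has_real_derivative y) (at x) \<and> y < 0"
      using assms by (auto intro!: exI mult_pos_neg)
  qed (use assms in \<open>auto intro!: continuous_on_powr' continuous_on_diff continuous_on_divide continuous_on_add
      continuous_on_const continuous_on_id\<close>)
  then show ?thesis by simp
qed

text \<open>By homogeneity it suffices to compare \<open>1\<close> with \<open>t \<in> [-1, 1]\<close>. Where \<open>\<bar>1 - t\<bar>\<close> is not
  already small, the convexity gap is bounded below by compactness and strict convexity.\<close>

lemma uniform_convexity_pointwise:
  fixes p e :: real
  assumes p: "1 < p" and e: "0 < e"
  obtains C where "0 \<le> C" and "\<And>a b::real. \<bar>a - b\<bar> powr p + C * \<bar>(a + b) / 2\<bar> powr p \<le>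
      (e + C / 2) * (\<bar>a\<bar> powr p + \<bar>b\<bar> powr p)"
proof -
  define gap where "gap t = (1 + \<bar>t\<bar> powr p) / 2 - \<bar>(1 + t) / 2\<bar> powr p" for t :: real
  define K where "K = {t \<in> {-1..1}. e \<le> \<bar>1 - t\<bar> powr p}"
  have gap_pos: "0 < gap t" if t: "t \<in> {-1..<1}" for t
  proof (cases "t < 0")
    case True
    have "\<bar>(1 + t) / 2\<bar> powr p < (1 / 2) powr p"
      using t True p by (intro powr_less_mono2) auto
    also have "\<dots> \<le> 1 / 2"
      using powr_mono'[of 1 p "1/2"] p by simp
    also have "\<dots> \<le> (1 + \<bar>t\<bar> powr p) / 2" by simp
    finally show ?thesis by (simp add: gap_def)
  next
    case False
    then show ?thesis using midpoint_powr_less[of p t] p t by (simp add: gap_def)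
  qed
  have gap_nonneg: "0 \<le> gap t" if "t \<in> {-1..1}" for t
    using gap_pos[of t] that by (cases "t = 1") (auto simp: gap_def)
  obtain m where m: "0 < m" "\<And>t. t \<in> K \<Longrightarrow> m \<le> gap t"
  proof (cases "K = {}")
    case False
    have cont: "continuous_on A gap" "continuous_on A (\<lambda>t. \<bar>1 - t\<bar> powr p)" for A
      unfolding gap_def using p by (auto intro!: continuous_on_powr' continuous_on_diff continuous_on_divide continuous_on_add
          continuous_on_rabs continuous_on_const continuous_on_id)
    have "K = {-1..1} \<inter> (\<lambda>t. \<bar>1 - t\<bar> powr p) -` {e..}"
      by (auto simp: K_def)
    then have "compact K"
      using continuous_closed_preimage[OF cont(2)[of "{-1..1}"], of "{e..}"] compact_Int_closed[of "{-1..1}"]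
      by (metis closed_atLeast closed_atLeastAtMost compact_Icc inf.absorb_iff2 inf_le1)
    then obtain s where s: "s \<in> K" "\<And>t. t \<in> K \<Longrightarrow> gap s \<le> gap t"
      using continuous_attains_inf[OF _ False cont(1)] by blast
    have "s \<noteq> 1" using s(1) e by (auto simp: K_def)
    then have "0 < gap s" using s(1) gap_pos[of s] by (auto simp: K_def)
    then show ?thesis using that s by blast
  qed (use that[of 1] in auto)
  \<comment> \<open>On \<open>[-1, 1]\<close> the power \<open>\<bar>1 - t\<bar> powr p\<close> is at most \<open>2 powr p\<close>, so \<open>C * gap t\<close> dominates it on \<open>K\<close>.\<close>
  define C where "C = 2 powr p / m"
  have "0 \<le> C" using m by (simp add: C_def)
  have one: "\<bar>1 - t\<bar> powr p \<le> e * (1 + \<bar>t\<bar> powr p) + C * gap t" if t: "t \<in> {-1..1}" for t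
  proof (cases "t \<in> K")
    case True
    have "\<bar>1 - t\<bar> powr p \<le> 2 powr p" using t p by (intro powr_mono2) auto
    also have "\<dots> = C * m" using m by (simp add: C_def)
    also have "\<dots> \<le> C * gap t" using m True \<open>0 \<le> C\<close> by (intro mult_left_mono) auto
    also have "\<dots> \<le> e * (1 + \<bar>t\<bar> powr p) + C * gap t" using e by simp
    finally show ?thesis .
  next
    case False
    then have "\<bar>1 - t\<bar> powr p \<le> e * 1" using t by (auto simp: K_def)
    also have "\<dots> \<le> e * (1 + \<bar>t\<bar> powr p)" using e by (intro mult_left_mono) auto
    also have "\<dots> \<le> \<dots> + C * gap t" using gap_nonneg[OF t] \<open>0 \<le> C\<close> by simp
    finally show ?thesis .
  qed
  have main: "\<bar>a - b\<bar> powr p + C * \<bar>(a + b) / 2\<bar> powr p \<le> (e + C / 2) * (\<bar>a\<bar> powr p + \<bar>b\<bar> powr p)"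
    if ab: "\<bar>b\<bar> \<le> \<bar>a\<bar>" "a \<noteq> 0" for a b
  proof -
    define t where "t = b / a"
    have t: "t \<in> {-1..1}" "b = t * a" using ab by (auto simp: t_def abs_le_iff divide_simps)
    have "a - b = a * (1 - t)" "(a + b) / 2 = a * ((1 + t) / 2)" using t by (auto simp: algebra_simps)
    then have eq: "\<bar>a - b\<bar> powr p = \<bar>a\<bar> powr p * \<bar>1 - t\<bar> powr p"
      "\<bar>(a + b) / 2\<bar> powr p = \<bar>a\<bar> powr p * \<bar>(1 + t) / 2\<bar> powr p"
      "\<bar>b\<bar> powr p = \<bar>a\<bar> powr p * \<bar>t\<bar> powr p"
      using t by (simp_all only: abs_mult powr_mult abs_ge_zero mult.commute)
    have "\<bar>a\<bar> powr p * \<bar>1 - t\<bar> powr p \<le> \<bar>a\<bar> powr p * (e * (1 + \<bar>t\<bar> powr p) + C * gap t)"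
      using one[OF t(1)] by (intro mult_left_mono) auto
    then show ?thesis unfolding eq gap_def by (simp add: algebra_simps add_divide_distrib)
  qed
  show ?thesis
  proof (rule that[OF \<open>0 \<le> C\<close>])
    fix a b :: real
    consider "a = 0 \<and> b = 0" | "\<bar>b\<bar> \<le> \<bar>a\<bar>" "a \<noteq> 0" | "\<bar>a\<bar> \<le> \<bar>b\<bar>" "b \<noteq> 0" by linarith
    then show "\<bar>a - b\<bar> powr p + C * \<bar>(a + b) / 2\<bar> powr p \<le> (e + C / 2) * (\<bar>a\<bar> powr p + \<bar>b\<bar> powr p)"
    proof cases
      case 3
      then show ?thesis using main[of a b] by (simp add: abs_minus_commute add.commute)
    qed (use main in auto)
  qed
qed

lemma abs_midpoint_powr_le:
  fixes a b p :: real
  assumes "1 < p"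
  shows "\<bar>(a + b) / 2\<bar> powr p \<le> (\<bar>a\<bar> powr p + \<bar>b\<bar> powr p) / 2"
proof -
  have *: "\<bar>(a + b) / 2\<bar> powr p \<le> (\<bar>a\<bar> powr p + \<bar>b\<bar> powr p) / 2" if ab: "\<bar>b\<bar> \<le> \<bar>a\<bar>" "a \<noteq> 0" for a b
  proof -
    define t where "t = \<bar>b\<bar> / \<bar>a\<bar>"
    have t: "0 \<le> t" "t \<le> 1" "\<bar>b\<bar> = \<bar>a\<bar> * t" using ab by (auto simp: t_def)
    have "\<bar>(a + b) / 2\<bar> \<le> \<bar>a\<bar> * ((1 + t) / 2)" using t by (simp add: algebra_simps)
    then have "\<bar>(a + b) / 2\<bar> powr p \<le> \<bar>a\<bar> powr p * ((1 + t) / 2) powr p"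
      using assms t by (subst powr_mult[symmetric]) (auto intro!: powr_mono2)
    also have "\<dots> \<le> \<bar>a\<bar> powr p * ((1 + t powr p) / 2)"
      using midpoint_powr_less[of p t] assms t by (intro mult_left_mono) (cases "t = 1", auto)
    also have "\<dots> = (\<bar>a\<bar> powr p + \<bar>b\<bar> powr p) / 2"
      unfolding t(3) using t by (simp add: powr_mult algebra_simps)
    finally show ?thesis .
  qed
  consider "a = 0 \<and> b = 0" | "\<bar>b\<bar> \<le> \<bar>a\<bar>" "a \<noteq> 0" | "\<bar>a\<bar> \<le> \<bar>b\<bar>" "b \<noteq> 0" by linarith
  then show ?thesis
    by cases (use *[of b a] *[of a b] in \<open>auto simp: add.commute\<close>)
qed

lemma epowr_midpoint_le:
  assumes "1 < p"
  shows "epowr (ennreal (1 / 2) * x + ennreal (1 / 2) * y) p \<le> ennreal (1 / 2) * epowr x p + ennreal (1 / 2) * epowr y p"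
proof (cases "x = top \<or> y = top")
  case False
  then obtain a b where ab: "0 \<le> a" "x = ennreal a" "0 \<le> b" "y = ennreal b"
    by (metis ennreal_cases)
  then have "ennreal (1 / 2) * x + ennreal (1 / 2) * y = ennreal ((a + b) / 2)"
    by (simp add: add_divide_distrib del: ennreal_half flip: ennreal_mult ennreal_plus)
  moreover have "ennreal (1 / 2) * epowr x p + ennreal (1 / 2) * epowr y p = ennreal ((a powr p + b powr p) / 2)"
    using ab by (simp add: add_divide_distrib del: ennreal_half flip: ennreal_mult ennreal_plus)
  moreover have "((a + b) / 2) powr p \<le> (a powr p + b powr p) / 2"
    using abs_midpoint_powr_le[OF assms, of a b] ab by simp
  ultimately show ?thesis using ab by (simp add: ennreal_leI del: ennreal_half)
qed (auto simp: ennreal_mult_top)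

text \<open>Integrating the pointwise inequality bounds \<open>\<integral>\<bar>f n - f m\<bar>\<^sup>p\<close> by a small multiple of a bounded quantity
  plus a large multiple of the integrated convexity gap, and the hypotheses say that the latter tends
  to zero.\<close>

lemma nn_abs_powr_midpoint_Cauchy:
  fixes f :: "nat \<Rightarrow> 'a \<Rightarrow> real"
  assumes p: "1 < p" and [measurable]: "\<And>n. f n \<in> borel_measurable N"
    and A: "\<And>n. (\<integral>\<^sup>+ x. ennreal (\<bar>f n x\<bar> powr p) \<partial>N) = ennreal (A n)" "\<And>n. 0 \<le> A n" "A \<longlonglongrightarrow> L"
    and mid: "\<And>e. 0 < e \<Longrightarrow> \<exists>n0. \<forall>n\<ge>n0. \<forall>m\<ge>n0.
      ennreal (L - e) \<le> (\<integral>\<^sup>+ x. ennreal (\<bar>(f n x + f m x) / 2\<bar> powr p) \<partial>N)"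
    and "0 < e"
  shows "\<exists>n0. \<forall>n\<ge>n0. \<forall>m\<ge>n0. (\<integral>\<^sup>+ x. ennreal (\<bar>f n x - f m x\<bar> powr p) \<partial>N) \<le> ennreal e"
proof -
  have "0 \<le> L" using A(2,3) by (intro LIMSEQ_le_const[OF A(3)]) auto
  define e1 where "e1 = e / (2 * (2 * L + 2))"
  have "0 < e1" using \<open>0 \<le> L\<close> \<open>0 < e\<close> by (simp add: e1_def)
  obtain C where C: "0 \<le> C" "\<And>a b::real. \<bar>a - b\<bar> powr p + C * \<bar>(a + b) / 2\<bar> powr p \<le>
      (e1 + C / 2) * (\<bar>a\<bar> powr p + \<bar>b\<bar> powr p)"
    using uniform_convexity_pointwise[OF p \<open>0 < e1\<close>] by blast
  define e2 where "e2 = min 1 (e / (4 * (C + 1)))"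
  have e2: "0 < e2" "e2 \<le> 1" "2 * C * e2 \<le> e / 2"
  proof -
    show "0 < e2" "e2 \<le> 1" using C \<open>0 < e\<close> by (auto simp: e2_def)
    have "2 * C * e2 \<le> 2 * (C + 1) * (e / (4 * (C + 1)))"
      using C \<open>0 < e\<close> \<open>0 < e2\<close> by (intro mult_mono) (auto simp: e2_def)
    also have "\<dots> = e / 2" using C by (simp add: field_simps)
    finally show "2 * C * e2 \<le> e / 2" .
  qed
  obtain n1 where n1: "\<And>n m. n \<ge> n1 \<Longrightarrow> m \<ge> n1 \<Longrightarrow>
      ennreal (L - e2) \<le> (\<integral>\<^sup>+ x. ennreal (\<bar>(f n x + f m x) / 2\<bar> powr p) \<partial>N)"
    using mid[OF e2(1)] by blast
  obtain n2 where n2: "\<And>n. n \<ge> n2 \<Longrightarrow> A n < L + e2"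
    using order_tendstoD(2)[OF A(3), of "L + e2"] e2(1) by (auto simp: eventually_sequentially)
  have "(\<integral>\<^sup>+ x. ennreal (\<bar>f n x - f m x\<bar> powr p) \<partial>N) \<le> ennreal e"
    if nm: "n \<ge> max n1 n2" "m \<ge> max n1 n2" for n m
  proof -
    let ?d = "\<integral>\<^sup>+ x. ennreal (\<bar>f n x - f m x\<bar> powr p) \<partial>N"
    let ?m = "\<integral>\<^sup>+ x. ennreal (\<bar>(f n x + f m x) / 2\<bar> powr p) \<partial>N"
    have k: "0 \<le> e1 + C / 2" using C \<open>0 < e1\<close> by simp
    have "?d + ennreal C * ?m = (\<integral>\<^sup>+ x. ennreal (\<bar>f n x - f m x\<bar> powr p) +
        ennreal C * ennreal (\<bar>(f n x + f m x) / 2\<bar> powr p) \<partial>N)"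
      by (simp add: nn_integral_add nn_integral_cmult)
    also have "\<dots> \<le> (\<integral>\<^sup>+ x. ennreal (e1 + C / 2) * (ennreal (\<bar>f n x\<bar> powr p) + ennreal (\<bar>f m x\<bar> powr p)) \<partial>N)"
      using C k by (intro nn_integral_mono) (simp flip: ennreal_mult ennreal_plus)
    also have "\<dots> = ennreal (e1 + C / 2) * (ennreal (A n) + ennreal (A m))"
      by (simp add: nn_integral_add nn_integral_cmult A)
    also have "\<dots> = ennreal ((e1 + C / 2) * (A n + A m))"
      using k A(2) by (simp flip: ennreal_mult ennreal_plus)
    finally have 1: "?d + ennreal C * ?m \<le> ennreal ((e1 + C / 2) * (A n + A m))" .
    have "ennreal (C * (L - e2)) \<le> ennreal C * ?m"
      using n1[of n m] nm C(1) mult_left_mono[of "ennreal (L - e2)" ?m "ennreal C"]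
      by (simp add: ennreal_mult')
    with 1 have 2: "?d + ennreal (C * (L - e2)) \<le> ennreal ((e1 + C / 2) * (A n + A m))"
      by (meson add_left_mono order_trans)
    then have "?d < top"
      by (metis ennreal_less_top le_less_trans order_trans add_increasing2 zero_le order_refl)
    then obtain d where d: "0 \<le> d" "?d = ennreal d" by (cases ?d) auto
    have "(e1 + C / 2) * (A n + A m) \<le> (e1 + C / 2) * (2 * L + 2 * e2)"
      using n2[of n] n2[of m] nm k by (intro mult_left_mono) auto
    then have 3: "ennreal d + ennreal (C * (L - e2)) \<le> ennreal ((e1 + C / 2) * (2 * L + 2 * e2))"
      using 2 d by (metis ennreal_leI order_trans)
    have 4: "d + max 0 (C * (L - e2)) \<le> (e1 + C / 2) * (2 * L + 2 * e2)"
    proof -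
      have "ennreal (C * (L - e2)) = ennreal (max 0 (C * (L - e2)))" by (simp add: max_def ennreal_neg)
      then show ?thesis using 3 d(1) k \<open>0 \<le> L\<close> e2(1) by (simp flip: ennreal_plus)
    qed
    then have "d + C * (L - e2) \<le> (e1 + C / 2) * (2 * L + 2 * e2)" by linarith
    then have "d \<le> e1 * (2 * L + 2 * e2) + 2 * C * e2" by (simp add: algebra_simps)
    also have "e1 * (2 * L + 2 * e2) \<le> e1 * (2 * L + 2)"
      using e2 \<open>0 < e1\<close> by (intro mult_left_mono) auto
    also have "\<dots> = e / 2" using \<open>0 \<le> L\<close> by (simp add: e1_def field_simps)
    finally show ?thesis using d e2(3) by (simp add: ennreal_leI)
  qed
  then show ?thesis by blast
qed

lemma fast_Cauchy_subsequence:
  fixes D :: "nat \<Rightarrow> nat \<Rightarrow> ennreal"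
  assumes "\<And>e. 0 < e \<Longrightarrow> \<exists>n0. \<forall>n\<ge>n0. \<forall>m\<ge>n0. D n m \<le> ennreal e" and "\<And>n. 0 < \<delta> n"
  obtains \<phi> :: "nat \<Rightarrow> nat" where "strict_mono \<phi>" "\<And>n m. n \<le> m \<Longrightarrow> D (\<phi> n) (\<phi> m) \<le> ennreal (\<delta> n)"
proof -
  have "\<exists>\<phi>. \<forall>n. (\<forall>k\<ge>\<phi> n. \<forall>l\<ge>\<phi> n. D k l \<le> ennreal (\<delta> n)) \<and> \<phi> n < \<phi> (Suc n)"
  proof (rule dependent_nat_choice)
    show "\<exists>x. \<forall>k\<ge>x. \<forall>l\<ge>x. D k l \<le> ennreal (\<delta> 0)" using assms by blast
  next
    fix x n
    obtain n0 where "\<forall>k\<ge>n0. \<forall>l\<ge>n0. D k l \<le> ennreal (\<delta> (Suc n))" using assms by blast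
    then show "\<exists>y. (\<forall>k\<ge>y. \<forall>l\<ge>y. D k l \<le> ennreal (\<delta> (Suc n))) \<and> x < y"
      by (intro exI[of _ "max (Suc x) n0"]) auto
  qed
  then obtain \<phi> where \<phi>: "\<And>n k l. k \<ge> \<phi> n \<Longrightarrow> l \<ge> \<phi> n \<Longrightarrow> D k l \<le> ennreal (\<delta> n)" "\<And>n. \<phi> n < \<phi> (Suc n)"
    by blast
  then have "strict_mono \<phi>" by (simp add: strict_mono_Suc_iff)
  then show ?thesis
    using that[of \<phi>] \<phi>(1) by (metis order_refl strict_mono_less_eq)
qed

text \<open>The rates below are chosen such that \<open>2^(n p)\<close> times the \<open>n\<close>-th one is still summable; the
  weighted sum of the \<open>p\<close>-th powers of the increments is then finite almost everywhere, so that
  these decay geometrically.\<close>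

lemma fast_Cauchy_AE_limit:
  fixes f :: "nat \<Rightarrow> 'a \<Rightarrow> real"
  assumes p: "1 < p" and [measurable]: "\<And>n. f n \<in> borel_measurable N"
    and Cauchy: "\<And>n m. n \<le> m \<Longrightarrow>
      (\<integral>\<^sup>+ x. ennreal (\<bar>f n x - f m x\<bar> powr p) \<partial>N) \<le> ennreal (2 powr (- (p + 1) * n))"
  shows "AE x in N. convergent (\<lambda>n. f n x)"
    and "\<And>n. (\<integral>\<^sup>+ x. ennreal (\<bar>f n x - lim (\<lambda>n. f n x)\<bar> powr p) \<partial>N) \<le> ennreal (2 powr (- (p + 1) * n))"
proof -
  let ?t = "\<lambda>n x. ennreal (2 powr (p * n) * \<bar>f n x - f (Suc n) x\<bar> powr p)"
  have "(\<integral>\<^sup>+ x. (\<Sum>n. ?t n x) \<partial>N) = (\<Sum>n. \<integral>\<^sup>+ x. ?t n x \<partial>N)"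
    by (rule nn_integral_suminf) simp
  also have "\<dots> \<le> (\<Sum>n. ennreal ((1 / 2) ^ n))"
  proof (intro suminf_le summableI)
    fix n
    have "(\<integral>\<^sup>+ x. ?t n x \<partial>N) = ennreal (2 powr (p * n)) * (\<integral>\<^sup>+ x. ennreal (\<bar>f n x - f (Suc n) x\<bar> powr p) \<partial>N)"
      by (simp add: ennreal_mult nn_integral_cmult)
    also have "\<dots> \<le> ennreal (2 powr (p * n)) * ennreal (2 powr (- (p + 1) * n))"
      by (intro mult_left_mono Cauchy) auto
    also have "\<dots> = ennreal (2 powr (- real n))"
      by (simp add: algebra_simps flip: ennreal_mult powr_add)
    also have "2 powr (- real n) = (1 / 2) ^ n"
      by (simp add: powr_minus powr_realpow power_one_over inverse_eq_divide)
    finally show "(\<integral>\<^sup>+ x. ?t n x \<partial>N) \<le> ennreal ((1 / 2) ^ n)" .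
  qed
  also have "\<dots> < top"
    by (subst suminf_ennreal2) (auto simp: summable_geometric)
  finally have "AE x in N. (\<Sum>n. ?t n x) \<noteq> \<infinity>"
    by (intro nn_integral_PInf_AE) auto
  then show conv: "AE x in N. convergent (\<lambda>n. f n x)"
  proof (rule AE_mp, intro AE_I2 impI)
    fix x assume "(\<Sum>n. ?t n x) \<noteq> \<infinity>"
    then obtain K where K: "0 \<le> K" "(\<Sum>n. ?t n x) = ennreal K"
      unfolding infinity_ennreal_def less_top less_top_ennreal by blast
    have "\<bar>f n x - f (Suc n) x\<bar> \<le> K powr (1 / p) * (1 / 2) ^ n" for n
    proof -
      have "T n \<le> suminf T" for T :: "nat \<Rightarrow> ennreal"
        using sum_le_suminf[OF summableI, of "{n}" T] by simp
      from this[of "\<lambda>n. ?t n x"] have "?t n x \<le> ennreal K" by (simp only: K(2))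
      then have "2 powr (p * n) * \<bar>f n x - f (Suc n) x\<bar> powr p \<le> K"
        using K(1) by simp
      then have "(2 powr (p * n) * \<bar>f n x - f (Suc n) x\<bar> powr p) powr (1 / p) \<le> K powr (1 / p)"
        using p by (intro powr_mono2) auto
      also have "(2 powr (p * n) * \<bar>f n x - f (Suc n) x\<bar> powr p) powr (1 / p) = 2 ^ n * \<bar>f n x - f (Suc n) x\<bar>"
        using p by (simp add: powr_mult powr_powr powr_realpow)
      finally show ?thesis by (simp add: field_simps)
    qed
    moreover have "summable (\<lambda>n. K powr (1 / p) * (1 / 2) ^ n :: real)"
      by (intro summable_mult summable_geometric) simp
    ultimately have "summable (\<lambda>n. f n x - f (Suc n) x)"
      using summable_comparison_test'[of "\<lambda>n. K powr (1 / p) * (1 / 2) ^ n" 0 "\<lambda>n. f n x - f (Suc n) x"]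
      by (simp only: real_norm_def)
    then have "convergent (\<lambda>n. \<Sum>i<n. f i x - f (Suc i) x)"
      by (simp add: summable_iff_convergent)
    then have "convergent (\<lambda>n. f 0 x - (\<Sum>i<n. f i x - f (Suc i) x))"
      by (intro convergent_diff convergent_const)
    then show "convergent (\<lambda>n. f n x)"
      by (simp add: sum_lessThan_telescope'[of "\<lambda>n. f n x"])
  qed
  show "(\<integral>\<^sup>+ x. ennreal (\<bar>f n x - lim (\<lambda>n. f n x)\<bar> powr p) \<partial>N) \<le> ennreal (2 powr (- (p + 1) * n))" for n
  proof -
    have "(\<integral>\<^sup>+ x. ennreal (\<bar>f n x - lim (\<lambda>n. f n x)\<bar> powr p) \<partial>N) =
        (\<integral>\<^sup>+ x. liminf (\<lambda>m. ennreal (\<bar>f n x - f m x\<bar> powr p)) \<partial>N)"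
    proof (rule nn_integral_cong_AE, use conv in eventually_elim)
      case (elim x)
      then have "(\<lambda>m. f m x) \<longlonglongrightarrow> lim (\<lambda>n. f n x)" by (simp add: convergent_LIMSEQ_iff)
      then have "(\<lambda>m. ennreal (\<bar>f n x - f m x\<bar> powr p)) \<longlonglongrightarrow> ennreal (\<bar>f n x - lim (\<lambda>n. f n x)\<bar> powr p)"
        using p by (intro tendsto_ennrealI tendsto_powr' tendsto_intros) auto
      then show ?case using lim_imp_Liminf[OF trivial_limit_sequentially] by metis
    qed
    also have "\<dots> \<le> liminf (\<lambda>m. \<integral>\<^sup>+ x. ennreal (\<bar>f n x - f m x\<bar> powr p) \<partial>N)"
      by (rule nn_integral_liminf) simp
    also have "\<dots> \<le> ennreal (2 powr (- (p + 1) * n))"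
      using Cauchy[of n] by (intro Liminf_le) (auto simp: eventually_sequentially)
    finally show ?thesis .
  qed
qed

text \<open>An upper limit of functions inherits an oscillation bound at two points even if the values converge
  at neither of them.\<close>

lemma limsup_diff_le:
  fixes x y :: "nat \<Rightarrow> real" and X Y H :: real
  assumes X: "ereal X = limsup (\<lambda>n. ereal (x n))" and Y: "ereal Y = limsup (\<lambda>n. ereal (y n))"
    and xy: "\<And>n. x n - y n \<le> H + t n" and t: "t \<longlonglongrightarrow> 0"
  shows "X - Y \<le> H"
proof (rule field_le_epsilon)
  fix e :: real assume "0 < e"
  have "\<forall>\<^sub>F n in sequentially. t n < e"
    using order_tendstoD(2)[OF t \<open>0 < e\<close>] .
  then have "\<forall>\<^sub>F n in sequentially. ereal (x n) \<le> ereal (y n) + ereal (H + e)"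
  proof eventually_elim
    case (elim n)
    then show ?case using xy[of n] by simp
  qed
  then have "ereal X \<le> limsup (\<lambda>n. ereal (y n) + ereal (H + e))"
    unfolding X by (rule Limsup_mono)
  also have "\<dots> = ereal Y + ereal (H + e)"
    unfolding Y by (rule Limsup_add_ereal_right) auto
  finally show "X - Y \<le> H + e" by simp
qed

lemma Bseq_const: "Bseq (\<lambda>n. c)" for c :: real
  by (intro convergent_imp_Bseq convergent_const)

lemma limsup_Bseq:
  fixes x :: "nat \<Rightarrow> real"
  assumes "Bseq x"
  shows "ereal (real_of_ereal (limsup (\<lambda>n. ereal (x n)))) = limsup (\<lambda>n. ereal (x n))"
proof -
  obtain K where K: "\<And>n. \<bar>x n\<bar> \<le> K" using assms by (auto simp: Bseq_def)
  have "limsup (\<lambda>n. ereal (x n)) \<le> ereal K"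
    using K by (intro Limsup_bounded always_eventually) (auto simp: abs_le_iff)
  moreover have "ereal (- K) \<le> limsup (\<lambda>n. ereal (x n))"
  proof (rule le_Limsup)
    have "- K \<le> x n" for n using K[of n] by linarith
    then show "\<forall>\<^sub>F n in sequentially. ereal (- K) \<le> ereal (x n)" by simp
  qed simp
  ultimately have "\<bar>limsup (\<lambda>n. ereal (x n))\<bar> \<noteq> \<infinity>" by auto
  then show ?thesis by (rule ereal_real')
qed

lemma restrict_space_UNIV [simp]: "restrict_space N UNIV = N"
  by (simp add: restrict_space_def measure_of_of_measure)

text \<open>The Young inequality in a form with a free scaling parameter \<open>t\<close>: a small \<open>t\<close> absorbs the
  integral of \<open>\<bar>v\<bar>\<^sup>p\<close>, a large one shows continuity in \<open>v\<close>.\<close>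

lemma Young_integral:
  fixes p :: real and f :: "'a \<Rightarrow> real"
  assumes p: "1 < p" and f: "f \<in> Lp (p / (p - 1)) N"
  obtains K where "0 \<le> K" and
    "\<And>v U. v \<in> borel_measurable N \<Longrightarrow> (\<integral>\<^sup>+ x. ennreal (\<bar>v x\<bar> powr p) \<partial>N) = ennreal U \<Longrightarrow> 0 \<le> U \<Longrightarrow>
      integrable N (\<lambda>x. f x * v x)"
    "\<And>v U t. v \<in> borel_measurable N \<Longrightarrow> (\<integral>\<^sup>+ x. ennreal (\<bar>v x\<bar> powr p) \<partial>N) = ennreal U \<Longrightarrow> 0 \<le> U \<Longrightarrow> 0 < t \<Longrightarrow>
      \<bar>LINT x|N. f x * v x\<bar> \<le> t powr (p - 1) * U + K / t"
proof -
  let ?q = "p / (p - 1)"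
  have [measurable]: "f \<in> borel_measurable N" using f by (simp add: Lp_iff)
  obtain K where K: "0 \<le> K" "(\<integral>\<^sup>+ x. ennreal (\<bar>f x\<bar> powr ?q) \<partial>N) = ennreal K"
    using f by (auto simp: Lp_iff less_top_ennreal)
  have bound: "(\<integral>\<^sup>+ x. ennreal (norm (f x * v x)) \<partial>N) \<le> ennreal (t powr (p - 1) * U + K / t)"
    if [measurable]: "v \<in> borel_measurable N" and U: "(\<integral>\<^sup>+ x. ennreal (\<bar>v x\<bar> powr p) \<partial>N) = ennreal U" "0 \<le> U"
      and t: "0 < t" for v U t
  proof -
    have "norm (f x * v x) \<le> t powr (p - 1) * \<bar>v x\<bar> powr p + 1 / t * \<bar>f x\<bar> powr ?q" for x
    proof -
      have "(t * \<bar>v x\<bar>) * \<bar>f x\<bar> \<le> (t * \<bar>v x\<bar>) powr p / p + \<bar>f x\<bar> powr ?q / ?q"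
        using p t by (intro Youngs_inequality) (auto simp: field_simps)
      also have "\<dots> \<le> (t * \<bar>v x\<bar>) powr p / 1 + \<bar>f x\<bar> powr ?q / 1"
        using p by (intro add_mono divide_left_mono) (auto simp: field_simps)
      also have "(t * \<bar>v x\<bar>) powr p = t * (t powr (p - 1) * \<bar>v x\<bar> powr p)"
        using t by (simp add: powr_mult powr_diff)
      finally show ?thesis using t by (simp add: abs_mult field_simps)
    qed
    then have "(\<integral>\<^sup>+ x. ennreal (norm (f x * v x)) \<partial>N) \<le>
        (\<integral>\<^sup>+ x. ennreal (t powr (p - 1)) * ennreal (\<bar>v x\<bar> powr p) + ennreal (1 / t) * ennreal (\<bar>f x\<bar> powr ?q) \<partial>N)"
      using t by (intro nn_integral_mono) (simp add: ennreal_leI flip: ennreal_mult ennreal_plus)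
    also have "\<dots> = ennreal (t powr (p - 1)) * ennreal U + ennreal (1 / t) * ennreal K"
      by (simp add: nn_integral_add nn_integral_cmult U K)
    also have "\<dots> = ennreal (t powr (p - 1) * U + K / t)"
      using t U K by (simp flip: ennreal_mult ennreal_plus)
    finally show ?thesis .
  qed
  show ?thesis
  proof (rule that[OF K(1)])
    fix v U assume v: "v \<in> borel_measurable N" "(\<integral>\<^sup>+ x. ennreal (\<bar>v x\<bar> powr p) \<partial>N) = ennreal U" "0 \<le> U"
    note [measurable] = v(1)
    show int: "integrable N (\<lambda>x. f x * v x)"
      using v(1) le_less_trans[OF bound[OF v, of 1] ennreal_less_top]
      by (intro integrableI_bounded) (auto simp: less_top)
    fix t :: real assume t: "0 < t"
    have "ennreal \<bar>LINT x|N. f x * v x\<bar> \<le> ennreal (t powr (p - 1) * U + K / t)"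
      using integral_norm_bound_ennreal[OF int] bound[OF v t] by simp
    moreover have "0 \<le> t powr (p - 1) * U + K / t" using t v(3) K(1) by simp
    ultimately show "\<bar>LINT x|N. f x * v x\<bar> \<le> t powr (p - 1) * U + K / t"
      using ennreal_le_iff by blast
  qed
qed

section \<open>Weak upper gradients and exceptional families of curves\<close>

locale regular_space =
  fixes M :: "'a::metric_space measure" and p :: real
  assumes regular: "borel_regular M" and p: "1 < p"
begin

abbreviation p_integral :: "'a set \<Rightarrow> ('a \<Rightarrow> ennreal) \<Rightarrow> ennreal" where
  "p_integral S h \<equiv> \<integral>\<^sup>+ x. epowr (h x) p \<partial>restrict_space M S"

lemma space_M: "space M = UNIV" and borel_sets: "B \<in> sets borel \<Longrightarrow> B \<in> sets M"
  using regular by (auto simp: borel_regular_def)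

lemma space_restrict: "space (restrict_space M S) = S"
  by (simp add: space_restrict_space space_M)

lemma borel_fun_measurable:
  assumes "borel_fun_on S h"
  shows "h \<in> borel_measurable (restrict_space M S)"
proof (rule measurableI)
  fix A :: "ennreal set" assume "A \<in> sets borel"
  then have "h -` A \<inter> S \<in> sets (restrict_space borel S)"
    using measurable_sets[OF assms[unfolded borel_fun_on_def]] by (simp add: space_restrict_space)
  then show "h -` A \<inter> space (restrict_space M S) \<in> sets (restrict_space M S)"
    using borel_sets by (auto simp: sets_restrict_space space_restrict)
qed simp

text \<open>The \<open>p\<close>-th root of a series of \<open>p\<close>-th powers replaces a sum or a supremum of functions:
  it dominates each of them, and the integral of its \<open>p\<close>-th power is a series of integrals.\<close>

lemma dominating_function:
  assumes h: "\<And>n. borel_fun_on S (h n)" and c: "\<And>n::nat. 0 \<le> c n"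
    and fin: "(\<Sum>n. ennreal (c n powr p) * p_integral S (h n)) < top"
  obtains R where "borel_fun_on S R" "p_integral S R < top"
    "\<And>n x. ennreal (c n) * h n x \<le> R x"
proof
  define Q where "Q x = (\<Sum>n. ennreal (c n powr p) * epowr (h n x) p)" for x
  let ?R = "\<lambda>x. epowr (Q x) (1 / p)"
  have [measurable]: "h n \<in> borel_measurable (restrict_space borel S)" for n
    using h by (simp add: borel_fun_on_def)
  have [measurable]: "h n \<in> borel_measurable (restrict_space M S)" for n
    using h by (rule borel_fun_measurable)
  show "borel_fun_on S ?R"
    unfolding borel_fun_on_def Q_def by measurable
  have "p_integral S ?R = (\<integral>\<^sup>+ x. Q x \<partial>restrict_space M S)"
    using p by (simp add: epowr_inverse)
  also have "\<dots> = (\<Sum>n. \<integral>\<^sup>+ x. ennreal (c n powr p) * epowr (h n x) p \<partial>restrict_space M S)"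
    unfolding Q_def by (rule nn_integral_suminf) simp
  also have "\<dots> = (\<Sum>n. ennreal (c n powr p) * p_integral S (h n))"
    by (simp add: nn_integral_cmult)
  finally show "p_integral S ?R < top" using fin by simp
  fix n x
  have "T n \<le> suminf T" for T :: "nat \<Rightarrow> ennreal"
    using sum_le_suminf[OF summableI, of "{n}" T] by simp
  then have "ennreal (c n powr p) * epowr (h n x) p \<le> Q x"
    unfolding Q_def .
  then have "epowr (epowr (ennreal (c n) * h n x) p) (1 / p) \<le> ?R x"
    using p c by (intro epowr_mono) (auto simp: epowr_cmult)
  then show "ennreal (c n) * h n x \<le> ?R x"
    using p by (simp add: epowr_inverse)
qed

lemma suminf_half_powers: "(\<Sum>n. ennreal ((1 / 2) ^ n)) < top"
  by (subst suminf_ennreal2) (auto simp: summable_geometric)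

text \<open>The weights \<open>c n\<close> are positive, hence finiteness of the integral of \<open>R\<close> passes to every \<open>\<rho> n\<close>; they
  are small enough for the series of integrals to converge.\<close>

lemma countable_domination:
  assumes \<rho>: "\<And>n::nat. borel_fun_on S (\<rho> n)" "\<And>n. p_integral S (\<rho> n) < top"
  obtains R where "borel_fun_on S R" "p_integral S R < top"
    "\<And>c n. c \<in> rect_curves S \<Longrightarrow> curve_integral c R < top \<Longrightarrow> curve_integral c (\<rho> n) < top"
proof -
  let ?I = "\<lambda>n. \<integral>\<^sup>+ x. epowr (\<rho> n x) p \<partial>restrict_space M S"
  define K where "K n = enn2real (?I n)" for n
  have K: "?I n = ennreal (K n)" "0 \<le> K n" for n
    using \<rho>(2)[of n] by (auto simp: K_def less_top)
  define c where "c n = ((1 / 2) ^ n / (K n + 1)) powr (1 / p)" for n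
  have c_pos: "0 < c n" for n
    using K(2)[of n] by (simp add: c_def)
  have "ennreal (c n powr p) * ?I n \<le> ennreal ((1 / 2) ^ n)" for n
  proof -
    have "c n powr p = (1 / 2) ^ n / (K n + 1)"
      using K(2)[of n] p by (simp add: c_def powr_powr)
    also have "\<dots> * K n \<le> (1 / 2) ^ n * 1"
      unfolding times_divide_eq_left times_divide_eq_right[symmetric]
      using K(2)[of n] by (intro mult_left_mono) auto
    finally have "ennreal (c n powr p * K n) \<le> ennreal ((1 / 2) ^ n)"
      by (intro ennreal_leI) simp
    then show ?thesis unfolding K(1) using K(2)[of n] by (simp add: ennreal_mult)
  qed
  then have "(\<Sum>n. ennreal (c n powr p) * ?I n) < top"
    using suminf_half_powers by (meson le_less_trans suminf_le summableI)
  then obtain R where R: "borel_fun_on S R" "p_integral S R < top"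
    "\<And>n x. ennreal (c n) * \<rho> n x \<le> R x"
    using dominating_function[of S \<rho> c] \<rho>(1) c_pos less_imp_le by metis
  have "curve_integral \<gamma> (\<rho> n) < top" if "\<gamma> \<in> rect_curves S" "curve_integral \<gamma> R < top" for \<gamma> n
  proof -
    have "ennreal (c n) * curve_integral \<gamma> (\<rho> n) \<le> curve_integral \<gamma> R"
      using curve_integral_cmult[OF that(1) \<rho>(1)] curve_integral_mono[OF that(1)] R(3) by metis
    then have "ennreal (c n) * curve_integral \<gamma> (\<rho> n) < top" using that(2) by simp
    then show ?thesis using c_pos[of n] by (auto simp: ennreal_mult_less_top)
  qed
  then show ?thesis using that R by blast
qed

text \<open>A family of curves is negligible for the modulus iff all its members have infinite integral
  with respect to a single \<open>L\<^sup>p\<close> function. In this form exceptional families are easy to pass to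
  countable unions and to subcurves.\<close>

lemma modulus_zeroE:
  assumes "\<Gamma> \<subseteq> rect_curves S" "modulus p M S \<Gamma> = 0"
  obtains R where "borel_fun_on S R" "p_integral S R < top"
    "\<And>c. c \<in> \<Gamma> \<Longrightarrow> curve_integral c R = top"
proof -
  have "\<exists>\<rho>. borel_fun_on S \<rho> \<and> (\<forall>c\<in>\<Gamma>. 1 \<le> curve_integral c \<rho>) \<and>
      p_integral S \<rho> < ennreal ((1 / 2) ^ n / (real n + 1) powr p)" for n
  proof -
    \<comment> \<open>The bound stays summable after multiplication with \<open>(n + 1) powr p\<close>, so that one function
      dominates \<open>(n + 1) * \<rho> n\<close> for all \<open>n\<close>.\<close>
    have "modulus p M S \<Gamma> < ennreal ((1 / 2) ^ n / (real n + 1) powr p)"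
      using assms(2) by simp
    then show ?thesis unfolding modulus_def INF_less_iff by blast
  qed
  then obtain \<rho> where \<rho>: "\<And>n. borel_fun_on S (\<rho> n)" "\<And>n c. c \<in> \<Gamma> \<Longrightarrow> 1 \<le> curve_integral c (\<rho> n)"
    "\<And>n. p_integral S (\<rho> n) < ennreal ((1 / 2) ^ n / (real n + 1) powr p)"
    by metis
  have "ennreal ((real n + 1) powr p) * p_integral S (\<rho> n) \<le> ennreal ((1 / 2) ^ n)" for n
  proof -
    have "ennreal ((real n + 1) powr p) * p_integral S (\<rho> n) \<le>
        ennreal ((real n + 1) powr p) * ennreal ((1 / 2) ^ n / (real n + 1) powr p)"
      using \<rho>(3)[of n] by (intro mult_left_mono less_imp_le) auto
    also have "\<dots> = ennreal ((1 / 2) ^ n)"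
      by (simp flip: ennreal_mult)
    finally show ?thesis .
  qed
  then have fin: "(\<Sum>n. ennreal ((real n + 1) powr p) * p_integral S (\<rho> n)) < top"
    using suminf_half_powers by (meson le_less_trans suminf_le summableI)
  obtain R where R: "borel_fun_on S R" "p_integral S R < top"
    "\<And>n x. ennreal (real n + 1) * \<rho> n x \<le> R x"
    by (rule dominating_function[of S \<rho> "\<lambda>n. real n + 1", OF \<rho>(1) _ fin]) auto
  have "curve_integral c R = top" if "c \<in> \<Gamma>" for c
  proof -
    have "ennreal (real n) \<le> curve_integral c R" for n
    proof -
      have "ennreal (real n) \<le> ennreal (real n + 1) * 1" by (simp add: ennreal_leI)
      also have "\<dots> \<le> ennreal (real n + 1) * curve_integral c (\<rho> n)"
        using \<rho>(2) that by (intro mult_left_mono) auto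
      also have "\<dots> = curve_integral c (\<lambda>x. ennreal (real n + 1) * \<rho> n x)"
        using that assms(1) \<rho>(1) by (subst curve_integral_cmult[of c S]) auto
      also have "\<dots> \<le> curve_integral c R"
        using that assms(1) R(3) by (intro curve_integral_mono[of c S]) auto
      finally show ?thesis .
    qed
    then show ?thesis
      using ennreal_Ex_less_of_nat[of "curve_integral c R"]
      by (metis ennreal_of_nat_eq_real_of_nat less_top linorder_not_less)
  qed
  then show ?thesis using that R by blast
qed

text \<open>Every positive multiple of \<open>R\<close>, however small, is an admissible test function for the modulus.\<close>

lemma modulus_zeroI:
  assumes "\<Gamma> \<subseteq> rect_curves S" "borel_fun_on S R" "p_integral S R < top"
    "\<And>c. c \<in> \<Gamma> \<Longrightarrow> curve_integral c R = top"
  shows "modulus p M S \<Gamma> = 0"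
proof -
  obtain K where K: "0 \<le> K" "p_integral S R = ennreal K"
    using assms(3) by (auto simp: less_top_ennreal)
  have [measurable]: "R \<in> borel_measurable (restrict_space M S)"
    using assms(2) by (rule borel_fun_measurable)
  have "modulus p M S \<Gamma> \<le> 0 + ennreal e" if "0 < e" for e
  proof -
    define r where "r = (e / (K + 1)) powr (1 / p)"
    have r: "0 < r" "r powr p = e / (K + 1)"
      using that K p by (auto simp: r_def powr_powr)
    have "modulus p M S \<Gamma> \<le> (\<integral>\<^sup>+ x. epowr (ennreal r * R x) p \<partial>restrict_space M S)"
      unfolding modulus_def
    proof (intro INF_lower CollectI conjI ballI)
      show "borel_fun_on S (\<lambda>x. ennreal r * R x)" using assms(2) by (rule borel_fun_on_cmult)
      fix c assume "c \<in> \<Gamma>"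
      then have "curve_integral c (\<lambda>x. ennreal r * R x) = ennreal r * top"
        using curve_integral_cmult[of c S R] assms by auto
      then show "1 \<le> curve_integral c (\<lambda>x. ennreal r * R x)" using r by (simp add: ennreal_mult_top)
    qed
    also have "\<dots> = ennreal (r powr p) * ennreal K"
      using r K by (simp add: epowr_cmult nn_integral_cmult)
    also have "\<dots> = ennreal (e / (K + 1) * K)"
      using r that K by (simp flip: ennreal_mult)
    also have "\<dots> \<le> ennreal e"
      using that K by (intro ennreal_leI) (simp add: field_simps)
    finally show ?thesis by simp
  qed
  then have "modulus p M S \<Gamma> \<le> 0" by (rule ennreal_le_epsilon) 
  then show ?thesis by simp
qed

text \<open>The upper gradient inequality is stated for all subcurves as well: their curve integrals
  are dominated by that of the whole curve.\<close>

lemma weak_upper_gradientE: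
  assumes "weak_upper_gradient p M S u h"
  obtains R where "borel_fun_on S R" "p_integral S R < top"
    "\<And>a b \<gamma> c d. (a, b, \<gamma>) \<in> rect_curves S \<Longrightarrow> curve_integral (a, b, \<gamma>) R < top \<Longrightarrow>
      a \<le> c \<Longrightarrow> c \<le> d \<Longrightarrow> d \<le> b \<Longrightarrow> ennreal \<bar>u (\<gamma> c) - u (\<gamma> d)\<bar> \<le> curve_integral (c, d, \<gamma>) h"
proof -
  obtain \<Gamma> where \<Gamma>: "\<Gamma> \<subseteq> rect_curves S" "modulus p M S \<Gamma> = 0" "\<And>c. c \<in> rect_curves S - \<Gamma> \<Longrightarrow> ug_ineq u h c"
    using assms by (auto simp: weak_upper_gradient_def)
  obtain R where R: "borel_fun_on S R" "p_integral S R < top"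
    "\<And>c. c \<in> \<Gamma> \<Longrightarrow> curve_integral c R = top"
    using modulus_zeroE[OF \<Gamma>(1,2)] by blast
  have "ennreal \<bar>u (\<gamma> c) - u (\<gamma> d)\<bar> \<le> curve_integral (c, d, \<gamma>) h"
    if ab: "(a, b, \<gamma>) \<in> rect_curves S" "curve_integral (a, b, \<gamma>) R < top" and cd: "a \<le> c" "c \<le> d" "d \<le> b"
    for a b \<gamma> c d
  proof (cases "\<gamma> c = \<gamma> d")
    case False
    have S: "\<gamma> ` {a..b} \<subseteq> S" using rect_curvesD ab by blast
    then have sub: "(c, d, \<gamma>) \<in> rect_curves S"
      using cd False by (intro rect_curves_subcurve[OF ab(1)]) auto
    have "curve_integral (c, d, \<gamma>) R \<le> curve_integral (a, b, \<gamma>) R"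
      by (rule rectifiable.curve_integral_subcurve_le[OF rect_curvesD(1)[OF ab(1)] cd S R(1)])
    then have "(c, d, \<gamma>) \<notin> \<Gamma>" using R(3) ab(2) by fastforce
    then show ?thesis using \<Gamma>(3)[of "(c, d, \<gamma>)"] sub by (simp add: ug_ineq_def)
  qed simp
  then show ?thesis using that R by blast
qed

lemma weak_upper_gradientI:
  assumes "borel_fun_on S h" "borel_fun_on S R" "p_integral S R < top"
    "\<And>a b \<gamma>. (a, b, \<gamma>) \<in> rect_curves S \<Longrightarrow> curve_integral (a, b, \<gamma>) R < top \<Longrightarrow>
      ennreal \<bar>u (\<gamma> a) - u (\<gamma> b)\<bar> \<le> curve_integral (a, b, \<gamma>) h"
  shows "weak_upper_gradient p M S u h"
  unfolding weak_upper_gradient_def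
proof (intro conjI exI[of _ "{c \<in> rect_curves S. curve_integral c R = top}"] ballI)
  show "modulus p M S {c \<in> rect_curves S. curve_integral c R = top} = 0"
    using assms(2,3) by (rule modulus_zeroI[rotated]) auto
  show "ug_ineq u h c" if "c \<in> rect_curves S - {c \<in> rect_curves S. curve_integral c R = top}" for c
    using that assms(4) by (cases c) (auto simp: ug_ineq_def less_top)
qed (use assms in auto)

lemma integral_epowr_add_less_top:
  assumes "borel_fun_on S h" "borel_fun_on S k"
    "p_integral S h < top" "p_integral S k < top"
  shows "(\<integral>\<^sup>+ x. epowr (h x + k x) p \<partial>restrict_space M S) < top"
proof -
  have [measurable]: "h \<in> borel_measurable (restrict_space M S)" "k \<in> borel_measurable (restrict_space M S)"
    using assms by (auto intro: borel_fun_measurable)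
  have "(\<integral>\<^sup>+ x. epowr (h x + k x) p \<partial>restrict_space M S) \<le>
      (\<integral>\<^sup>+ x. ennreal (2 powr p) * (epowr (h x) p + epowr (k x) p) \<partial>restrict_space M S)"
    using p by (intro nn_integral_mono epowr_add_le) auto
  also have "\<dots> = ennreal (2 powr p) * (p_integral S h +
      p_integral S k)"
    by (simp add: nn_integral_cmult nn_integral_add)
  also have "\<dots> < top" using assms by (simp add: ennreal_mult_less_top)
  finally show ?thesis .
qed

lemma weak_upper_gradient_cong:
  assumes "weak_upper_gradient p M S u h" "\<And>x. x \<in> S \<Longrightarrow> u x = v x"
  shows "weak_upper_gradient p M S v h"
proof -
  have "ug_ineq v h c" if "c \<in> rect_curves S" "ug_ineq u h c" for c
    using that rect_curvesD[of "fst c" "fst (snd c)" "snd (snd c)" S] rectifiable.le assms(2)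
    by (cases c) (force simp: ug_ineq_def image_subset_iff)
  then show ?thesis
    using assms(1) unfolding weak_upper_gradient_def by blast
qed

lemma weak_upper_gradient_lincomb:
  assumes "weak_upper_gradient p M S u h" "weak_upper_gradient p M S v k"
  shows "weak_upper_gradient p M S (\<lambda>x. r * u x + s * v x) (\<lambda>x. ennreal \<bar>r\<bar> * h x + ennreal \<bar>s\<bar> * k x)"
proof -
  have b: "borel_fun_on S h" "borel_fun_on S k" using assms by (auto simp: weak_upper_gradient_def)
  obtain R where R: "borel_fun_on S R" "p_integral S R < top"
    "\<And>a b \<gamma>. (a, b, \<gamma>) \<in> rect_curves S \<Longrightarrow> curve_integral (a, b, \<gamma>) R < top \<Longrightarrow>
      ennreal \<bar>u (\<gamma> a) - u (\<gamma> b)\<bar> \<le> curve_integral (a, b, \<gamma>) h"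
    using weak_upper_gradientE[OF assms(1)] rectifiable.le rect_curvesD(1) by (metis order_refl)
  obtain R' where R': "borel_fun_on S R'" "p_integral S R' < top"
    "\<And>a b \<gamma>. (a, b, \<gamma>) \<in> rect_curves S \<Longrightarrow> curve_integral (a, b, \<gamma>) R' < top \<Longrightarrow>
      ennreal \<bar>v (\<gamma> a) - v (\<gamma> b)\<bar> \<le> curve_integral (a, b, \<gamma>) k"
    using weak_upper_gradientE[OF assms(2)] rectifiable.le rect_curvesD(1) by (metis order_refl)
  show ?thesis
  proof (rule weak_upper_gradientI[where R="\<lambda>x. R x + R' x"])
    fix a b \<gamma> assume c: "(a, b, \<gamma>) \<in> rect_curves S" "curve_integral (a, b, \<gamma>) (\<lambda>x. R x + R' x) < top"
    then have fin: "curve_integral (a, b, \<gamma>) R < top" "curve_integral (a, b, \<gamma>) R' < top"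
      using R(1) R'(1) by (auto simp: curve_integral_add)
    have "\<bar>(r * u (\<gamma> a) + s * v (\<gamma> a)) - (r * u (\<gamma> b) + s * v (\<gamma> b))\<bar> \<le>
        \<bar>r\<bar> * \<bar>u (\<gamma> a) - u (\<gamma> b)\<bar> + \<bar>s\<bar> * \<bar>v (\<gamma> a) - v (\<gamma> b)\<bar>"
      unfolding abs_mult[symmetric] right_diff_distrib by linarith
    then have "ennreal \<bar>(r * u (\<gamma> a) + s * v (\<gamma> a)) - (r * u (\<gamma> b) + s * v (\<gamma> b))\<bar> \<le>
        ennreal \<bar>r\<bar> * ennreal \<bar>u (\<gamma> a) - u (\<gamma> b)\<bar> + ennreal \<bar>s\<bar> * ennreal \<bar>v (\<gamma> a) - v (\<gamma> b)\<bar>"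
      by (simp add: ennreal_leI flip: ennreal_mult ennreal_plus)
    also have "\<dots> \<le> ennreal \<bar>r\<bar> * curve_integral (a, b, \<gamma>) h + ennreal \<bar>s\<bar> * curve_integral (a, b, \<gamma>) k"
      using R(3) R'(3) c(1) fin by (intro add_mono mult_left_mono) auto
    also have "\<dots> = curve_integral (a, b, \<gamma>) (\<lambda>x. ennreal \<bar>r\<bar> * h x + ennreal \<bar>s\<bar> * k x)"
      using c(1) b by (simp add: curve_integral_add curve_integral_cmult borel_fun_on_cmult)
    finally show "ennreal \<bar>(r * u (\<gamma> a) + s * v (\<gamma> a)) - (r * u (\<gamma> b) + s * v (\<gamma> b))\<bar> \<le>
        curve_integral (a, b, \<gamma>) (\<lambda>x. ennreal \<bar>r\<bar> * h x + ennreal \<bar>s\<bar> * k x)" .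
  qed (rule borel_fun_on_add borel_fun_on_cmult integral_epowr_add_less_top b R(1,2) R'(1,2))+
qed

section \<open>Limits of weak upper gradients\<close>

text \<open>Borel regularity is needed since test functions for the modulus must be Borel.\<close>

lemma AE_restrict_borel_null:
  assumes "S \<in> sets borel" "AE x in restrict_space M S. P x"
  obtains B where "B \<in> sets borel" "emeasure M B = 0" "\<And>x. x \<in> S \<Longrightarrow> x \<notin> B \<Longrightarrow> P x"
proof -
  have "AE x in M. x \<in> S \<longrightarrow> P x"
    using assms by (subst (asm) AE_restrict_space_iff) (auto simp: borel_sets space_M)
  then obtain A where A: "{x. \<not> (x \<in> S \<longrightarrow> P x)} \<subseteq> A" "emeasure M A = 0" "A \<in> sets M"
    by (auto simp: space_M elim: AE_E)
  obtain B where "B \<in> sets borel" "A \<subseteq> B" "emeasure M B = emeasure M A"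
    using regular A(3) unfolding borel_regular_def by blast
  moreover from this have "x \<in> S \<Longrightarrow> x \<notin> B \<Longrightarrow> P x" for x using A(1) by blast
  ultimately show ?thesis using A(2) that by metis
qed

text \<open>The test function \<open>\<infinity>\<close> on a null Borel set forces almost every curve to leave the set.\<close>

lemma integral_epowr_null:
  assumes "S \<in> sets borel" "B \<in> sets borel" "emeasure M B = 0"
  shows "borel_fun_on S (\<lambda>x. top * indicator B x)"
    and "(\<integral>\<^sup>+ x. epowr (top * indicator B x) p \<partial>restrict_space M S) = 0"
proof -
  have "(\<lambda>x. top * indicator B x :: ennreal) \<in> borel_measurable borel" using assms(2) by measurable
  then show b: "borel_fun_on S (\<lambda>x. top * indicator B x)"
    unfolding borel_fun_on_def by (rule measurable_restrict_space1)
  have "AE x in M. x \<notin> B"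
    using assms borel_sets by (intro AE_not_in) (auto simp: null_sets_def)
  then have "AE x in restrict_space M S. x \<notin> B"
    using assms(1) by (subst AE_restrict_space_iff) (auto simp: borel_sets space_M)
  then have "(\<integral>\<^sup>+ x. epowr (top * indicator B x) p \<partial>restrict_space M S) = (\<integral>\<^sup>+ x. 0 \<partial>restrict_space M S)"
    by (intro nn_integral_cong_AE) (auto elim!: eventually_mono)
  then show "(\<integral>\<^sup>+ x. epowr (top * indicator B x) p \<partial>restrict_space M S) = 0" by simp
qed

text \<open>A form of Fuglede's lemma. On a curve along which the common dominating function \<open>E\<close> of \<open>2^n * e n\<close> has
  finite integral, the integrals of \<open>e n\<close> tend to zero, which gives uniform oscillation bounds for
  all \<open>u n\<close> on the curve. The curve contains a point at which the sequence is bounded, because it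
  does not run inside the exceptional null set; by the oscillation bounds the sequence is bounded at all
  points of the curve, and the upper limit inherits the inequality.

  The function \<open>v\<close> is prescribed only where the sequence is bounded. This covers the
  upper limit of \<open>u n\<close> itself as well as the sum of a fixed function and the upper limit of
  the differences.\<close>

lemma weak_upper_gradient_limit:
  assumes S: "S \<in> sets borel"
    and wug: "\<And>n. weak_upper_gradient p M S (u n) (g n)"
    and h: "borel_fun_on S h" and e: "\<And>n. borel_fun_on S (e n)"
    and g_le: "\<And>n x. x \<in> S \<Longrightarrow> g n x \<le> h x + e n x"
    and small: "\<And>n. p_integral S (e n) \<le> ennreal (2 powr (- (p + 1) * real n))"
    and bdd: "AE x in restrict_space M S. Bseq (\<lambda>n. u n x)"
    and v: "\<And>x. x \<in> S \<Longrightarrow> Bseq (\<lambda>n. u n x) \<Longrightarrow> ereal (v x) = limsup (\<lambda>n. ereal (u n x))"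
  shows "weak_upper_gradient p M S v h"
proof -
  define Q where "Q n R \<longleftrightarrow> borel_fun_on S R \<and> p_integral S R < top \<and>
    (\<forall>a b \<gamma> c d. (a, b, \<gamma>) \<in> rect_curves S \<longrightarrow> curve_integral (a, b, \<gamma>) R < top \<longrightarrow>
      a \<le> c \<longrightarrow> c \<le> d \<longrightarrow> d \<le> b \<longrightarrow> ennreal \<bar>u n (\<gamma> c) - u n (\<gamma> d)\<bar> \<le> curve_integral (c, d, \<gamma>) (g n))"
    for n R
  have "\<exists>R. Q n R" for n
    unfolding Q_def by (rule weak_upper_gradientE[OF wug[of n]]) blast
  then obtain \<rho> where Q: "\<And>n. Q n (\<rho> n)" by metis
  then have \<rho>: "\<And>n. borel_fun_on S (\<rho> n)"
    "\<And>n. p_integral S (\<rho> n) < top"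
    "\<And>n a b \<gamma> c d. (a, b, \<gamma>) \<in> rect_curves S \<Longrightarrow> curve_integral (a, b, \<gamma>) (\<rho> n) < top \<Longrightarrow>
      a \<le> c \<Longrightarrow> c \<le> d \<Longrightarrow> d \<le> b \<Longrightarrow> ennreal \<bar>u n (\<gamma> c) - u n (\<gamma> d)\<bar> \<le> curve_integral (c, d, \<gamma>) (g n)"
    unfolding Q_def by blast+
  obtain R where R: "borel_fun_on S R" "p_integral S R < top"
    "\<And>c n. c \<in> rect_curves S \<Longrightarrow> curve_integral c R < top \<Longrightarrow> curve_integral c (\<rho> n) < top"
    by (rule countable_domination[of S \<rho>, OF \<rho>(1,2)]) blast
  have "ennreal ((2 ^ n) powr p) * p_integral S (e n) \<le> ennreal ((1 / 2) ^ n)" for n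
  proof -
    have "ennreal ((2 ^ n) powr p) * p_integral S (e n) \<le>
        ennreal ((2 ^ n) powr p) * ennreal (2 powr (- (p + 1) * real n))"
      by (intro mult_left_mono small) auto
    also have "\<dots> = ennreal (2 powr (- real n))"
      by (simp add: algebra_simps powr_powr flip: ennreal_mult powr_add powr_realpow)
    also have "2 powr (- real n) = (1 / 2) ^ n"
      by (simp add: powr_minus powr_realpow power_one_over inverse_eq_divide)
    finally show ?thesis .
  qed
  then have fin: "(\<Sum>n. ennreal ((2 ^ n) powr p) * p_integral S (e n)) < top"
    using suminf_half_powers by (meson le_less_trans suminf_le summableI)
  obtain E where E: "borel_fun_on S E" "p_integral S E < top"
    "\<And>n x. ennreal (2 ^ n) * e n x \<le> E x"
    by (rule dominating_function[of S e "\<lambda>n. 2 ^ n", OF e _ fin]) auto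
  obtain B where B: "B \<in> sets borel" "emeasure M B = 0" "\<And>x. x \<in> S \<Longrightarrow> x \<notin> B \<Longrightarrow> Bseq (\<lambda>n. u n x)"
    using AE_restrict_borel_null[OF S bdd] by blast
  note null = integral_epowr_null[OF S B(1,2)]
  show ?thesis
  proof (rule weak_upper_gradientI[where R="\<lambda>x. R x + (E x + top * indicator B x)", OF h])
    show "borel_fun_on S (\<lambda>x. R x + (E x + top * indicator B x))"
      using R E null by (intro borel_fun_on_add)
    show "(\<integral>\<^sup>+ x. epowr (R x + (E x + top * indicator B x)) p \<partial>restrict_space M S) < top"
      using R E null by (intro integral_epowr_add_less_top borel_fun_on_add) auto
    fix a b \<gamma> assume c: "(a, b, \<gamma>) \<in> rect_curves S"
      and "curve_integral (a, b, \<gamma>) (\<lambda>x. R x + (E x + top * indicator B x)) < top"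
    then have fin: "curve_integral (a, b, \<gamma>) R < top" "curve_integral (a, b, \<gamma>) E < top"
        "curve_integral (a, b, \<gamma>) (\<lambda>x. top * indicator B x) < top"
      using R(1) E(1) null(1) by (auto simp: curve_integral_add[OF c] borel_fun_on_add)
    interpret rectifiable a b \<gamma> using rect_curvesD c by blast
    have sub: "\<gamma> ` {a..b} \<subseteq> S" using rect_curvesD c by blast
    show "ennreal \<bar>v (\<gamma> a) - v (\<gamma> b)\<bar> \<le> curve_integral (a, b, \<gamma>) h"
    proof (cases "curve_integral (a, b, \<gamma>) h < top")
      case True
      obtain H where H: "0 \<le> H" "curve_integral (a, b, \<gamma>) h = ennreal H"
        using True by (auto simp: less_top_ennreal)
      obtain K where K: "0 \<le> K" "curve_integral (a, b, \<gamma>) E = ennreal K"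
        using fin(2) by (auto simp: less_top_ennreal)
      have e_small: "curve_integral (a, b, \<gamma>) (e n) \<le> ennreal (K * (1 / 2) ^ n)" for n
      proof -
        have "ennreal (2 ^ n) * curve_integral (a, b, \<gamma>) (e n) \<le> ennreal K"
          unfolding K(2)[symmetric] curve_integral_cmult[OF c e, symmetric]
          using E(3) by (intro curve_integral_mono[OF c])
        then have "ennreal ((1 / 2) ^ n) * (ennreal (2 ^ n) * curve_integral (a, b, \<gamma>) (e n)) \<le>
            ennreal ((1 / 2) ^ n) * ennreal K"
          by (rule mult_left_mono) simp
        moreover have "ennreal ((1 / 2) ^ n) * ennreal (2 ^ n) = 1"
          by (simp add: power_one_over flip: ennreal_mult del: ennreal_power)
        ultimately show ?thesis
          using K(1) by (simp add: mult.assoc[symmetric]) (simp add: mult.commute ennreal_mult'')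
      qed
      have osc: "\<bar>u n (\<gamma> s) - u n (\<gamma> t)\<bar> \<le> H + K * (1 / 2) ^ n" if st: "a \<le> s" "s \<le> t" "t \<le> b" for n s t
      proof -
        have "ennreal \<bar>u n (\<gamma> s) - u n (\<gamma> t)\<bar> \<le> curve_integral (s, t, \<gamma>) (g n)"
          using \<rho>(3)[OF c R(3)[OF c fin(1)]] st by blast
        also have "\<dots> \<le> curve_integral (a, b, \<gamma>) (g n)"
          using curve_integral_subcurve_le[OF st sub] wug by (simp add: weak_upper_gradient_def)
        also have "\<dots> \<le> curve_integral (a, b, \<gamma>) (\<lambda>x. h x + e n x)"
          using g_le by (intro curve_integral_mono[OF c])
        also have "\<dots> = ennreal H + curve_integral (a, b, \<gamma>) (e n)"
          using curve_integral_add[OF c h e] H by simp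
        also have "\<dots> \<le> ennreal H + ennreal (K * (1 / 2) ^ n)"
          by (intro add_left_mono e_small)
        also have "\<dots> = ennreal (H + K * (1 / 2) ^ n)"
          using H K by simp
        finally have "ennreal \<bar>u n (\<gamma> s) - u n (\<gamma> t)\<bar> \<le> ennreal (H + K * (1 / 2) ^ n)" .
        moreover have "0 \<le> H + K * (1 / 2) ^ n" using H K by simp
        ultimately show ?thesis using ennreal_le_iff by blast
      qed
      \<comment> \<open>One good point suffices: the oscillation bound carries boundedness along the curve.\<close>
      obtain r where r: "r \<in> {a..b}" "\<gamma> r \<notin> B"
        using curve_leaves_set[OF c fin(3)] by blast
      have bounded: "Bseq (\<lambda>n. u n (\<gamma> s))" if s: "s \<in> {a..b}" for s
      proof -
        have "Bseq (\<lambda>n. u n (\<gamma> r))" using B(3) r sub by blast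
        then obtain Q where Q: "\<And>n. \<bar>u n (\<gamma> r)\<bar> \<le> Q" by (auto simp: Bseq_def)
        have "\<bar>u n (\<gamma> s)\<bar> \<le> Q + (H + K)" for n
        proof -
          have "K * (1 / 2) ^ n \<le> K * 1" using K(1) by (intro mult_left_mono power_le_one) auto
          then show ?thesis
            using osc[of s r n] osc[of r s n] Q[of n] r s by (cases "s \<le> r") auto
        qed
        then show ?thesis by (intro BseqI') auto
      qed
      have lim: "(\<lambda>n. K * (1 / 2) ^ n) \<longlonglongrightarrow> 0"
        by (intro tendsto_mult_right_zero LIMSEQ_power_zero) simp
      have ends: "\<gamma> a \<in> S" "\<gamma> b \<in> S" "a \<in> {a..b}" "b \<in> {a..b}" using sub le by auto
      have "v (\<gamma> a) - v (\<gamma> b) \<le> H" "v (\<gamma> b) - v (\<gamma> a) \<le> H"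
        using osc[of a b] le
        by (intro limsup_diff_le[OF v v _ lim] ends bounded, fastforce simp: abs_le_iff)+
      then show ?thesis using H by (simp add: ennreal_leI)
    qed (simp add: not_less top_unique)
  qed
qed

section \<open>Minimal weak upper gradients\<close>

text \<open>Minimizing sequences of gradients converge by uniform convexity. Along a subsequence
  they exceed their limit only by errors that decay fast.\<close>

lemma gradients_converge:
  assumes S: "S \<in> sets borel"
    and wug: "\<And>n. weak_upper_gradient p M S (u n) (g n)"
    and A: "\<And>n. p_integral S (g n) = ennreal (A n)" "\<And>n. 0 \<le> A n" "A \<longlonglongrightarrow> L"
    and mid: "\<And>e. 0 < e \<Longrightarrow> \<exists>n0. \<forall>n\<ge>n0. \<forall>m\<ge>n0. ennreal (L - e) \<le>
      (\<integral>\<^sup>+ x. epowr (ennreal (1 / 2) * g n x + ennreal (1 / 2) * g m x) p \<partial>restrict_space M S)"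
  obtains \<psi> :: "nat \<Rightarrow> nat" and h and e :: "nat \<Rightarrow> 'a \<Rightarrow> ennreal" where "strict_mono \<psi>" "borel_fun_on S h"
    "p_integral S h \<le> ennreal L"
    "\<And>n. borel_fun_on S (e n)" "\<And>n x. g (\<psi> n) x \<le> h x + e n x"
    "\<And>n. p_integral S (e n) \<le> ennreal (2 powr (- (p + 1) * real n))"
proof -
  let ?N = "restrict_space M S"
  define r where "r n x = enn2real (g n x)" for n x
  have bg [measurable]: "g n \<in> borel_measurable (restrict_space borel S)" for n
    using wug by (auto simp: weak_upper_gradient_def borel_fun_on_def)
  have [measurable]: "g n \<in> borel_measurable ?N" for n
    using wug by (auto simp: weak_upper_gradient_def intro: borel_fun_measurable)
  have br [measurable]: "r n \<in> borel_measurable (restrict_space borel S)" "r n \<in> borel_measurable ?N" for n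
    unfolding r_def by measurable
  have g_fin: "AE x in ?N. g n x \<noteq> top" for n
  proof -
    have "AE x in ?N. epowr (g n x) p \<noteq> \<infinity>"
      using A(1) by (intro nn_integral_PInf_AE) auto
    then show ?thesis by eventually_elim auto
  qed
  have r_nonneg: "0 \<le> r n x" for n x by (simp add: r_def)
  have g_r: "AE x in ?N. g n x = ennreal (r n x)" for n
    using g_fin[of n] by eventually_elim (simp add: r_def less_top)
  have Ar: "(\<integral>\<^sup>+ x. ennreal (\<bar>r n x\<bar> powr p) \<partial>?N) = ennreal (A n)" for n
  proof -
    have "(\<integral>\<^sup>+ x. ennreal (\<bar>r n x\<bar> powr p) \<partial>?N) = (\<integral>\<^sup>+ x. epowr (g n x) p \<partial>?N)"
      using g_r[of n] by (intro nn_integral_cong_AE) (auto elim!: eventually_mono simp: r_nonneg)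
    then show ?thesis by (simp add: A)
  qed
  have mid_r: "(\<integral>\<^sup>+ x. epowr (ennreal (1 / 2) * g n x + ennreal (1 / 2) * g m x) p \<partial>?N) =
      (\<integral>\<^sup>+ x. ennreal (\<bar>(r n x + r m x) / 2\<bar> powr p) \<partial>?N)" for n m
  proof (rule nn_integral_cong_AE, use g_r[of n] g_r[of m] in eventually_elim)
    case (elim x)
    have "ennreal (1 / 2) * g n x + ennreal (1 / 2) * g m x = ennreal ((r n x + r m x) / 2)"
      unfolding elim using r_nonneg
      by (simp add: add_divide_distrib del: ennreal_half flip: ennreal_mult ennreal_plus)
    then show ?case using r_nonneg[of n x] r_nonneg[of m x] by (simp del: ennreal_half)
  qed
  define D where "D n m = (\<integral>\<^sup>+ x. ennreal (\<bar>r n x - r m x\<bar> powr p) \<partial>?N)" for n m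
  have Cauchy: "\<exists>n0. \<forall>n\<ge>n0. \<forall>m\<ge>n0. D n m \<le> ennreal e" if "0 < e" for e
    unfolding D_def using nn_abs_powr_midpoint_Cauchy[OF p br(2) Ar A(2,3) mid[unfolded mid_r] that] .
  have rate: "0 < 2 powr (- (p + 1) * real n)" for n by simp
  obtain \<psi> :: "nat \<Rightarrow> nat" where \<psi>: "strict_mono \<psi>"
    and "\<And>n m. n \<le> m \<Longrightarrow> D (\<psi> n) (\<psi> m) \<le> ennreal (2 powr (- (p + 1) * real n))"
    using fast_Cauchy_subsequence[of D "\<lambda>n. 2 powr (- (p + 1) * real n)", OF Cauchy rate] by metis
  then have fast: "\<And>n m. n \<le> m \<Longrightarrow> (\<integral>\<^sup>+ x. ennreal (\<bar>r (\<psi> n) x - r (\<psi> m) x\<bar> powr p) \<partial>?N) \<le>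
      ennreal (2 powr (- (p + 1) * real n))"
    unfolding D_def by blast
  define F where "F x = lim (\<lambda>n. r (\<psi> n) x)" for x
  have bF [measurable]: "F \<in> borel_measurable (restrict_space borel S)" "F \<in> borel_measurable ?N"
    unfolding F_def by measurable
  have conv: "AE x in ?N. convergent (\<lambda>n. r (\<psi> n) x)"
    and err: "\<And>n. (\<integral>\<^sup>+ x. ennreal (\<bar>r (\<psi> n) x - F x\<bar> powr p) \<partial>?N) \<le> ennreal (2 powr (- (p + 1) * real n))"
    unfolding F_def using fast_Cauchy_AE_limit[of p "\<lambda>n. r (\<psi> n)" ?N] p br(2) fast by auto
  \<comment> \<open>The value of \<open>lim\<close> is unspecified where the sequence diverges and may be negative there.\<close>
  define h where "h x = ennreal \<bar>F x\<bar>" for x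
  \<comment> \<open>The value \<open>\<infinity>\<close> on a null set makes the inequality \<open>g \<le> h + e\<close> hold everywhere.\<close>
  define e where "e n x = (if g (\<psi> n) x = top then top else ennreal \<bar>r (\<psi> n) x - F x\<bar>)" for n x
  show ?thesis
  proof (rule that[OF \<psi>])
    show bh: "borel_fun_on S h" unfolding borel_fun_on_def h_def by measurable
    have "(\<integral>\<^sup>+ x. epowr (h x) p \<partial>?N) = (\<integral>\<^sup>+ x. liminf (\<lambda>n. ennreal (\<bar>r (\<psi> n) x\<bar> powr p)) \<partial>?N)"
    proof (rule nn_integral_cong_AE, use conv in eventually_elim)
      case (elim x)
      then have "(\<lambda>n. r (\<psi> n) x) \<longlonglongrightarrow> F x" by (simp add: convergent_LIMSEQ_iff F_def)
      then have "(\<lambda>n. ennreal (\<bar>r (\<psi> n) x\<bar> powr p)) \<longlonglongrightarrow> ennreal (\<bar>F x\<bar> powr p)"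
        using p by (intro tendsto_ennrealI tendsto_powr' tendsto_intros) auto
      then show ?case
        unfolding h_def using lim_imp_Liminf[OF trivial_limit_sequentially] by (metis epowr_ennreal abs_ge_zero)
    qed
    also have "\<dots> \<le> liminf (\<lambda>n. \<integral>\<^sup>+ x. ennreal (\<bar>r (\<psi> n) x\<bar> powr p) \<partial>?N)"
      by (rule nn_integral_liminf) simp
    also have "\<dots> = liminf (\<lambda>n. ennreal (A (\<psi> n)))" by (simp only: Ar)
    also have "\<dots> = ennreal L"
      using LIMSEQ_subseq_LIMSEQ[OF A(3) \<psi>]
      by (intro lim_imp_Liminf tendsto_ennrealI) (auto simp: comp_def)
    finally show "(\<integral>\<^sup>+ x. epowr (h x) p \<partial>?N) \<le> ennreal L" .
    show "borel_fun_on S (e n)" for n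
      unfolding borel_fun_on_def e_def by measurable
    show "(\<integral>\<^sup>+ x. epowr (e n x) p \<partial>?N) \<le> ennreal (2 powr (- (p + 1) * real n))" for n
    proof -
      have "(\<integral>\<^sup>+ x. epowr (e n x) p \<partial>?N) = (\<integral>\<^sup>+ x. ennreal (\<bar>r (\<psi> n) x - F x\<bar> powr p) \<partial>?N)"
        using g_fin[of "\<psi> n"] by (intro nn_integral_cong_AE) (auto elim!: eventually_mono simp: e_def)
      then show ?thesis using err[of n] by simp
    qed
    show "g (\<psi> n) x \<le> h x + e n x" for n x
    proof (cases "g (\<psi> n) x = top")
      case False
      then have "g (\<psi> n) x = ennreal (r (\<psi> n) x)" by (simp add: r_def less_top)
      also have "\<dots> \<le> ennreal (\<bar>F x\<bar> + \<bar>r (\<psi> n) x - F x\<bar>)" by (intro ennreal_leI) linarith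
      also have "\<dots> = h x + e n x" using False by (simp add: h_def e_def)
      finally show ?thesis .
    qed (simp add: e_def)
  qed
qed

lemma newtonian_iff:
  "u \<in> newtonian p M S \<longleftrightarrow> u \<in> borel_measurable (restrict_space M S) \<and>
    (\<integral>\<^sup>+ x. ennreal (\<bar>u x\<bar> powr p) \<partial>restrict_space M S) < top \<and>
    (\<exists>h. weak_upper_gradient p M S u h \<and> p_integral S h < top)"
  by (auto simp: newtonian_def Lp_iff Lp_weak_upper_gradients_def eLp_norm_less_top_iff)

text \<open>Midpoints of weak upper gradients of \<open>u\<close> are weak upper gradients of \<open>u\<close>, so a sequence whose norms
  approach the infimum converges, and its limit attains the infimum. Hence the choice operator in the
  definition chooses from a nonempty set.\<close>

lemma minimal_wug:
  assumes S: "S \<in> sets borel" and u: "u \<in> newtonian p M S"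
  shows "weak_upper_gradient p M S u (minimal_wug p M S u)"
    and "(\<integral>\<^sup>+ x. epowr (minimal_wug p M S u x) p \<partial>restrict_space M S) < top"
    and "weak_upper_gradient p M S u k \<Longrightarrow>
      (\<integral>\<^sup>+ x. epowr (minimal_wug p M S u x) p \<partial>restrict_space M S) \<le>
      p_integral S k"
proof -
  let ?N = "restrict_space M S"
  define I where "I h = (\<integral>\<^sup>+ x. epowr (h x) p \<partial>?N)" for h
  define G where "G = Lp_weak_upper_gradients p M S u"
  have G: "k \<in> G \<longleftrightarrow> weak_upper_gradient p M S u k \<and> I k < top" for k
    by (simp add: G_def Lp_weak_upper_gradients_def eLp_norm_less_top_iff I_def)
  have "G \<noteq> {}" using u by (simp add: newtonian_def G_def)
  define L where "L = enn2real (INF k\<in>G. I k)"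
  have L: "(INF k\<in>G. I k) = ennreal L" "0 \<le> L"
  proof -
    obtain k where "k \<in> G" using \<open>G \<noteq> {}\<close> by blast
    then have "(INF k\<in>G. I k) < top" using G by (meson INF_lower le_less_trans)
    then show "(INF k\<in>G. I k) = ennreal L" "0 \<le> L" by (auto simp: L_def less_top)
  qed
  have "\<exists>k\<in>G. I k < ennreal (L + inverse (real (Suc n)))" for n
  proof -
    have "(INF k\<in>G. I k) < ennreal (L + inverse (real (Suc n)))"
      unfolding L(1) using L(2) by (intro ennreal_lessI) (auto intro: add_nonneg_pos)
    then show ?thesis by (simp only: INF_less_iff)
  qed
  then obtain g where g: "\<And>n. g n \<in> G" "\<And>n. I (g n) < ennreal (L + inverse (real (Suc n)))"
    by metis
  define A where "A n = enn2real (I (g n))" for n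
  have A: "I (g n) = ennreal (A n)" "0 \<le> A n" for n
    using g(1)[of n] G by (auto simp: A_def less_top)
  have "A \<longlonglongrightarrow> L"
  proof (rule tendsto_sandwich[OF _ _ tendsto_const])
    show "\<forall>\<^sub>F n in sequentially. L \<le> A n"
    proof (intro always_eventually allI)
      fix n have "ennreal L \<le> ennreal (A n)"
        unfolding L(1)[symmetric] A(1)[symmetric] using g(1) by (rule INF_lower)
      then show "L \<le> A n" using A(2) by simp
    qed
    show "\<forall>\<^sub>F n in sequentially. A n \<le> L + inverse (real (Suc n))"
    proof (intro always_eventually allI)
      fix n show "A n \<le> L + inverse (real (Suc n))"
        using g(2)[of n] A(2)[of n] by (simp add: A(1) ennreal_less_iff)
    qed
    show "(\<lambda>n. L + inverse (real (Suc n))) \<longlonglongrightarrow> L"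
      using tendsto_add[OF tendsto_const LIMSEQ_inverse_real_of_nat, of L] by simp
  qed
  have mid: "ennreal (L - e) \<le> I (\<lambda>x. ennreal (1 / 2) * g n x + ennreal (1 / 2) * g m x)" if "0 < e" for e n m
  proof (cases "I (\<lambda>x. ennreal (1 / 2) * g n x + ennreal (1 / 2) * g m x) < top")
    case True
    have "weak_upper_gradient p M S (\<lambda>x. 1 / 2 * u x + 1 / 2 * u x)
        (\<lambda>x. ennreal \<bar>1 / 2\<bar> * g n x + ennreal \<bar>1 / 2\<bar> * g m x)"
      using g(1) G by (intro weak_upper_gradient_lincomb) auto
    then have "weak_upper_gradient p M S u (\<lambda>x. ennreal (1 / 2) * g n x + ennreal (1 / 2) * g m x)"
      by (simp del: ennreal_half)
    then have "ennreal L \<le> I (\<lambda>x. ennreal (1 / 2) * g n x + ennreal (1 / 2) * g m x)"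
      unfolding L(1)[symmetric] using True G by (intro INF_lower) blast
    moreover have "ennreal (L - e) \<le> ennreal L" using that by (intro ennreal_leI) simp
    ultimately show ?thesis by (rule order_trans[rotated])
  qed (simp add: not_less top_unique)
  obtain \<psi> :: "nat \<Rightarrow> nat" and h and e :: "nat \<Rightarrow> 'a \<Rightarrow> ennreal" where h: "borel_fun_on S h" "I h \<le> ennreal L"
    and e: "\<And>n. borel_fun_on S (e n)" "\<And>n x. g (\<psi> n) x \<le> h x + e n x"
    "\<And>n. (\<integral>\<^sup>+ x. epowr (e n x) p \<partial>?N) \<le> ennreal (2 powr (- (p + 1) * real n))"
    unfolding I_def
  proof (rule gradients_converge[of S "\<lambda>n. u" g A L])
    show "weak_upper_gradient p M S u (g n)" for n using g(1) G by blast
    show "(\<integral>\<^sup>+ x. epowr (g n x) p \<partial>?N) = ennreal (A n)" for n using A(1) by (simp add: I_def)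
    show "\<exists>n0. \<forall>n\<ge>n0. \<forall>m\<ge>n0. ennreal (L - e) \<le>
      (\<integral>\<^sup>+ x. epowr (ennreal (1 / 2) * g n x + ennreal (1 / 2) * g m x) p \<partial>?N)" if "0 < e" for e
      using mid[OF that] unfolding I_def by blast
  qed (use S A(2) \<open>A \<longlonglongrightarrow> L\<close> in auto)
  have "weak_upper_gradient p M S u h"
  proof (rule weak_upper_gradient_limit[OF S, of "\<lambda>n. u" "\<lambda>n. g (\<psi> n)" h e])
    show "weak_upper_gradient p M S u (g (\<psi> n))" for n using g(1) G by blast
  qed (use h e in \<open>simp_all add: Bseq_const Limsup_const\<close>)
  then have "h \<in> G" using h(2) G by (auto intro: le_less_trans)
  moreover have "I h \<le> I k" if "k \<in> G" for k
    using h(2) INF_lower[OF that, of I] unfolding L(1) by simp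
  moreover have "eLp_norm p ?N h \<le> eLp_norm p ?N k \<longleftrightarrow> I h \<le> I k" for h k
    using p by (simp add: eLp_norm_le_iff I_def)
  ultimately have "\<exists>h. h \<in> G \<and> (\<forall>k\<in>G. eLp_norm p ?N h \<le> eLp_norm p ?N k)" by blast
  then have *: "minimal_wug p M S u \<in> G \<and> (\<forall>k\<in>G. eLp_norm p ?N (minimal_wug p M S u) \<le> eLp_norm p ?N k)"
    unfolding minimal_wug_def G_def by (rule someI_ex)
  then show "weak_upper_gradient p M S u (minimal_wug p M S u)"
    "(\<integral>\<^sup>+ x. epowr (minimal_wug p M S u x) p \<partial>?N) < top"
    unfolding G I_def by auto
  show "(\<integral>\<^sup>+ x. epowr (minimal_wug p M S u x) p \<partial>?N) \<le> (\<integral>\<^sup>+ x. epowr (k x) p \<partial>?N)"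
    if "weak_upper_gradient p M S u k"
  proof (cases "I k < top")
    case True
    then have "k \<in> G" using that G by blast
    then show ?thesis using * p by (simp add: eLp_norm_le_iff)
  qed (simp add: I_def not_less top_unique)
qed

lemma integral_abs_powr_add_less_top:
  fixes u v :: "'b \<Rightarrow> real"
  assumes [measurable]: "u \<in> borel_measurable N" "v \<in> borel_measurable N"
    and "(\<integral>\<^sup>+ x. ennreal (\<bar>u x\<bar> powr p) \<partial>N) < top" "(\<integral>\<^sup>+ x. ennreal (\<bar>v x\<bar> powr p) \<partial>N) < top"
  shows "(\<integral>\<^sup>+ x. ennreal (\<bar>r * u x + s * v x\<bar> powr p) \<partial>N) < top"
proof -
  have "(\<integral>\<^sup>+ x. ennreal (\<bar>r * u x + s * v x\<bar> powr p) \<partial>N) \<le>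
      (\<integral>\<^sup>+ x. ennreal (2 powr p) * (ennreal (\<bar>r\<bar> powr p) * ennreal (\<bar>u x\<bar> powr p) + ennreal (\<bar>s\<bar> powr p) * ennreal (\<bar>v x\<bar> powr p)) \<partial>N)"
  proof (rule nn_integral_mono)
    fix x
    have pow: "epowr (ennreal \<bar>c * d\<bar>) p = ennreal (\<bar>c\<bar> powr p) * ennreal (\<bar>d\<bar> powr p)" for c d :: real
      by (subst epowr_ennreal) (auto simp: abs_mult powr_mult ennreal_mult)
    have "ennreal (\<bar>r * u x + s * v x\<bar> powr p) \<le> epowr (ennreal \<bar>r * u x\<bar> + ennreal \<bar>s * v x\<bar>) p"
      using p by (auto simp: ennreal_leI powr_mono2 abs_triangle_ineq simp flip: ennreal_plus)
    also have "\<dots> \<le> ennreal (2 powr p) * (epowr (ennreal \<bar>r * u x\<bar>) p + epowr (ennreal \<bar>s * v x\<bar>) p)"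
      using p by (intro epowr_add_le) simp
    finally show "ennreal (\<bar>r * u x + s * v x\<bar> powr p) \<le>
      ennreal (2 powr p) * (ennreal (\<bar>r\<bar> powr p) * ennreal (\<bar>u x\<bar> powr p) + ennreal (\<bar>s\<bar> powr p) * ennreal (\<bar>v x\<bar> powr p))"
      unfolding pow .
  qed
  also have "\<dots> = ennreal (2 powr p) * (ennreal (\<bar>r\<bar> powr p) * (\<integral>\<^sup>+ x. ennreal (\<bar>u x\<bar> powr p) \<partial>N) +
      ennreal (\<bar>s\<bar> powr p) * (\<integral>\<^sup>+ x. ennreal (\<bar>v x\<bar> powr p) \<partial>N))"
    by (simp add: nn_integral_cmult nn_integral_add)
  also have "\<dots> < top" using assms by (simp add: ennreal_mult_less_top)
  finally show ?thesis .
qed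

lemma newtonian_lincomb:
  assumes "u \<in> newtonian p M S" "v \<in> newtonian p M S"
  shows "(\<lambda>x. r * u x + s * v x) \<in> newtonian p M S"
proof -
  obtain h where h: "weak_upper_gradient p M S u h" "p_integral S h < top"
    using assms by (auto simp: newtonian_iff)
  obtain k where k: "weak_upper_gradient p M S v k" "p_integral S k < top"
    using assms by (auto simp: newtonian_iff)
  have scale: "(\<integral>\<^sup>+ x. epowr (ennreal \<bar>r\<bar> * h x) p \<partial>restrict_space M S) < top"
    if "borel_fun_on S h" "p_integral S h < top" for r h
    using that borel_fun_measurable[OF that(1)]
    by (simp add: epowr_cmult nn_integral_cmult ennreal_mult_less_top)
  have "(\<integral>\<^sup>+ x. epowr (ennreal \<bar>r\<bar> * h x + ennreal \<bar>s\<bar> * k x) p \<partial>restrict_space M S) < top"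
    using h k by (intro integral_epowr_add_less_top scale borel_fun_on_cmult) (auto simp: weak_upper_gradient_def)
  with weak_upper_gradient_lincomb[OF h(1) k(1)] show ?thesis
    using assms by (auto simp: newtonian_iff integral_abs_powr_add_less_top)
qed

section \<open>Extension by zero\<close>

lemma borel_fun_on_zero_extension:
  assumes [measurable]: "\<Omega> \<in> sets borel" and "borel_fun_on \<Omega> h"
  shows "borel_fun_on UNIV (\<lambda>x. h x * indicator \<Omega> x)"
  using assms(2) unfolding borel_fun_on_def
  by (subst (asm) borel_measurable_restrict_space_iff_ennreal) (auto intro: measurable_restrict_space1)

lemma integral_zero_extension:
  assumes "\<Omega> \<in> sets borel"
  shows "(\<integral>\<^sup>+ x. epowr (h x * indicator \<Omega> x) p \<partial>M) = p_integral \<Omega> h"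
proof -
  have "(\<integral>\<^sup>+ x. epowr (h x * indicator \<Omega> x) p \<partial>M) = (\<integral>\<^sup>+ x. epowr (h x) p * indicator \<Omega> x \<partial>M)"
    by (intro nn_integral_cong) (auto simp: indicator_def)
  then show ?thesis
    using assms by (simp add: nn_integral_restrict_space borel_sets space_M)
qed

text \<open>A curve that leaves \<open>\<Omega>\<close> is cut at its first exit and its last entrance. There the function
  vanishes, and the two end pieces stay in \<open>\<Omega>\<close>. The function is continuous along the curve because it
  has some \<open>L\<^sup>p\<close> weak upper gradient on the whole space, so that the inequality on compact
  pieces inside \<open>\<Omega>\<close> extends up to the cutting points.\<close>

lemma weak_upper_gradient_zero_extension:
  assumes \<Omega>: "open \<Omega>" and w0: "\<And>x. x \<notin> \<Omega> \<Longrightarrow> w x = 0"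
    and H: "weak_upper_gradient p M UNIV w H" "(\<integral>\<^sup>+ x. epowr (H x) p \<partial>M) < top"
    and k: "weak_upper_gradient p M \<Omega> w k"
  shows "weak_upper_gradient p M UNIV w (\<lambda>x. k x * indicator \<Omega> x)"
proof -
  have \<Omega>_borel [measurable]: "\<Omega> \<in> sets borel" using \<Omega> by simp
  note ext = borel_fun_on_zero_extension[OF \<Omega>_borel]
  have bk: "borel_fun_on \<Omega> k" and bH: "borel_fun_on UNIV H"
    using k H by (auto simp: weak_upper_gradient_def)
  obtain R1 where R1: "borel_fun_on UNIV R1" "p_integral UNIV R1 < top"
    "\<And>a b \<gamma> c d. (a, b, \<gamma>) \<in> rect_curves UNIV \<Longrightarrow> curve_integral (a, b, \<gamma>) R1 < top \<Longrightarrow>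
      a \<le> c \<Longrightarrow> c \<le> d \<Longrightarrow> d \<le> b \<Longrightarrow> ennreal \<bar>w (\<gamma> c) - w (\<gamma> d)\<bar> \<le> curve_integral (c, d, \<gamma>) H"
    by (rule weak_upper_gradientE[OF H(1)]) blast
  obtain R2 where R2: "borel_fun_on \<Omega> R2" "p_integral \<Omega> R2 < top"
    "\<And>a b \<gamma> c d. (a, b, \<gamma>) \<in> rect_curves \<Omega> \<Longrightarrow> curve_integral (a, b, \<gamma>) R2 < top \<Longrightarrow>
      a \<le> c \<Longrightarrow> c \<le> d \<Longrightarrow> d \<le> b \<Longrightarrow> ennreal \<bar>w (\<gamma> c) - w (\<gamma> d)\<bar> \<le> curve_integral (c, d, \<gamma>) k"
    by (rule weak_upper_gradientE[OF k]) blast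
  let ?k = "\<lambda>x. k x * indicator \<Omega> x" and ?R2 = "\<lambda>x. R2 x * indicator \<Omega> x"
  have R2_fin: "p_integral UNIV ?R2 < top"
    using R2(2) by (simp add: integral_zero_extension)
  show ?thesis
  proof (rule weak_upper_gradientI[where R="\<lambda>x. R1 x + (H x + ?R2 x)", OF ext[OF bk]])
    show "borel_fun_on UNIV (\<lambda>x. R1 x + (H x + ?R2 x))"
      using R1 bH ext[OF R2(1)] by (intro borel_fun_on_add)
    show "(\<integral>\<^sup>+ x. epowr (R1 x + (H x + ?R2 x)) p \<partial>restrict_space M UNIV) < top"
      using R1 bH ext[OF R2(1)] R2_fin H(2)
      by (intro integral_epowr_add_less_top borel_fun_on_add) auto
    fix a b \<gamma> assume c: "(a, b, \<gamma>) \<in> rect_curves UNIV"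
      and "curve_integral (a, b, \<gamma>) (\<lambda>x. R1 x + (H x + ?R2 x)) < top"
    then have fin: "curve_integral (a, b, \<gamma>) R1 < top" "curve_integral (a, b, \<gamma>) H < top"
        "curve_integral (a, b, \<gamma>) ?R2 < top"
      using R1(1) bH ext[OF R2(1)] by (auto simp: curve_integral_add[OF c] borel_fun_on_add)
    interpret rectifiable a b \<gamma> using rect_curvesD c by blast
    have sub: "\<gamma> ` {a..b} \<subseteq> UNIV" by simp
    have inside: "ennreal \<bar>w (\<gamma> s) - w (\<gamma> t)\<bar> \<le> curve_integral (s, t, \<gamma>) ?k"
      if st: "a \<le> s" "s \<le> t" "t \<le> b" and "\<gamma> ` {s..t} \<subseteq> \<Omega>" for s t
    proof (cases "\<gamma> s = \<gamma> t")
      case False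
      then have st': "(s, t, \<gamma>) \<in> rect_curves \<Omega>"
        using rect_curves_subcurve[OF c] that by auto
      have "curve_integral (s, t, \<gamma>) R2 = curve_integral (s, t, \<gamma>) ?R2"
        by (rule curve_integral_cong[OF st']) simp
      also have "\<dots> \<le> curve_integral (a, b, \<gamma>) ?R2"
        by (rule curve_integral_subcurve_le[OF st sub ext[OF R2(1)]])
      finally have "curve_integral (s, t, \<gamma>) R2 < top" using fin(3) by simp
      then have "ennreal \<bar>w (\<gamma> s) - w (\<gamma> t)\<bar> \<le> curve_integral (s, t, \<gamma>) k"
        using R2(3)[OF st', of s t] st by simp
      also have "\<dots> = curve_integral (s, t, \<gamma>) ?k"
        by (rule curve_integral_cong[OF st']) simp
      finally show ?thesis .
    qed simp
    have w_cont: "(\<lambda>n. w (\<gamma> (s n)) - w (\<gamma> (t n))) \<longlonglongrightarrow> 0"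
      if "\<And>n::nat. a \<le> s n" "\<And>n. s n \<le> t n" "\<And>n. t n \<le> b" "s \<longlonglongrightarrow> r" "t \<longlonglongrightarrow> r" for s t r
    proof -
      have "(\<lambda>n. ennreal \<bar>w (\<gamma> (s n)) - w (\<gamma> (t n))\<bar>) \<longlonglongrightarrow> ennreal 0"
      proof (rule tendsto_sandwich[OF _ _ tendsto_const])
        show "(\<lambda>n. curve_integral (s n, t n, \<gamma>) H) \<longlonglongrightarrow> ennreal 0"
          using curve_integral_shrinking[OF sub bH _ that] fin(2) by simp
        show "\<forall>\<^sub>F n in sequentially. ennreal \<bar>w (\<gamma> (s n)) - w (\<gamma> (t n))\<bar> \<le> curve_integral (s n, t n, \<gamma>) H"
          using R1(3)[OF c fin(1)] that(1-3) by simp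
      qed simp
      then show ?thesis
        by (subst (asm) tendsto_ennreal_iff) (auto simp: tendsto_rabs_zero_iff)
    qed
    show "ennreal \<bar>w (\<gamma> a) - w (\<gamma> b)\<bar> \<le> curve_integral (a, b, \<gamma>) ?k"
    proof (cases "\<gamma> ` {a..b} \<subseteq> \<Omega>")
      case True
      then show ?thesis using inside[of a b] le by simp
    next
      case False
      define Z where "Z = {a..b} \<inter> \<gamma> -` (- \<Omega>)"
      have "Z \<noteq> {}" using False by (auto simp: Z_def)
      moreover have "compact Z"
      proof -
        have "closed Z"
          unfolding Z_def using cont \<Omega> by (intro continuous_closed_preimage) auto
        then show ?thesis
          using compact_Int_closed[of "{a..b}" Z] by (simp add: Z_def Int_absorb1)
      qed
      ultimately obtain r1 r2 where r1: "r1 \<in> Z" "\<And>t. t \<in> Z \<Longrightarrow> r1 \<le> t"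
        and r2: "r2 \<in> Z" "\<And>t. t \<in> Z \<Longrightarrow> t \<le> r2"
        using compact_attains_inf[of Z] compact_attains_sup[of Z] by blast
      have r: "a \<le> r1" "r1 \<le> r2" "r2 \<le> b" "w (\<gamma> r1) = 0" "w (\<gamma> r2) = 0"
        using r1 r2 w0 by (auto simp: Z_def)
      have first: "ennreal \<bar>w (\<gamma> a)\<bar> \<le> curve_integral (a, r1, \<gamma>) ?k"
      proof (cases "r1 = a")
        case False
        define t where "t n = r1 - (r1 - a) * inverse (real (Suc n))" for n
        have t: "a \<le> t n" "t n < r1" for n
          using False r(1) mult_left_mono[of "inverse (real (Suc n))" 1 "r1 - a"]
          by (auto simp: t_def inverse_le_1_iff algebra_simps)
        have "t \<longlonglongrightarrow> r1 - (r1 - a) * 0"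
          unfolding t_def by (intro tendsto_intros LIMSEQ_inverse_real_of_nat)
        then have "(\<lambda>n. w (\<gamma> (t n)) - w (\<gamma> r1)) \<longlonglongrightarrow> 0"
          using t r le by (intro w_cont[where r=r1]) (auto intro: less_imp_le order_trans)
        then have "(\<lambda>n. ennreal \<bar>w (\<gamma> a) - w (\<gamma> (t n))\<bar>) \<longlonglongrightarrow> ennreal \<bar>w (\<gamma> a) - 0\<bar>"
          using r(4) by (intro tendsto_intros tendsto_ennrealI) simp
        moreover have "ennreal \<bar>w (\<gamma> a) - w (\<gamma> (t n))\<bar> \<le> curve_integral (a, r1, \<gamma>) ?k" for n
        proof -
          have "\<gamma> ` {a..t n} \<subseteq> \<Omega>"
            using t[of n] r r1(2) by (fastforce simp: Z_def)
          then have "ennreal \<bar>w (\<gamma> a) - w (\<gamma> (t n))\<bar> \<le> curve_integral (a, t n, \<gamma>) ?k"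
            using t[of n] r by (intro inside) auto
          also have "\<dots> \<le> curve_integral (a, r1, \<gamma>) ?k"
          proof -
            interpret s: rectifiable a r1 \<gamma> using subcurve r by auto
            show ?thesis using s.curve_integral_subcurve_le[of a "t n" UNIV ?k] t[of n] ext[OF bk] by simp
          qed
          finally show ?thesis .
        qed
        ultimately have "ennreal \<bar>w (\<gamma> a) - 0\<bar> \<le> curve_integral (a, r1, \<gamma>) ?k"
          using LIMSEQ_le_const2 by blast
        then show ?thesis by simp
      qed (use r in simp)
      have last: "ennreal \<bar>w (\<gamma> b)\<bar> \<le> curve_integral (r2, b, \<gamma>) ?k"
      proof (cases "r2 = b")
        case False
        define t where "t n = r2 + (b - r2) * inverse (real (Suc n))" for n
        have t: "t n \<le> b" "r2 < t n" for n
          using False r(3) mult_left_mono[of "inverse (real (Suc n))" 1 "b - r2"]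
          by (auto simp: t_def inverse_le_1_iff algebra_simps)
        have "t \<longlonglongrightarrow> r2 + (b - r2) * 0"
          unfolding t_def by (intro tendsto_intros LIMSEQ_inverse_real_of_nat)
        then have "(\<lambda>n. w (\<gamma> r2) - w (\<gamma> (t n))) \<longlonglongrightarrow> 0"
          using t r le by (intro w_cont[where r=r2]) (auto intro: less_imp_le order_trans)
        then have "(\<lambda>n. ennreal \<bar>(w (\<gamma> r2) - w (\<gamma> (t n))) + w (\<gamma> b)\<bar>) \<longlonglongrightarrow> ennreal \<bar>0 + w (\<gamma> b)\<bar>"
          by (intro tendsto_intros tendsto_ennrealI)
        moreover have "ennreal \<bar>(w (\<gamma> r2) - w (\<gamma> (t n))) + w (\<gamma> b)\<bar> \<le> curve_integral (r2, b, \<gamma>) ?k" for n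
        proof -
          have "\<gamma> ` {t n..b} \<subseteq> \<Omega>"
            using t[of n] r r2(2) by (fastforce simp: Z_def)
          then have "ennreal \<bar>w (\<gamma> (t n)) - w (\<gamma> b)\<bar> \<le> curve_integral (t n, b, \<gamma>) ?k"
            using t[of n] r by (intro inside) auto
          also have "\<dots> \<le> curve_integral (r2, b, \<gamma>) ?k"
          proof -
            interpret s: rectifiable r2 b \<gamma> using subcurve r by auto
            show ?thesis using s.curve_integral_subcurve_le[of "t n" b UNIV ?k] t[of n] ext[OF bk] by simp
          qed
          finally show ?thesis using r by (simp add: abs_minus_commute)
        qed
        ultimately have "ennreal \<bar>0 + w (\<gamma> b)\<bar> \<le> curve_integral (r2, b, \<gamma>) ?k"
          using LIMSEQ_le_const2 by blast
        then show ?thesis by simp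
      qed (use r in simp)
      have "ennreal \<bar>w (\<gamma> a) - w (\<gamma> b)\<bar> \<le> ennreal \<bar>w (\<gamma> a)\<bar> + ennreal \<bar>w (\<gamma> b)\<bar>"
        by (simp add: ennreal_leI flip: ennreal_plus)
      also have "\<dots> \<le> curve_integral (a, r1, \<gamma>) ?k + curve_integral (r2, b, \<gamma>) ?k"
        by (intro add_mono first last)
      also have "\<dots> \<le> curve_integral (a, r1, \<gamma>) ?k + curve_integral (r1, b, \<gamma>) ?k"
      proof -
        interpret s: rectifiable r1 b \<gamma> using subcurve r by auto
        show ?thesis using s.curve_integral_subcurve_le[of r2 b UNIV ?k] r ext[OF bk]
          by (intro add_left_mono) simp
      qed
      also have "\<dots> = curve_integral (a, b, \<gamma>) ?k"
        using curve_integral_split[of r1 UNIV ?k] r ext[OF bk] by simp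
      finally show ?thesis .
    qed
  qed
qed

section \<open>The Friedrichs inequality\<close>

text \<open>The Poincare inequality speaks about upper gradients without exceptional curves. Adding a small
  multiple of a function with infinite integral along all exceptional curves removes the exception at an
  arbitrarily small cost.\<close>

lemma upper_gradient_perturbation:
  assumes "weak_upper_gradient p M S u h"
  obtains R where "borel_fun_on S R" "p_integral S R < top"
    "\<And>t. 0 < t \<Longrightarrow> upper_gradient S u (\<lambda>x. h x + ennreal t * R x)"
proof -
  have bh: "borel_fun_on S h" using assms by (simp add: weak_upper_gradient_def)
  obtain R where R: "borel_fun_on S R" "p_integral S R < top"
    "\<And>a b \<gamma> c d. (a, b, \<gamma>) \<in> rect_curves S \<Longrightarrow> curve_integral (a, b, \<gamma>) R < top \<Longrightarrow>
      a \<le> c \<Longrightarrow> c \<le> d \<Longrightarrow> d \<le> b \<Longrightarrow> ennreal \<bar>u (\<gamma> c) - u (\<gamma> d)\<bar> \<le> curve_integral (c, d, \<gamma>) h"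
    by (rule weak_upper_gradientE[OF assms]) blast
  have "upper_gradient S u (\<lambda>x. h x + ennreal t * R x)" if "0 < t" for t
    unfolding upper_gradient_def
  proof (intro conjI ballI)
    show "borel_fun_on S (\<lambda>x. h x + ennreal t * R x)"
      by (rule borel_fun_on_add[OF bh borel_fun_on_cmult[OF R(1)]])
    fix c assume c: "c \<in> rect_curves S"
    obtain a b \<gamma> where c_def: "c = (a, b, \<gamma>)" by (cases c) auto
    have eq: "curve_integral c (\<lambda>x. h x + ennreal t * R x) = curve_integral c h + ennreal t * curve_integral c R"
      using curve_integral_add[OF c bh borel_fun_on_cmult[OF R(1)]] curve_integral_cmult[OF c R(1)] by simp
    show "ug_ineq u (\<lambda>x. h x + ennreal t * R x) c"
    proof (cases "curve_integral c R < top")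
      case True
      then have "ennreal \<bar>u (\<gamma> a) - u (\<gamma> b)\<bar> \<le> curve_integral c h"
        using R(3)[of a b \<gamma> a b] c rectifiable.le[OF rect_curvesD(1)] by (auto simp: c_def)
      also have "\<dots> \<le> curve_integral c (\<lambda>x. h x + ennreal t * R x)" unfolding eq by simp
      finally show ?thesis by (simp add: ug_ineq_def c_def)
    next
      case False
      then have "curve_integral c (\<lambda>x. h x + ennreal t * R x) = top"
        unfolding eq using that by (simp add: not_less top_unique ennreal_mult_top)
      then show ?thesis by (simp add: ug_ineq_def c_def)
    qed
  qed
  then show ?thesis using that R(1,2) by blast
qed

lemma doubling_ball:
  assumes "doubling M" "0 < r"
  shows "0 < emeasure M (ball x r)" "emeasure M (ball x r) < top"
proof -
  obtain C :: real where C: "1 \<le> C" "\<And>x r. 0 < r \<Longrightarrow> 0 < emeasure M (ball x (2 * r)) \<and>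
        emeasure M (ball x (2 * r)) \<le> ennreal C * emeasure M (ball x r) \<and>
        ennreal C * emeasure M (ball x r) < \<infinity>"
    using assms(1) by (auto simp: doubling_def)
  show "0 < emeasure M (ball x r)" using C(2)[of "r / 2" x] assms(2) by simp
  show "emeasure M (ball x r) < top"
    using C(2)[of r x] C(1) assms(2) by (auto simp: ennreal_mult_less_top)
qed

text \<open>The complement of \<open>\<Omega>\<close> is covered by countably many balls, so its measure is seen in one of them.\<close>

lemma exists_ball_meeting_complement:
  assumes "doubling M" "bounded \<Omega>" "open \<Omega>" "0 < emeasure M (UNIV - \<Omega>)"
  obtains x r where "0 < r" "\<Omega> \<subseteq> ball x r" "0 < emeasure M (ball x r - \<Omega>)"
proof -
  obtain x :: 'a and r0 where r0: "\<Omega> \<subseteq> ball x r0"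
    using bounded_subset_ballD[OF assms(2)] by blast
  let ?B = "\<lambda>n. ball x (max r0 0 + real (Suc n)) - \<Omega>"
  have sets: "?B n \<in> sets M" for n using assms(3) by (intro borel_sets) auto
  have "\<exists>n. 0 < emeasure M (?B n)"
  proof (rule ccontr)
    assume "\<not> ?thesis"
    then have "?B n \<in> null_sets M" for n using sets by auto
    then have "(\<Union>n. ?B n) \<in> null_sets M" by (rule null_sets_UN)
    moreover have "(\<Union>n. ?B n) = UNIV - \<Omega>"
    proof -
      have "\<exists>n. dist x y < max r0 0 + real (Suc n)" for y
      proof -
        obtain n where "dist x y < real n" using reals_Archimedean2 by blast
        then show ?thesis by (intro exI[of _ n]) auto
      qed
      then show ?thesis by auto
    qed
    ultimately show False using assms(4) by auto
  qed
  then obtain n where "0 < emeasure M (?B n)" by blast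
  moreover have "\<Omega> \<subseteq> ball x (max r0 0 + real (Suc n))" using r0 by fastforce
  ultimately show ?thesis using that[of "max r0 0 + real (Suc n)" x] by simp
qed

text \<open>The mean value \<open>a\<close> of \<open>w\<close> over the ball is controlled because \<open>w\<close> vanishes on a part of the ball of
  positive measure, where \<open>\<bar>w - a\<bar> = \<bar>a\<bar>\<close>.\<close>

lemma integral_abs_powr_le_of_vanishing:
  fixes w :: "'a \<Rightarrow> real"
  assumes [measurable]: "w \<in> borel_measurable M" "B \<in> sets M" "A \<in> sets M"
    and A: "A \<subseteq> B" "emeasure M A = ennreal mA" "0 < mA" and B: "emeasure M B = ennreal mB" "0 \<le> mB"
    and w: "\<And>x. x \<in> A \<Longrightarrow> w x = 0"
  shows "(\<integral>\<^sup>+ x\<in>B. ennreal (\<bar>w x\<bar> powr p) \<partial>M) \<le>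
    ennreal (2 powr p * (1 + mB / mA)) * (\<integral>\<^sup>+ x\<in>B. ennreal (\<bar>w x - a\<bar> powr p) \<partial>M)" (is "_ \<le> _ * ?T")
proof -
  have "ennreal (\<bar>a\<bar> powr p) * ennreal mA = (\<integral>\<^sup>+ x. ennreal (\<bar>a\<bar> powr p) * indicator A x \<partial>M)"
    by (simp add: nn_integral_cmult_indicator A)
  also have "\<dots> \<le> ?T"
    using A(1) w by (intro nn_integral_mono) (auto simp: indicator_def)
  finally have "ennreal (mB / mA) * (ennreal (\<bar>a\<bar> powr p) * ennreal mA) \<le> ennreal (mB / mA) * ?T"
    by (rule mult_left_mono) simp
  moreover have "ennreal (mB / mA) * (ennreal (\<bar>a\<bar> powr p) * ennreal mA) = ennreal (\<bar>a\<bar> powr p) * ennreal mB"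
    using A(3) B(2) by (simp flip: ennreal_mult)
  ultimately have a: "ennreal (\<bar>a\<bar> powr p) * ennreal mB \<le> ennreal (mB / mA) * ?T" by simp
  have "(\<integral>\<^sup>+ x\<in>B. ennreal (\<bar>w x\<bar> powr p) \<partial>M) \<le>
      (\<integral>\<^sup>+ x. ennreal (2 powr p) * (ennreal (\<bar>w x - a\<bar> powr p) * indicator B x + ennreal (\<bar>a\<bar> powr p) * indicator B x) \<partial>M)"
  proof (rule nn_integral_mono)
    fix x
    have "ennreal (\<bar>w x\<bar> powr p) \<le> epowr (ennreal \<bar>w x - a\<bar> + ennreal \<bar>a\<bar>) p"
      using p by (auto intro!: ennreal_leI powr_mono2 simp flip: ennreal_plus)
    also have "\<dots> \<le> ennreal (2 powr p) * (epowr (ennreal \<bar>w x - a\<bar>) p + epowr (ennreal \<bar>a\<bar>) p)"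
      using p by (intro epowr_add_le) simp
    finally show "ennreal (\<bar>w x\<bar> powr p) * indicator B x \<le> ennreal (2 powr p) *
        (ennreal (\<bar>w x - a\<bar> powr p) * indicator B x + ennreal (\<bar>a\<bar> powr p) * indicator B x)"
      by (auto simp: indicator_def)
  qed
  also have "\<dots> = ennreal (2 powr p) * (?T + ennreal (\<bar>a\<bar> powr p) * ennreal mB)"
    by (simp add: nn_integral_cmult nn_integral_add nn_integral_cmult_indicator B)
  also have "\<dots> \<le> ennreal (2 powr p) * (?T + ennreal (mB / mA) * ?T)"
    by (intro mult_left_mono add_left_mono a) simp
  also have "\<dots> = ennreal (2 powr p * (1 + mB / mA)) * ?T"
    using A(3) B(2) by (simp add: ennreal_mult distrib_right mult.assoc)
  finally show ?thesis .
qed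

lemma integrable_of_bounded_support:
  fixes w :: "'a \<Rightarrow> real"
  assumes [measurable]: "w \<in> borel_measurable M" "B \<in> sets M" and B: "emeasure M B < top"
    and w: "\<And>x. x \<notin> B \<Longrightarrow> w x = 0" "(\<integral>\<^sup>+ x. ennreal (\<bar>w x\<bar> powr p) \<partial>M) < top"
  shows "integrable M w"
proof (rule integrableI_bounded)
  have "(\<integral>\<^sup>+ x. ennreal (norm (w x)) \<partial>M) \<le> (\<integral>\<^sup>+ x. indicator B x + ennreal (\<bar>w x\<bar> powr p) \<partial>M)"
  proof (rule nn_integral_mono)
    fix x
    have "\<bar>w x\<bar> \<le> \<bar>w x\<bar> powr p" if "\<not> \<bar>w x\<bar> \<le> 1"
      using powr_mono[of 1 p "\<bar>w x\<bar>"] p that by simp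
    then have "\<bar>w x\<bar> \<le> 1 + \<bar>w x\<bar> powr p" by (cases "\<bar>w x\<bar> \<le> 1") (auto intro: order_trans)
    then show "ennreal (norm (w x)) \<le> indicator B x + ennreal (\<bar>w x\<bar> powr p)"
      using w(1)[of x] by (cases "x \<in> B") (auto simp: ennreal_leI simp flip: ennreal_plus ennreal_1)
  qed
  also have "\<dots> = emeasure M B + (\<integral>\<^sup>+ x. ennreal (\<bar>w x\<bar> powr p) \<partial>M)"
    by (simp add: nn_integral_add)
  also have "\<dots> < \<infinity>" using w B by simp
  finally show "(\<integral>\<^sup>+ x. ennreal (norm (w x)) \<partial>M) < \<infinity>" .
qed simp

lemma ennreal_le_of_small_perturbations:
  assumes "\<And>t. 0 < t \<Longrightarrow> X \<le> Y + ennreal (t powr p) * K" "K < top"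
  shows "X \<le> Y"
proof (rule ennreal_le_epsilon)
  obtain k where k: "0 \<le> k" "K = ennreal k" using assms(2) by (auto simp: less_top_ennreal)
  fix e :: real assume e: "0 < e"
  define t where "t = (e / (k + 1)) powr (1 / p)"
  have t: "0 < t" "t powr p = e / (k + 1)" using e k p by (auto simp: t_def powr_powr)
  have "e / (k + 1) * k \<le> e" using e k by (simp add: field_simps)
  then have "ennreal (t powr p) * K \<le> ennreal e"
    unfolding t(2) k(2) using e k(1) by (simp add: ennreal_leI flip: ennreal_mult)
  then show "X \<le> Y + ennreal e" using assms(1)[OF t(1)] by (meson add_left_mono order_trans)
qed

text \<open>The Poincare inequality is applied on a ball \<open>B\<close> that contains \<open>\<Omega>\<close>, where the mean value is
  eliminated by the preceding estimate. Replacing the ball of radius \<open>l * r\<close> on the right by the whole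
  space only increases the integral.\<close>

lemma Friedrichs_inequality:
  assumes "doubling M" "poincare p M" "bounded \<Omega>" "open \<Omega>" "0 < emeasure M (UNIV - \<Omega>)"
  obtains C :: real where "0 \<le> C"
    "\<And>w h. w \<in> borel_measurable M \<Longrightarrow> (\<integral>\<^sup>+ x. ennreal (\<bar>w x\<bar> powr p) \<partial>M) < top \<Longrightarrow>
      (\<And>x. x \<notin> \<Omega> \<Longrightarrow> w x = 0) \<Longrightarrow> weak_upper_gradient p M UNIV w h \<Longrightarrow>
      (\<integral>\<^sup>+ x. ennreal (\<bar>w x\<bar> powr p) \<partial>M) \<le> ennreal C * (\<integral>\<^sup>+ x. epowr (h x) p \<partial>M)"
proof -
  obtain x r where r: "0 < r" "\<Omega> \<subseteq> ball x r" "0 < emeasure M (ball x r - \<Omega>)"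
    using exists_ball_meeting_complement[OF assms(1,3-5)] .
  obtain CP l :: real where P: "0 < CP \<and> 1 \<le> l \<and> (\<forall>u x r h. integrable M u \<and> r > 0 \<and> upper_gradient UNIV u h \<longrightarrow>
      epowr ((\<integral>\<^sup>+ y\<in>ball x r. epowr (ennreal \<bar>u y - average M (ball x r) u\<bar>) p \<partial>M) / emeasure M (ball x r)) (1 / p)
      \<le> ennreal (CP * r) *
        epowr ((\<integral>\<^sup>+ y\<in>ball x (l * r). epowr (h y) p \<partial>M) / emeasure M (ball x (l * r))) (1 / p))"
    using assms(2) unfolding poincare_def by (elim exE) (rule that)
  then have CP: "0 < CP" "1 \<le> l" by auto
  define A where "A = ball x r - \<Omega>"
  have sets: "ball x r \<in> sets M" "A \<in> sets M" "ball x (l * r) \<in> sets M"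
    unfolding A_def using assms(4) by (auto intro!: borel_sets)
  have lr: "ball x r \<subseteq> ball x (l * r)"
    using CP(2) r(1) by (intro subset_ball) simp
  define mA mB where "mA = measure M A" and "mB = measure M (ball x r)"
  have "emeasure M A \<le> emeasure M (ball x r)" using sets by (intro emeasure_mono) (auto simp: A_def)
  then have "emeasure M A < top" using doubling_ball(2)[OF assms(1) r(1), of x] by simp
  then have mA: "emeasure M A = ennreal mA"
    unfolding mA_def by (intro emeasure_eq_ennreal_measure) simp
  then have "0 < mA" using r(3) by (simp add: A_def)
  have mB: "emeasure M (ball x r) = ennreal mB"
    unfolding mB_def using doubling_ball(2)[OF assms(1) r(1), of x] by (intro emeasure_eq_ennreal_measure) simp
  then have "0 < mB" using doubling_ball(1)[OF assms(1) r(1), of x] by simp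
  have inverse_mono: "inverse (emeasure M (ball x (l * r))) \<le> inverse (emeasure M (ball x r))"
  proof -
    have "0 < l * r" using CP(2) r(1) by simp
    obtain m where m: "0 \<le> m" "emeasure M (ball x (l * r)) = ennreal m"
      using doubling_ball(2)[OF assms(1) \<open>0 < l * r\<close>, of x] by (auto simp: less_top_ennreal)
    have "ennreal mB \<le> ennreal m" unfolding mB[symmetric] m(2)[symmetric] by (intro emeasure_mono lr sets)
    then have "mB \<le> m" using m(1) by simp
    then show ?thesis
      unfolding mB m(2) using \<open>0 < mB\<close> by (simp add: inverse_ennreal ennreal_leI le_imp_inverse_le)
  qed
  define k where "k = (CP * r) powr p"
  define c where "c = 2 powr p * (1 + mB / mA)"
  have nonneg: "0 \<le> k" "0 \<le> c" using \<open>0 < mA\<close> \<open>0 < mB\<close> by (auto simp: k_def c_def)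
  have strong: "(\<integral>\<^sup>+ x. ennreal (\<bar>w x\<bar> powr p) \<partial>M) \<le> ennreal (c * k) * (\<integral>\<^sup>+ x. epowr (h x) p \<partial>M)"
    if w: "w \<in> borel_measurable M" "(\<integral>\<^sup>+ x. ennreal (\<bar>w x\<bar> powr p) \<partial>M) < top"
      "\<And>x. x \<notin> \<Omega> \<Longrightarrow> w x = 0" and h: "upper_gradient UNIV w h" for w h
  proof -
    define a where "a = average M (ball x r) w"
    let ?T = "\<integral>\<^sup>+ y\<in>ball x r. ennreal (\<bar>w y - a\<bar> powr p) \<partial>M"
    let ?I = "\<integral>\<^sup>+ y\<in>ball x (l * r). epowr (h y) p \<partial>M"
    have w_out: "w y = 0" if "y \<notin> ball x r" for y using w(3) r(2) that by blast
    have "integrable M w"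
      by (rule integrable_of_bounded_support[OF w(1) sets(1) doubling_ball(2)[OF assms(1) r(1)] w_out w(2)])
    then have "epowr (?T / emeasure M (ball x r)) (1 / p) \<le>
        ennreal (CP * r) * epowr (?I / emeasure M (ball x (l * r))) (1 / p)"
      using P[THEN conjunct2, THEN conjunct2, rule_format, of w r h x] h r(1) by (simp add: a_def)
    then have "epowr (epowr (?T / emeasure M (ball x r)) (1 / p)) p \<le>
        epowr (ennreal (CP * r) * epowr (?I / emeasure M (ball x (l * r))) (1 / p)) p"
      using p by (intro epowr_mono) auto
    then have "?T / emeasure M (ball x r) \<le> ennreal k * (?I / emeasure M (ball x (l * r)))"
      using p CP r(1) by (simp add: epowr_cmult epowr_inverse k_def)
    also have "\<dots> \<le> ennreal k * (?I / emeasure M (ball x r))"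
      unfolding divide_ennreal_def
      by (intro mult_left_mono inverse_mono) simp_all
    finally have "?T / ennreal mB * ennreal mB \<le> ennreal k * (?I / ennreal mB) * ennreal mB"
      unfolding mB by (rule mult_right_mono) simp
    moreover have cancel: "X / ennreal mB * ennreal mB = X" for X
      using \<open>0 < mB\<close> by (simp add: ennreal_divide_times ennreal_divide_self)
    ultimately have T: "?T \<le> ennreal k * ?I" by (simp add: mult.assoc)
    have "(\<integral>\<^sup>+ x. ennreal (\<bar>w x\<bar> powr p) \<partial>M) = (\<integral>\<^sup>+ y\<in>ball x r. ennreal (\<bar>w y\<bar> powr p) \<partial>M)"
      using w_out by (intro nn_integral_cong) (auto simp: indicator_def)
    also have "\<dots> \<le> ennreal c * ?T"
      unfolding c_def using w sets mA mB \<open>0 < mA\<close> \<open>0 < mB\<close>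
      by (intro integral_abs_powr_le_of_vanishing[where A=A]) (auto simp: A_def)
    also have "\<dots> \<le> ennreal c * (ennreal k * ?I)" by (intro mult_left_mono T) simp
    also have "\<dots> \<le> ennreal c * (ennreal k * (\<integral>\<^sup>+ x. epowr (h x) p \<partial>M))"
      by (intro mult_left_mono nn_integral_mono) (auto simp: indicator_def)
    also have "\<dots> = ennreal (c * k) * (\<integral>\<^sup>+ x. epowr (h x) p \<partial>M)"
      using nonneg by (simp add: ennreal_mult mult.assoc)
    finally show ?thesis .
  qed
  define C where "C = c * k * 2 powr p"
  have "(\<integral>\<^sup>+ x. ennreal (\<bar>w x\<bar> powr p) \<partial>M) \<le> ennreal C * (\<integral>\<^sup>+ x. epowr (h x) p \<partial>M)"
    if w: "w \<in> borel_measurable M" "(\<integral>\<^sup>+ x. ennreal (\<bar>w x\<bar> powr p) \<partial>M) < top"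
      "\<And>x. x \<notin> \<Omega> \<Longrightarrow> w x = 0" and h: "weak_upper_gradient p M UNIV w h" for w h
  proof -
    obtain R where R: "borel_fun_on UNIV R" "p_integral UNIV R < top"
      "\<And>t. 0 < t \<Longrightarrow> upper_gradient UNIV w (\<lambda>x. h x + ennreal t * R x)"
      by (rule upper_gradient_perturbation[OF h]) blast
    have [measurable]: "h \<in> borel_measurable M" "R \<in> borel_measurable M"
      using h R(1) borel_fun_measurable[of UNIV] by (auto simp: weak_upper_gradient_def)
    show ?thesis
    proof (rule ennreal_le_of_small_perturbations)
      show "ennreal C * (\<integral>\<^sup>+ x. epowr (R x) p \<partial>M) < top" using R(2) by (simp add: ennreal_mult_less_top)
      fix t :: real assume t: "0 < t"
      have "(\<integral>\<^sup>+ x. ennreal (\<bar>w x\<bar> powr p) \<partial>M) \<le>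
          ennreal (c * k) * (\<integral>\<^sup>+ x. epowr (h x + ennreal t * R x) p \<partial>M)"
        by (rule strong[OF w R(3)[OF t]])
      also have "\<dots> \<le> ennreal (c * k) *
          (\<integral>\<^sup>+ x. ennreal (2 powr p) * (epowr (h x) p + ennreal (t powr p) * epowr (R x) p) \<partial>M)"
        using p t epowr_add_le[of p "h _" "ennreal t * R _"]
        by (intro mult_left_mono nn_integral_mono) (auto simp: epowr_cmult)
      also have "\<dots> = ennreal (c * k) * (ennreal (2 powr p) *
          ((\<integral>\<^sup>+ x. epowr (h x) p \<partial>M) + ennreal (t powr p) * (\<integral>\<^sup>+ x. epowr (R x) p \<partial>M)))"
        by (simp add: nn_integral_cmult nn_integral_add)
      also have "\<dots> = ennreal C * (\<integral>\<^sup>+ x. epowr (h x) p \<partial>M) +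
          ennreal (t powr p) * (ennreal C * (\<integral>\<^sup>+ x. epowr (R x) p \<partial>M))"
        using nonneg by (simp add: C_def ennreal_mult distrib_left mult_ac)
      finally show "(\<integral>\<^sup>+ x. ennreal (\<bar>w x\<bar> powr p) \<partial>M) \<le> ennreal C * (\<integral>\<^sup>+ x. epowr (h x) p \<partial>M) +
          ennreal (t powr p) * (ennreal C * (\<integral>\<^sup>+ x. epowr (R x) p \<partial>M))" .
    qed
  qed
  moreover have "0 \<le> C" using nonneg by (simp add: C_def)
  ultimately show ?thesis using that by blast
qed

end

section \<open>The Dirichlet problem\<close>

locale dirichlet_problem = regular_space M p for M :: "'a::metric_space measure" and p :: real +
  fixes \<Omega> :: "'a set" and f g :: "'a \<Rightarrow> real"
  assumes doubling: "doubling M" and poincare: "poincare p M"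
    and \<Omega>: "bounded \<Omega>" "open \<Omega>" "emeasure M (UNIV - \<Omega>) > 0"
    and f: "f \<in> Lp (p / (p - 1)) (restrict_space M \<Omega>)" and g: "g \<in> newtonian p M \<Omega>"
begin

abbreviation "N \<equiv> restrict_space M \<Omega>"

definition dirichlet_energy :: "('a \<Rightarrow> real) \<Rightarrow> real" where
  "dirichlet_energy u = enn2real (\<integral>\<^sup>+ x. epowr (minimal_wug p M \<Omega> u x) p \<partial>N)"

definition norm_power :: "('a \<Rightarrow> real) \<Rightarrow> real" where
  "norm_power u = enn2real (\<integral>\<^sup>+ x. ennreal (\<bar>u x\<bar> powr p) \<partial>N)"

lemma energy_eq: "energy p M \<Omega> f u = dirichlet_energy u - p * (LINT x|N. f x * u x)"
  by (simp add: energy_def dirichlet_energy_def)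

lemma \<Omega>_borel: "\<Omega> \<in> sets borel" using \<Omega> by simp

lemma
  assumes "u \<in> newtonian p M \<Omega>"
  shows newtonian_measurable: "u \<in> borel_measurable N"
    and norm_power: "(\<integral>\<^sup>+ x. ennreal (\<bar>u x\<bar> powr p) \<partial>N) = ennreal (norm_power u)"
    and dirichlet_energy: "(\<integral>\<^sup>+ x. epowr (minimal_wug p M \<Omega> u x) p \<partial>N) = ennreal (dirichlet_energy u)"
    and integrable_source: "integrable N (\<lambda>x. f x * u x)"
proof -
  show u: "u \<in> borel_measurable N" and pn: "(\<integral>\<^sup>+ x. ennreal (\<bar>u x\<bar> powr p) \<partial>N) = ennreal (norm_power u)"
    using assms by (auto simp: newtonian_iff norm_power_def less_top)
  show "(\<integral>\<^sup>+ x. epowr (minimal_wug p M \<Omega> u x) p \<partial>N) = ennreal (dirichlet_energy u)"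
    using minimal_wug(2)[OF \<Omega>_borel assms] by (simp add: dirichlet_energy_def less_top)
  show "integrable N (\<lambda>x. f x * u x)"
    by (rule Young_integral[OF p f]) (use u pn in \<open>auto simp: norm_power_def\<close>)
qed

lemma norm_power_nonneg: "0 \<le> norm_power u" by (simp add: norm_power_def)

lemma dirichlet_energy_nonneg: "0 \<le> dirichlet_energy u" by (simp add: dirichlet_energy_def)

lemma dirichlet_energy_le:
  assumes "u \<in> newtonian p M \<Omega>" "weak_upper_gradient p M \<Omega> u k"
  shows "ennreal (dirichlet_energy u) \<le> (\<integral>\<^sup>+ x. epowr (k x) p \<partial>N)"
  using minimal_wug(3)[OF \<Omega>_borel assms] dirichlet_energy[OF assms(1)] by simp

lemma midpoint_weak_upper_gradient:
  assumes "u \<in> newtonian p M \<Omega>" "v \<in> newtonian p M \<Omega>"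
  shows "weak_upper_gradient p M \<Omega> (\<lambda>x. (u x + v x) / 2)
    (\<lambda>x. ennreal (1 / 2) * minimal_wug p M \<Omega> u x + ennreal (1 / 2) * minimal_wug p M \<Omega> v x)"
  using weak_upper_gradient_lincomb[OF minimal_wug(1)[OF \<Omega>_borel assms(1)] minimal_wug(1)[OF \<Omega>_borel assms(2)],
      of "1 / 2" "1 / 2"]
  by (simp add: add_divide_distrib del: ennreal_half)

lemma midpoint_newtonian:
  assumes "u \<in> newtonian p M S" "v \<in> newtonian p M S"
  shows "(\<lambda>x. (u x + v x) / 2) \<in> newtonian p M S"
  using newtonian_lincomb[OF assms, of "1 / 2" "1 / 2"] by (simp add: add_divide_distrib)

lemma admissible_newtonian: "u \<in> admissible p M \<Omega> g \<Longrightarrow> u \<in> newtonian p M \<Omega>"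
  by (simp add: admissible_def)

lemma admissibleE:
  assumes "u \<in> admissible p M \<Omega> g"
  obtains w where "w \<in> newtonian p M UNIV" "\<And>x. x \<notin> \<Omega> \<Longrightarrow> w x = 0" "\<And>x. x \<in> \<Omega> \<Longrightarrow> u x = w x + g x"
proof -
  obtain w where "w \<in> newtonian p M UNIV" "\<forall>x. x \<notin> \<Omega> \<longrightarrow> w x = 0" "\<forall>x\<in>\<Omega>. u x - g x = w x"
    using assms by (auto simp: admissible_def newtonian0_def)
  then show ?thesis using that[of w] by (auto simp: algebra_simps)
qed

lemma admissibleI:
  assumes "u \<in> newtonian p M \<Omega>" "w \<in> newtonian p M UNIV" "\<And>x. x \<notin> \<Omega> \<Longrightarrow> w x = 0" "\<And>x. x \<in> \<Omega> \<Longrightarrow> u x = w x + g x"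
  shows "u \<in> admissible p M \<Omega> g"
  using assms by (auto simp: admissible_def newtonian0_def intro!: bexI[of _ w])

lemma midpoint_admissible:
  assumes "u \<in> admissible p M \<Omega> g" "v \<in> admissible p M \<Omega> g"
  shows "(\<lambda>x. (u x + v x) / 2) \<in> admissible p M \<Omega> g"
proof -
  obtain w where w: "w \<in> newtonian p M UNIV" "\<And>x. x \<notin> \<Omega> \<Longrightarrow> w x = 0" "\<And>x. x \<in> \<Omega> \<Longrightarrow> u x = w x + g x"
    by (rule admissibleE[OF assms(1)]) blast
  obtain w' where w': "w' \<in> newtonian p M UNIV" "\<And>x. x \<notin> \<Omega> \<Longrightarrow> w' x = 0" "\<And>x. x \<in> \<Omega> \<Longrightarrow> v x = w' x + g x"
    by (rule admissibleE[OF assms(2)]) blast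
  show ?thesis
    by (rule admissibleI[where w="\<lambda>x. (w x + w' x) / 2", OF midpoint_newtonian midpoint_newtonian])
      (use w w' assms in \<open>auto intro: admissible_newtonian simp: field_simps\<close>)
qed

lemma g_admissible: "g \<in> admissible p M \<Omega> g"
proof (rule admissibleI[OF g, where w="\<lambda>x. 0"])
  have "weak_upper_gradient p M UNIV (\<lambda>x. 0) (\<lambda>x. 0)"
    by (rule weak_upper_gradientI[where R="\<lambda>x. 0"]) auto
  then show "(\<lambda>x. 0) \<in> newtonian p M UNIV"
    by (auto simp: newtonian_iff intro!: exI[of _ "\<lambda>x. 0"])
qed auto

text \<open>Although \<open>w\<close> lives on the whole space, its gradient is bounded by gradients in \<open>\<Omega>\<close> alone. This
  is what makes the gradients of the extensions converge together with those of a minimizing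
  sequence.\<close>

lemma extension_weak_upper_gradient:
  assumes u: "u \<in> admissible p M \<Omega> g"
    and w: "w \<in> newtonian p M UNIV" "\<And>x. x \<notin> \<Omega> \<Longrightarrow> w x = 0" "\<And>x. x \<in> \<Omega> \<Longrightarrow> u x = w x + g x"
  shows "weak_upper_gradient p M UNIV w
    (\<lambda>x. (minimal_wug p M \<Omega> u x + minimal_wug p M \<Omega> g x) * indicator \<Omega> x)"
proof -
  obtain H where H: "weak_upper_gradient p M UNIV w H" "(\<integral>\<^sup>+ x. epowr (H x) p \<partial>M) < top"
    using w(1) by (auto simp: newtonian_iff)
  have "weak_upper_gradient p M \<Omega> (\<lambda>x. 1 * u x + (- 1) * g x)
      (\<lambda>x. ennreal \<bar>1\<bar> * minimal_wug p M \<Omega> u x + ennreal \<bar>- 1\<bar> * minimal_wug p M \<Omega> g x)"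
    by (intro weak_upper_gradient_lincomb minimal_wug \<Omega>_borel admissible_newtonian u g)
  then have "weak_upper_gradient p M \<Omega> (\<lambda>x. u x - g x) (\<lambda>x. minimal_wug p M \<Omega> u x + minimal_wug p M \<Omega> g x)"
    by simp
  then have "weak_upper_gradient p M \<Omega> w (\<lambda>x. minimal_wug p M \<Omega> u x + minimal_wug p M \<Omega> g x)"
    by (rule weak_upper_gradient_cong) (use w in auto)
  then show ?thesis
    using weak_upper_gradient_zero_extension[OF \<Omega>(2), of w] w(2) H by blast
qed

text \<open>This is the Friedrichs inequality for \<open>u - g\<close>; the terms with \<open>g\<close> make up \<open>C2\<close>.\<close>

lemma norm_power_bound:
  obtains C1 C2 where "0 \<le> C1" "0 \<le> C2"
    "\<And>u. u \<in> admissible p M \<Omega> g \<Longrightarrow> norm_power u \<le> C1 * dirichlet_energy u + C2"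
proof -
  obtain C where C: "0 \<le> C" "\<And>w h. w \<in> borel_measurable M \<Longrightarrow> (\<integral>\<^sup>+ x. ennreal (\<bar>w x\<bar> powr p) \<partial>M) < top \<Longrightarrow>
      (\<And>x. x \<notin> \<Omega> \<Longrightarrow> w x = 0) \<Longrightarrow> weak_upper_gradient p M UNIV w h \<Longrightarrow>
      (\<integral>\<^sup>+ x. ennreal (\<bar>w x\<bar> powr p) \<partial>M) \<le> ennreal C * (\<integral>\<^sup>+ x. epowr (h x) p \<partial>M)"
    by (rule Friedrichs_inequality[OF doubling poincare \<Omega>]) blast
  define c where "c = 2 powr p"
  have "0 \<le> c" by (simp add: c_def)
  have "norm_power u \<le> c * C * c * dirichlet_energy u + (c * C * c * dirichlet_energy g + c * norm_power g)"
    if u: "u \<in> admissible p M \<Omega> g" for u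
  proof -
    obtain w where w: "w \<in> newtonian p M UNIV" "\<And>x. x \<notin> \<Omega> \<Longrightarrow> w x = 0" "\<And>x. x \<in> \<Omega> \<Longrightarrow> u x = w x + g x"
      by (rule admissibleE[OF u]) blast
    have wM [measurable]: "w \<in> borel_measurable M" and w_fin: "(\<integral>\<^sup>+ x. ennreal (\<bar>w x\<bar> powr p) \<partial>M) < top"
      using w(1) by (auto simp: newtonian_iff)
    have [measurable]: "minimal_wug p M \<Omega> u \<in> borel_measurable N" "minimal_wug p M \<Omega> g \<in> borel_measurable N"
      using minimal_wug(1)[OF \<Omega>_borel] admissible_newtonian[OF u] g
      by (auto simp: weak_upper_gradient_def intro: borel_fun_measurable)
    have [measurable]: "g \<in> borel_measurable N" "w \<in> borel_measurable N"
      using newtonian_measurable[OF g] measurable_restrict_space1[OF wM] by auto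
    let ?k = "\<lambda>x. minimal_wug p M \<Omega> u x + minimal_wug p M \<Omega> g x"
    have "(\<integral>\<^sup>+ x. ennreal (\<bar>w x\<bar> powr p) \<partial>M) \<le> ennreal C * (\<integral>\<^sup>+ x. epowr (?k x * indicator \<Omega> x) p \<partial>M)"
      by (rule C(2)[OF wM w_fin w(2) extension_weak_upper_gradient[OF u w]])
    also have "\<dots> = ennreal C * (\<integral>\<^sup>+ x. epowr (?k x) p \<partial>N)"
      by (simp only: integral_zero_extension[OF \<Omega>_borel])
    also have "\<dots> \<le> ennreal C * (\<integral>\<^sup>+ x. ennreal c * (epowr (minimal_wug p M \<Omega> u x) p + epowr (minimal_wug p M \<Omega> g x) p) \<partial>N)"
      unfolding c_def using p by (intro mult_left_mono nn_integral_mono epowr_add_le) auto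
    also have "\<dots> = ennreal C * (ennreal c * (ennreal (dirichlet_energy u) + ennreal (dirichlet_energy g)))"
      by (simp add: nn_integral_cmult nn_integral_add dirichlet_energy[OF admissible_newtonian[OF u]] dirichlet_energy[OF g])
    finally have w_le: "(\<integral>\<^sup>+ x. ennreal (\<bar>w x\<bar> powr p) \<partial>M) \<le>
        ennreal C * (ennreal c * (ennreal (dirichlet_energy u) + ennreal (dirichlet_energy g)))" .
    have "ennreal (norm_power u) = (\<integral>\<^sup>+ x. ennreal (\<bar>u x\<bar> powr p) \<partial>N)"
      by (simp add: norm_power[OF admissible_newtonian[OF u]])
    also have "\<dots> \<le> (\<integral>\<^sup>+ x. ennreal c * (ennreal (\<bar>w x\<bar> powr p) + ennreal (\<bar>g x\<bar> powr p)) \<partial>N)"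
    proof (rule nn_integral_mono)
      fix x assume "x \<in> space N"
      then have "\<bar>u x\<bar> \<le> \<bar>w x\<bar> + \<bar>g x\<bar>" using w(3) by (simp add: space_restrict)
      then have "ennreal (\<bar>u x\<bar> powr p) \<le> epowr (ennreal \<bar>w x\<bar> + ennreal \<bar>g x\<bar>) p"
        using p by (auto intro!: ennreal_leI powr_mono2 simp flip: ennreal_plus)
      also have "\<dots> \<le> ennreal c * (epowr (ennreal \<bar>w x\<bar>) p + epowr (ennreal \<bar>g x\<bar>) p)"
        unfolding c_def using p by (intro epowr_add_le) simp
      finally show "ennreal (\<bar>u x\<bar> powr p) \<le> ennreal c * (ennreal (\<bar>w x\<bar> powr p) + ennreal (\<bar>g x\<bar> powr p))" by simp
    qed
    also have "\<dots> = ennreal c * ((\<integral>\<^sup>+ x. ennreal (\<bar>w x\<bar> powr p) \<partial>N) + ennreal (norm_power g))"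
      by (simp add: nn_integral_cmult nn_integral_add norm_power[OF g])
    also have "\<dots> \<le> ennreal c * (ennreal C * (ennreal c * (ennreal (dirichlet_energy u) +
        ennreal (dirichlet_energy g))) + ennreal (norm_power g))"
    proof (intro mult_left_mono add_right_mono order_trans[OF _ w_le])
      show "(\<integral>\<^sup>+ x. ennreal (\<bar>w x\<bar> powr p) \<partial>N) \<le> (\<integral>\<^sup>+ x. ennreal (\<bar>w x\<bar> powr p) \<partial>M)"
        using \<Omega>_borel by (subst nn_integral_restrict_space)
          (auto simp: borel_sets space_M indicator_def intro!: nn_integral_mono)
    qed simp
    also have "\<dots> = ennreal (c * (C * (c * (dirichlet_energy u + dirichlet_energy g)) + norm_power g))"
      using \<open>0 \<le> c\<close> C(1) dirichlet_energy_nonneg norm_power_nonneg by (simp flip: ennreal_mult ennreal_plus)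
    finally have "norm_power u \<le> c * (C * (c * (dirichlet_energy u + dirichlet_energy g)) + norm_power g)"
      using \<open>0 \<le> c\<close> C(1) dirichlet_energy_nonneg norm_power_nonneg by (subst (asm) ennreal_le_iff) auto
    then show ?thesis by (simp add: algebra_simps)
  qed
  then show ?thesis
    using that[of "c * C * c" "c * C * c * dirichlet_energy g + c * norm_power g"]
      \<open>0 \<le> c\<close> C(1) dirichlet_energy_nonneg norm_power_nonneg by simp
qed

text \<open>By Young's inequality the source term is at most a small multiple of \<open>\<integral>\<bar>u\<bar>\<^sup>p\<close> plus a constant, and
  \<open>\<integral>\<bar>u\<bar>\<^sup>p\<close> is in turn bounded by a multiple of the gradient term plus a constant.\<close>

lemma coercivity:
  obtains C where "0 \<le> C" "\<And>u. u \<in> admissible p M \<Omega> g \<Longrightarrow> dirichlet_energy u \<le> 2 * (energy p M \<Omega> f u + C)"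
proof -
  obtain C1 C2 where C: "0 \<le> C1" "0 \<le> C2"
    "\<And>u. u \<in> admissible p M \<Omega> g \<Longrightarrow> norm_power u \<le> C1 * dirichlet_energy u + C2"
    by (rule norm_power_bound) blast
  obtain K where K: "0 \<le> K" "\<And>v U t. v \<in> borel_measurable N \<Longrightarrow>
      (\<integral>\<^sup>+ x. ennreal (\<bar>v x\<bar> powr p) \<partial>N) = ennreal U \<Longrightarrow> 0 \<le> U \<Longrightarrow> 0 < t \<Longrightarrow>
      \<bar>LINT x|N. f x * v x\<bar> \<le> t powr (p - 1) * U + K / t"
    by (rule Young_integral[OF p f]) blast
  \<comment> \<open>With this choice the source term absorbs at most half of the gradient term.\<close>
  define t where "t = (1 / (2 * p * (C1 + 1))) powr (1 / (p - 1))"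
  have t: "0 < t" "t powr (p - 1) = 1 / (2 * p * (C1 + 1))"
    using p C(1) by (auto simp: t_def powr_powr)
  define s where "s = t powr (p - 1)"
  have "0 \<le> s" by (simp add: s_def)
  have "p * s = 1 / (2 * (C1 + 1))" using p by (simp add: s_def t)
  then have "p * s * C1 = C1 / (2 * (C1 + 1))" by simp
  also have "\<dots> \<le> 1 / 2" using C(1) by (simp add: divide_le_eq)
  finally have "p * s * C1 \<le> 1 / 2" .
  note s = \<open>0 \<le> s\<close> this
  have "dirichlet_energy u \<le> 2 * (energy p M \<Omega> f u + (p * s * C2 + p * (K / t)))"
    if u: "u \<in> admissible p M \<Omega> g" for u
  proof -
    note N = admissible_newtonian[OF u]
    have "(LINT x|N. f x * u x) \<le> s * norm_power u + K / t"
      using K(2)[OF newtonian_measurable[OF N] norm_power[OF N] norm_power_nonneg t(1)] by (simp add: s_def)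
    also have "\<dots> \<le> s * (C1 * dirichlet_energy u + C2) + K / t"
      using C(3)[OF u] s(1) by (intro add_right_mono mult_left_mono)
    finally have "p * (LINT x|N. f x * u x) \<le> p * (s * (C1 * dirichlet_energy u + C2) + K / t)"
      using p by (intro mult_left_mono) auto
    also have "\<dots> = p * s * C1 * dirichlet_energy u + (p * s * C2 + p * (K / t))"
      by (simp add: algebra_simps)
    also have "p * s * C1 * dirichlet_energy u \<le> 1 / 2 * dirichlet_energy u"
      using s(2) dirichlet_energy_nonneg by (intro mult_right_mono) auto
    finally show ?thesis by (simp add: energy_eq)
  qed
  then show ?thesis
    using that[of "p * s * C2 + p * (K / t)"] p s(1) C(2) K(1) t(1) by simp
qed

lemma energy_midpoint_le:
  assumes "u \<in> newtonian p M \<Omega>" "v \<in> newtonian p M \<Omega>"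
  shows "energy p M \<Omega> f (\<lambda>x. (u x + v x) / 2) \<le> (energy p M \<Omega> f u + energy p M \<Omega> f v) / 2"
proof -
  have [measurable]: "minimal_wug p M \<Omega> u \<in> borel_measurable N" "minimal_wug p M \<Omega> v \<in> borel_measurable N"
    using minimal_wug(1)[OF \<Omega>_borel] assms
    by (auto simp: weak_upper_gradient_def intro: borel_fun_measurable)
  have "ennreal (dirichlet_energy (\<lambda>x. (u x + v x) / 2)) \<le>
      (\<integral>\<^sup>+ x. epowr (ennreal (1 / 2) * minimal_wug p M \<Omega> u x + ennreal (1 / 2) * minimal_wug p M \<Omega> v x) p \<partial>N)"
    by (intro dirichlet_energy_le midpoint_newtonian midpoint_weak_upper_gradient assms)
  also have "\<dots> \<le> (\<integral>\<^sup>+ x. ennreal (1 / 2) * epowr (minimal_wug p M \<Omega> u x) p + ennreal (1 / 2) * epowr (minimal_wug p M \<Omega> v x) p \<partial>N)"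
    by (intro nn_integral_mono epowr_midpoint_le p)
  also have "\<dots> = ennreal (1 / 2) * ennreal (dirichlet_energy u) + ennreal (1 / 2) * ennreal (dirichlet_energy v)"
    by (simp add: nn_integral_add nn_integral_cmult dirichlet_energy assms del: ennreal_half)
  also have "\<dots> = ennreal ((dirichlet_energy u + dirichlet_energy v) / 2)"
    using dirichlet_energy_nonneg by (simp add: add_divide_distrib del: ennreal_half flip: ennreal_mult ennreal_plus)
  finally have "dirichlet_energy (\<lambda>x. (u x + v x) / 2) \<le> (dirichlet_energy u + dirichlet_energy v) / 2"
    using dirichlet_energy_nonneg by (subst (asm) ennreal_le_iff) auto
  moreover have "(LINT x|N. f x * ((u x + v x) / 2)) = ((LINT x|N. f x * u x) + (LINT x|N. f x * v x)) / 2"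
    using integrable_source assms by (simp add: distrib_left)
  ultimately show ?thesis by (simp add: energy_eq field_simps)
qed

text \<open>Near-minimizers of the energy form decreasing midpoint-convex sets; choosing in them functions of
  almost smallest norm makes the sequence converge in \<open>L\<^sup>p\<close> by uniform convexity, without any weak
  compactness.\<close>

lemma minimizing_sequence:
  obtains u and I :: real where "\<And>n::nat. u n \<in> admissible p M \<Omega> g" "(\<lambda>n. energy p M \<Omega> f (u n)) \<longlonglongrightarrow> I"
    "\<And>v. v \<in> admissible p M \<Omega> g \<Longrightarrow> I \<le> energy p M \<Omega> f v"
    "AE x in N. convergent (\<lambda>n. u n x)"
    "\<And>n. (\<integral>\<^sup>+ x. ennreal (\<bar>u n x - lim (\<lambda>n. u n x)\<bar> powr p) \<partial>N) \<le> ennreal (2 powr (- (p + 1) * real n))"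
proof -
  let ?J = "energy p M \<Omega> f" and ?Adm = "admissible p M \<Omega> g"
  obtain C where C: "0 \<le> C" "\<And>u. u \<in> ?Adm \<Longrightarrow> dirichlet_energy u \<le> 2 * (?J u + C)"
    by (rule coercivity) blast
  obtain C1 C2 where C12: "0 \<le> C1" "0 \<le> C2"
    "\<And>u. u \<in> ?Adm \<Longrightarrow> norm_power u \<le> C1 * dirichlet_energy u + C2"
    by (rule norm_power_bound) blast
  have J_bdd: "bdd_below (?J ` ?Adm)"
  proof (rule bdd_belowI2)
    fix u assume "u \<in> ?Adm"
    then show "- C \<le> ?J u" using C(2) dirichlet_energy_nonneg[of u] by fastforce
  qed
  define I where "I = Inf (?J ` ?Adm)"
  have I_le: "I \<le> ?J v" if "v \<in> ?Adm" for v
    unfolding I_def using J_bdd that by (intro cInf_lower) auto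
  define V where "V n = {u \<in> ?Adm. ?J u \<le> I + inverse (real (Suc n))}" for n
  have V_nonempty: "V n \<noteq> {}" for n
  proof -
    have "Inf (?J ` ?Adm) < I + inverse (real (Suc n))" by (simp add: I_def)
    then obtain u where "u \<in> ?Adm" "?J u < I + inverse (real (Suc n))"
      using cInf_lessD[of "?J ` ?Adm"] g_admissible by blast
    then show ?thesis by (auto simp: V_def intro: less_imp_le)
  qed
  have V_mono: "V m \<subseteq> V n" if "n \<le> m" for n m
  proof -
    have "inverse (real (Suc m)) \<le> inverse (real (Suc n))" using that by (intro le_imp_inverse_le) auto
    then have "I + inverse (real (Suc m)) \<le> I + inverse (real (Suc n))" by (rule add_left_mono)
    then show ?thesis unfolding V_def by (blast intro: order_trans)
  qed
  have V_mid: "(\<lambda>x. (u x + v x) / 2) \<in> V n" if "u \<in> V n" "v \<in> V n" for u v n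
  proof -
    have "?J (\<lambda>x. (u x + v x) / 2) \<le> (?J u + ?J v) / 2"
      using that by (intro energy_midpoint_le admissible_newtonian) (auto simp: V_def)
    also have "\<dots> \<le> I + inverse (real (Suc n))" using that by (auto simp: V_def)
    finally show ?thesis using midpoint_admissible that by (auto simp: V_def)
  qed
  define Bd where "Bd = C1 * (2 * (I + 1 + C)) + C2"
  have V_bd: "norm_power u \<le> Bd" if "u \<in> V n" for u n
  proof -
    have "u \<in> ?Adm" "?J u \<le> I + 1" using V_mono[of 0 n] that by (auto simp: V_def)
    then have "dirichlet_energy u \<le> 2 * (I + 1 + C)" using C(2)[of u] by simp
    then have "C1 * dirichlet_energy u \<le> C1 * (2 * (I + 1 + C))" using C12(1) by (rule mult_left_mono)
    then show ?thesis using C12(3)[OF \<open>u \<in> ?Adm\<close>] by (simp add: Bd_def)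
  qed
  define d where "d n = Inf (norm_power ` V n)" for n
  have bdd: "bdd_below (norm_power ` V n)" for n
    using norm_power_nonneg by (intro bdd_belowI2[of _ 0])
  have d_le: "d n \<le> norm_power u" if "u \<in> V n" for u n
    unfolding d_def using bdd that by (intro cInf_lower) auto
  have "incseq d"
    unfolding d_def incseq_def
    by (intro allI impI cInf_superset_mono image_mono V_mono bdd) (simp_all add: V_nonempty)
  moreover have "d n \<le> Bd" for n
    using V_nonempty[of n] d_le V_bd by (meson ex_in_conv order_trans)
  ultimately obtain D where D: "d \<longlonglongrightarrow> D"
    using incseq_convergent[of d Bd] by blast
  have "\<exists>u\<in>V n. norm_power u < d n + inverse (real (Suc n))" for n
    using cInf_lessD[of "norm_power ` V n" "d n + inverse (real (Suc n))"] V_nonempty[of n] by (auto simp: d_def)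
  then obtain u where u: "\<And>n. u n \<in> V n" "\<And>n. norm_power (u n) < d n + inverse (real (Suc n))"
    by metis
  have adm: "u n \<in> ?Adm" for n using u(1)[of n] by (simp add: V_def)
  note newt = admissible_newtonian[OF adm]
  have A_lim: "(\<lambda>n. norm_power (u n)) \<longlonglongrightarrow> D"
  proof (rule tendsto_sandwich[OF _ _ D])
    show "(\<lambda>n. d n + inverse (real (Suc n))) \<longlonglongrightarrow> D"
      using tendsto_add[OF D LIMSEQ_inverse_real_of_nat] by simp
  qed (use d_le u(1) less_imp_le[OF u(2)] in \<open>auto intro!: always_eventually\<close>)
  have J_lim: "(\<lambda>n. ?J (u n)) \<longlonglongrightarrow> I"
  proof (rule tendsto_sandwich[OF _ _ tendsto_const])
    show "(\<lambda>n. I + inverse (real (Suc n))) \<longlonglongrightarrow> I"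
      using tendsto_add[OF tendsto_const LIMSEQ_inverse_real_of_nat, of I] by simp
  qed (use I_le adm u(1) in \<open>auto intro!: always_eventually simp: V_def\<close>)
  have mid: "\<exists>n0. \<forall>n\<ge>n0. \<forall>m\<ge>n0. ennreal (D - e) \<le> (\<integral>\<^sup>+ x. ennreal (\<bar>(u n x + u m x) / 2\<bar> powr p) \<partial>N)"
    if "0 < e" for e
  proof -
    obtain n0 where n0: "D - e < d n0"
      using order_tendstoD(1)[OF D, of "D - e"] \<open>0 < e\<close> by (auto simp: eventually_sequentially)
    have "ennreal (D - e) \<le> (\<integral>\<^sup>+ x. ennreal (\<bar>(u n x + u m x) / 2\<bar> powr p) \<partial>N)" if "n \<ge> n0" "m \<ge> n0" for n m
    proof -
      have v: "(\<lambda>x. (u n x + u m x) / 2) \<in> V n0"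
        using V_mid u(1) V_mono that by blast
      then have "D - e \<le> norm_power (\<lambda>x. (u n x + u m x) / 2)"
        using d_le n0 by fastforce
      moreover have "(\<lambda>x. (u n x + u m x) / 2) \<in> newtonian p M \<Omega>"
        using v by (auto simp: V_def intro: admissible_newtonian)
      ultimately show ?thesis using norm_power ennreal_leI by metis
    qed
    then show ?thesis by blast
  qed
  define D2 where "D2 n m = (\<integral>\<^sup>+ x. ennreal (\<bar>u n x - u m x\<bar> powr p) \<partial>N)" for n m
  have Cauchy: "\<exists>n0. \<forall>n\<ge>n0. \<forall>m\<ge>n0. D2 n m \<le> ennreal e" if "0 < e" for e
    unfolding D2_def
    using nn_abs_powr_midpoint_Cauchy[OF p newtonian_measurable[OF newt] norm_power[OF newt]
        norm_power_nonneg A_lim mid that] .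
  have rate: "0 < 2 powr (- (p + 1) * real n)" for n by simp
  obtain \<phi> :: "nat \<Rightarrow> nat" where \<phi>: "strict_mono \<phi>"
    "\<And>n m. n \<le> m \<Longrightarrow> D2 (\<phi> n) (\<phi> m) \<le> ennreal (2 powr (- (p + 1) * real n))"
    using fast_Cauchy_subsequence[of D2 "\<lambda>n. 2 powr (- (p + 1) * real n)", OF Cauchy rate] by metis
  show ?thesis
  proof (rule that[of "\<lambda>n. u (\<phi> n)" I, OF adm _ I_le])
    show "(\<lambda>n. ?J (u (\<phi> n))) \<longlonglongrightarrow> I"
      using LIMSEQ_subseq_LIMSEQ[OF J_lim \<phi>(1)] by (simp add: comp_def)
    show "AE x in N. convergent (\<lambda>n. u (\<phi> n) x)"
      by (rule fast_Cauchy_AE_limit[OF p, of "\<lambda>n. u (\<phi> n)"])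
        (use newtonian_measurable[OF newt] \<phi>(2) in \<open>auto simp: D2_def\<close>)
    show "(\<integral>\<^sup>+ x. ennreal (\<bar>u (\<phi> n) x - lim (\<lambda>n. u (\<phi> n) x)\<bar> powr p) \<partial>N) \<le> ennreal (2 powr (- (p + 1) * real n))" for n
      by (rule fast_Cauchy_AE_limit[OF p, of "\<lambda>n. u (\<phi> n)"])
        (use newtonian_measurable[OF newt] \<phi>(2) in \<open>auto simp: D2_def\<close>)
  qed
qed

text \<open>Young's inequality with the scaling \<open>t = 2^n\<close>: the errors decay so fast that they beat the factor
  \<open>t powr (p - 1)\<close>.\<close>

lemma source_term_converges:
  assumes [measurable]: "\<And>n. u n \<in> borel_measurable N" "F \<in> borel_measurable N"
    and err: "\<And>n. (\<integral>\<^sup>+ x. ennreal (\<bar>u n x - F x\<bar> powr p) \<partial>N) \<le> ennreal (2 powr (- (p + 1) * real n))"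
    and int: "\<And>n. integrable N (\<lambda>x. f x * u n x)"
  shows "(\<lambda>n. LINT x|N. f x * u n x) \<longlonglongrightarrow> (LINT x|N. f x * F x)"
proof -
  obtain K where K: "0 \<le> K" "\<And>v U. v \<in> borel_measurable N \<Longrightarrow>
      (\<integral>\<^sup>+ x. ennreal (\<bar>v x\<bar> powr p) \<partial>N) = ennreal U \<Longrightarrow> 0 \<le> U \<Longrightarrow> integrable N (\<lambda>x. f x * v x)"
    "\<And>v U t. v \<in> borel_measurable N \<Longrightarrow>
      (\<integral>\<^sup>+ x. ennreal (\<bar>v x\<bar> powr p) \<partial>N) = ennreal U \<Longrightarrow> 0 \<le> U \<Longrightarrow> 0 < t \<Longrightarrow>
      \<bar>LINT x|N. f x * v x\<bar> \<le> t powr (p - 1) * U + K / t"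
    by (rule Young_integral[OF p f]) blast
  have bound: "\<bar>(LINT x|N. f x * u n x) - (LINT x|N. f x * F x)\<bar> \<le> (1 / 4) ^ n + K * (1 / 2) ^ n" for n
  proof -
    let ?v = "\<lambda>x. u n x - F x"
    define U where "U = enn2real (\<integral>\<^sup>+ x. ennreal (\<bar>?v x\<bar> powr p) \<partial>N)"
    have U: "(\<integral>\<^sup>+ x. ennreal (\<bar>?v x\<bar> powr p) \<partial>N) = ennreal U" "0 \<le> U"
      using le_less_trans[OF err ennreal_less_top] by (auto simp: U_def less_top)
    then have "U \<le> 2 powr (- (p + 1) * real n)" using err[of n] by simp
    have v: "?v \<in> borel_measurable N" by measurable
    have "integrable N (\<lambda>x. f x * u n x - f x * ?v x)"
      using int K(2)[OF v U] by (rule Bochner_Integration.integrable_diff)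
    then have "integrable N (\<lambda>x. f x * F x)" by (simp add: algebra_simps)
    then have "(LINT x|N. f x * u n x) - (LINT x|N. f x * F x) = (LINT x|N. f x * ?v x)"
      using int by (simp add: right_diff_distrib)
    also have "\<bar>\<dots>\<bar> \<le> (2 ^ n) powr (p - 1) * U + K / 2 ^ n"
      by (rule K(3)[OF v U]) simp
    also have "\<dots> \<le> (2 ^ n) powr (p - 1) * 2 powr (- (p + 1) * real n) + K / 2 ^ n"
      using \<open>U \<le> _\<close> by (intro add_right_mono mult_left_mono) auto
    also have "(2 ^ n) powr (p - 1) * 2 powr (- (p + 1) * real n) = 2 powr (- real (2 * n))"
      by (simp add: powr_powr algebra_simps flip: powr_realpow powr_add)
    also have "\<dots> = (1 / 4) ^ n"
      unfolding powr_minus powr_realpow[OF zero_less_numeral] by (simp add: power_mult power_one_over inverse_eq_divide)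
    finally show ?thesis by (simp add: power_one_over)
  qed
  have "(\<lambda>n. (1 / 4) ^ n + K * (1 / 2) ^ n) \<longlonglongrightarrow> 0 + K * 0"
    by (intro tendsto_intros LIMSEQ_power_zero) auto
  then have lim: "(\<lambda>n. (1 / 4) ^ n + K * (1 / 2) ^ n) \<longlonglongrightarrow> 0" by simp
  show ?thesis
    by (rule Lim_null_comparison[OF _ lim, THEN LIM_zero_cancel]) (use bound in simp)
qed

text \<open>The source terms of a minimizing sequence converge, and hence so do the gradient terms. At the midpoints
  the gradient terms are bounded below since \<open>J\<close> is at least \<open>I\<close> there, which is the hypothesis
  for convergence of the gradients. The differences \<open>w n\<close> from \<open>g\<close>, extended by zero, are treated in
  parallel on the whole space: their upper limit \<open>v\<close> vanishes outside \<open>\<Omega>\<close> everywhere, not only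
  almost everywhere, and \<open>v + g\<close> is the minimizer.\<close>

lemma minimizer_exists:
  "\<exists>u0\<in>admissible p M \<Omega> g. \<forall>v\<in>admissible p M \<Omega> g. energy p M \<Omega> f u0 \<le> energy p M \<Omega> f v"
proof -
  let ?J = "energy p M \<Omega> f" and ?Adm = "admissible p M \<Omega> g"
  obtain u and I :: real where u: "\<And>n::nat. u n \<in> ?Adm" "(\<lambda>n. ?J (u n)) \<longlonglongrightarrow> I"
      "\<And>v. v \<in> ?Adm \<Longrightarrow> I \<le> ?J v"
    and conv: "AE x in N. convergent (\<lambda>n. u n x)"
    and err: "\<And>n. (\<integral>\<^sup>+ x. ennreal (\<bar>u n x - lim (\<lambda>n. u n x)\<bar> powr p) \<partial>N) \<le> ennreal (2 powr (- (p + 1) * real n))"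
    by (rule minimizing_sequence) blast
  note newt = admissible_newtonian[OF u(1)]
  note [measurable] = newtonian_measurable[OF newt] newtonian_measurable[OF g]
  define F where "F x = lim (\<lambda>n. u n x)" for x
  have F [measurable]: "F \<in> borel_measurable N" unfolding F_def by measurable
  define P where "P = (LINT x|N. f x * F x)"
  have P_lim: "(\<lambda>n. LINT x|N. f x * u n x) \<longlonglongrightarrow> P"
    unfolding P_def
    by (rule source_term_converges) (use err integrable_source[OF newt] in \<open>auto simp: F_def\<close>)
  \<comment> \<open>The limit of the gradient terms, since \<open>J (u n)\<close> tends to \<open>I\<close>.\<close>
  define L where "L = I + p * P"
  have A_lim: "(\<lambda>n. dirichlet_energy (u n)) \<longlonglongrightarrow> L"
    using tendsto_add[OF u(2) tendsto_mult[OF tendsto_const[of p] P_lim]] by (simp add: energy_eq L_def)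
  have mid: "\<exists>n0. \<forall>n\<ge>n0. \<forall>m\<ge>n0. ennreal (L - e) \<le> (\<integral>\<^sup>+ x. epowr (ennreal (1 / 2) * minimal_wug p M \<Omega> (u n) x +
      ennreal (1 / 2) * minimal_wug p M \<Omega> (u m) x) p \<partial>N)" if "0 < e" for e
  proof -
    obtain n0 where n0: "\<And>n. n \<ge> n0 \<Longrightarrow> P - e / p < (LINT x|N. f x * u n x)"
    proof -
      have "P - e / p < P" using \<open>0 < e\<close> p by simp
      from order_tendstoD(1)[OF P_lim this] show ?thesis
        using that by (auto simp: eventually_sequentially)
    qed
    have "ennreal (L - e) \<le> (\<integral>\<^sup>+ x. epowr (ennreal (1 / 2) * minimal_wug p M \<Omega> (u n) x +
      ennreal (1 / 2) * minimal_wug p M \<Omega> (u m) x) p \<partial>N)" if nm: "n \<ge> n0" "m \<ge> n0" for n m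
    proof -
      let ?v = "\<lambda>x. (u n x + u m x) / 2"
      have "(LINT x|N. f x * ?v x) = ((LINT x|N. f x * u n x) + (LINT x|N. f x * u m x)) / 2"
        using integrable_source[OF newt] by (simp add: distrib_left)
      moreover have "c \<le> X" if "X = (A + B) / 2" "c < A" "c < B" for c X A B :: real
        using that by simp
      ultimately have "P - e / p \<le> (LINT x|N. f x * ?v x)" using n0[OF nm(1)] n0[OF nm(2)] by blast
      then have "p * (P - e / p) \<le> p * (LINT x|N. f x * ?v x)" using p by (intro mult_left_mono) auto
      moreover have "I \<le> ?J ?v" by (rule u(3)[OF midpoint_admissible[OF u(1) u(1)]])
      ultimately have "L - e \<le> dirichlet_energy ?v" using p by (simp add: energy_eq L_def algebra_simps)
      then have "ennreal (L - e) \<le> ennreal (dirichlet_energy ?v)" by (rule ennreal_leI)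
      also have "\<dots> \<le> (\<integral>\<^sup>+ x. epowr (ennreal (1 / 2) * minimal_wug p M \<Omega> (u n) x +
          ennreal (1 / 2) * minimal_wug p M \<Omega> (u m) x) p \<partial>N)"
        by (intro dirichlet_energy_le midpoint_newtonian midpoint_weak_upper_gradient newt)
      finally show ?thesis .
    qed
    then show ?thesis by blast
  qed
  obtain \<psi> :: "nat \<Rightarrow> nat" and h and e :: "nat \<Rightarrow> 'a \<Rightarrow> ennreal" where \<psi>: "strict_mono \<psi>"
    and h: "borel_fun_on \<Omega> h" "(\<integral>\<^sup>+ x. epowr (h x) p \<partial>N) \<le> ennreal L"
    and e: "\<And>n. borel_fun_on \<Omega> (e n)" "\<And>n x. minimal_wug p M \<Omega> (u (\<psi> n)) x \<le> h x + e n x"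
      "\<And>n. (\<integral>\<^sup>+ x. epowr (e n x) p \<partial>N) \<le> ennreal (2 powr (- (p + 1) * real n))"
    by (rule gradients_converge[OF \<Omega>_borel minimal_wug(1)[OF \<Omega>_borel newt] dirichlet_energy[OF newt]
          dirichlet_energy_nonneg A_lim mid]) blast+
  define Q where "Q n w \<longleftrightarrow> w \<in> newtonian p M UNIV \<and> (\<forall>x. x \<notin> \<Omega> \<longrightarrow> w x = 0) \<and> (\<forall>x\<in>\<Omega>. u (\<psi> n) x = w x + g x)" for n w
  have "\<exists>w. Q n w" for n
    by (rule admissibleE[OF u(1)[of "\<psi> n"]]) (auto simp: Q_def)
  then obtain w where "\<And>n. Q n (w n)" by metis
  then have w: "\<And>n. w n \<in> newtonian p M UNIV" "\<And>n x. x \<notin> \<Omega> \<Longrightarrow> w n x = 0"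
    "\<And>n x. x \<in> \<Omega> \<Longrightarrow> u (\<psi> n) x = w n x + g x"
    by (auto simp: Q_def)
  have [measurable]: "w n \<in> borel_measurable M" for n using w(1)[of n] by (auto simp: newtonian_iff)
  define v where "v x = real_of_ereal (limsup (\<lambda>n. ereal (w n x)))" for x
  have v_M [measurable]: "v \<in> borel_measurable M" unfolding v_def by measurable
  have v_N [measurable]: "v \<in> borel_measurable N" by (rule measurable_restrict_space1[OF v_M])
  have v0: "v x = 0" if "x \<notin> \<Omega>" for x using w(2)[OF that] by (simp add: v_def Limsup_const zero_ereal_def[symmetric])
  have v_limsup: "ereal (v x) = limsup (\<lambda>n. ereal (w n x))" if "Bseq (\<lambda>n. w n x)" for x
    unfolding v_def using that by (rule limsup_Bseq)
  define u0 where "u0 x = v x + g x" for x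
  have u0_limsup: "ereal (u0 x) = limsup (\<lambda>n. ereal (u (\<psi> n) x))" if x: "x \<in> \<Omega>" "Bseq (\<lambda>n. u (\<psi> n) x)" for x
  proof -
    have "Bseq (\<lambda>n. u (\<psi> n) x + (- g x))" using x(2) by (rule Bseq_add)
    then have "Bseq (\<lambda>n. w n x)" using w(3)[OF x(1)] by simp
    then have "ereal (u0 x) = limsup (\<lambda>n. ereal (w n x)) + ereal (g x)"
      by (simp add: u0_def flip: v_limsup)
    also have "\<dots> = limsup (\<lambda>n. ereal (w n x) + ereal (g x))"
      by (rule Limsup_add_ereal_right[symmetric]) auto
    finally show ?thesis using w(3)[OF x(1)] by simp
  qed
  have sub_lim: "AE x in N. (\<lambda>n. u (\<psi> n) x) \<longlonglongrightarrow> F x"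
    using conv
  proof eventually_elim
    case (elim x)
    then have "(\<lambda>n. u n x) \<longlonglongrightarrow> F x" by (simp add: F_def convergent_LIMSEQ_iff)
    then show ?case using LIMSEQ_subseq_LIMSEQ[OF _ \<psi>] by (auto simp: comp_def)
  qed
  have sub_bdd: "AE x in N. Bseq (\<lambda>n. u (\<psi> n) x)"
    using sub_lim by eventually_elim (auto intro: convergent_imp_Bseq convergentI)
  have u0_F: "AE x in N. u0 x = F x"
    using sub_lim sub_bdd AE_space
  proof eventually_elim
    case (elim x)
    then have "ereal (u0 x) = limsup (\<lambda>n. ereal (u (\<psi> n) x))" using u0_limsup by (simp add: space_restrict)
    also have "\<dots> = ereal (F x)"
      by (intro lim_imp_Limsup tendsto_ereal elim(1)) simp
    finally show ?case by simp
  qed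
  have h_fin: "(\<integral>\<^sup>+ x. epowr (h x) p \<partial>N) < top"
    using h(2) ennreal_less_top by (rule le_less_trans)
  have h_wug: "weak_upper_gradient p M \<Omega> u0 h"
    using minimal_wug(1)[OF \<Omega>_borel newt] h e sub_bdd u0_limsup
    by (intro weak_upper_gradient_limit[OF \<Omega>_borel, of "\<lambda>n. u (\<psi> n)" "\<lambda>n. minimal_wug p M \<Omega> (u (\<psi> n))" h e])
  have gg: "borel_fun_on \<Omega> (minimal_wug p M \<Omega> g)" "(\<integral>\<^sup>+ x. epowr (minimal_wug p M \<Omega> g x) p \<partial>N) < top"
    using minimal_wug(1,2)[OF \<Omega>_borel g] by (auto simp: weak_upper_gradient_def)
  let ?k = "\<lambda>x. h x + minimal_wug p M \<Omega> g x"
  have bk: "borel_fun_on \<Omega> ?k" by (rule borel_fun_on_add[OF h(1) gg(1)])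
  have v_wug: "weak_upper_gradient p M UNIV v (\<lambda>x. ?k x * indicator \<Omega> x)"
  proof (rule weak_upper_gradient_limit)
    show "weak_upper_gradient p M UNIV (w n)
        (\<lambda>x. (minimal_wug p M \<Omega> (u (\<psi> n)) x + minimal_wug p M \<Omega> g x) * indicator \<Omega> x)" for n
      by (rule extension_weak_upper_gradient[OF u(1) w])
    show "borel_fun_on UNIV (\<lambda>x. ?k x * indicator \<Omega> x)" "borel_fun_on UNIV (\<lambda>x. e n x * indicator \<Omega> x)" for n
      by (intro borel_fun_on_zero_extension \<Omega>_borel bk e)+
    show "(minimal_wug p M \<Omega> (u (\<psi> n)) x + minimal_wug p M \<Omega> g x) * indicator \<Omega> x \<le>
        ?k x * indicator \<Omega> x + e n x * indicator \<Omega> x" for n x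
      using add_right_mono[OF e(2)[of n x], of "minimal_wug p M \<Omega> g x"] by (auto simp: indicator_def ac_simps)
    show "(\<integral>\<^sup>+ x. epowr (e n x * indicator \<Omega> x) p \<partial>restrict_space M UNIV) \<le> ennreal (2 powr (- (p + 1) * real n))" for n
      using e(3) by (simp add: integral_zero_extension[OF \<Omega>_borel])
    have "AE x in M. x \<in> \<Omega> \<longrightarrow> Bseq (\<lambda>n. u (\<psi> n) x)"
      using sub_bdd \<Omega>_borel by (subst (asm) AE_restrict_space_iff) (auto simp: borel_sets space_M)
    then show "AE x in restrict_space M UNIV. Bseq (\<lambda>n. w n x)"
      unfolding restrict_space_UNIV
    proof eventually_elim
      case (elim x)
      show ?case
      proof (cases "x \<in> \<Omega>")
        case True
        then have "Bseq (\<lambda>n. u (\<psi> n) x + (- g x))" using elim by (intro Bseq_add) simp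
        then show ?thesis using w(3)[OF True] by simp
      qed (simp add: w(2) Bseq_const)
    qed
  qed (auto intro: v_limsup)
  have F_fin: "(\<integral>\<^sup>+ x. ennreal (\<bar>F x\<bar> powr p) \<partial>N) < top"
  proof -
    have "(\<integral>\<^sup>+ x. ennreal (\<bar>u 0 x - F x\<bar> powr p) \<partial>N) < top"
      using le_less_trans[OF err[of 0] ennreal_less_top] by (simp add: F_def)
    moreover have "(\<integral>\<^sup>+ x. ennreal (\<bar>u 0 x\<bar> powr p) \<partial>N) < top"
      by (simp add: norm_power[OF newt])
    ultimately show ?thesis
      using integral_abs_powr_add_less_top[of "u 0" N "\<lambda>x. u 0 x - F x" 1 "-1"] by simp
  qed
  have "(\<integral>\<^sup>+ x. ennreal (\<bar>u0 x\<bar> powr p) \<partial>N) = (\<integral>\<^sup>+ x. ennreal (\<bar>F x\<bar> powr p) \<partial>N)"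
    using u0_F by (intro nn_integral_cong_AE) (auto elim!: eventually_mono)
  then have u0_fin: "(\<integral>\<^sup>+ x. ennreal (\<bar>u0 x\<bar> powr p) \<partial>N) < top" using F_fin by simp
  have [measurable]: "u0 \<in> borel_measurable N" unfolding u0_def by measurable
  have u0_newt: "u0 \<in> newtonian p M \<Omega>"
    unfolding newtonian_iff using u0_fin h_wug h_fin by auto
  have "(\<integral>\<^sup>+ x. ennreal (\<bar>v x\<bar> powr p) \<partial>M) = (\<integral>\<^sup>+ x. ennreal (\<bar>v x\<bar> powr p) \<partial>N)"
    using \<Omega>_borel v0 by (subst nn_integral_restrict_space)
      (auto simp: borel_sets space_M indicator_def intro!: nn_integral_cong)
  also have "\<dots> < top"
    using integral_abs_powr_add_less_top[of u0 N g 1 "-1"] u0_fin norm_power[OF g] by (simp add: u0_def)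
  finally have "(\<integral>\<^sup>+ x. ennreal (\<bar>v x\<bar> powr p) \<partial>M) < top" .
  moreover have "(\<integral>\<^sup>+ x. epowr (?k x * indicator \<Omega> x) p \<partial>M) < top"
    unfolding integral_zero_extension[OF \<Omega>_borel]
    using h(1) h_fin gg by (intro integral_epowr_add_less_top)
  ultimately have "v \<in> newtonian p M UNIV"
    unfolding newtonian_iff using v_wug by auto
  then have u0_adm: "u0 \<in> ?Adm"
    by (rule admissibleI[OF u0_newt]) (auto simp: v0 u0_def)
  have "(LINT x|N. f x * u0 x) = P"
    unfolding P_def
  proof (rule integral_cong_AE)
    show "AE x in N. f x * u0 x = f x * F x" using u0_F by eventually_elim simp
  qed (use f in \<open>auto simp: Lp_iff\<close>)
  moreover have "ennreal (dirichlet_energy u0) \<le> ennreal L"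
    using dirichlet_energy_le[OF u0_newt h_wug] h(2) by (rule order_trans)
  moreover have "0 \<le> L"
    using A_lim dirichlet_energy_nonneg by (intro LIMSEQ_le_const[OF A_lim]) auto
  ultimately have "?J u0 \<le> I" by (simp add: energy_eq L_def)
  then show ?thesis using u0_adm u(3) by (meson order_trans)
qed

end

theorem theorem4p1:
  fixes M :: "'a::complete_space measure"
    and p :: real
    and \<Omega> :: "'a set"
    and f g :: "'a \<Rightarrow> real"
  assumes "1 < p"
    and "borel_regular M"
    and "doubling M"
    and "poincare p M"
    and "\<Omega> \<noteq> {}" and "bounded \<Omega>" and "open \<Omega>" and "connected \<Omega>"
    and "emeasure M (UNIV - \<Omega>) > 0"
    and "f \<in> Lp (p / (p - 1)) (restrict_space M \<Omega>)"
    and "g \<in> newtonian p M \<Omega>"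
  shows "\<exists>u0. dirichlet_solution p M \<Omega> f g u0"
proof -
  interpret dirichlet_problem M p \<Omega> f g
    using assms by unfold_locales auto
  obtain u0 where u0: "u0 \<in> admissible p M \<Omega> g"
    "\<And>v. v \<in> admissible p M \<Omega> g \<Longrightarrow> energy p M \<Omega> f u0 \<le> energy p M \<Omega> f v"
    using minimizer_exists by blast
  then have "ereal (energy p M \<Omega> f u0) = (INF u \<in> admissible p M \<Omega> g. ereal (energy p M \<Omega> f u))"
    by (intro antisym INF_greatest INF_lower) auto
  then show ?thesis using u0(1) by (auto simp: dirichlet_solution_def)
qed

end
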